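(* Let $\mathscr M$ be a set of decorated representations of $\Lambda$ supported in $[n]$. Suppose that the following two conditions are satisfied: (1) $\mathrm{Ker}(B)\cap\mathbb Z_{\ge0}^n=0$; (2) for any $\mathcal M,\mathcal M'\in\mathscr M$, if $\mathcal M\ne\mathcal M'$ then $\mathbf g_{\mathcal M}^\Lambda\neq\mathbf g_{\mathcal M'}^\Lambda$. Then $CC_{\widetilde\Lambda}(\mathscr M):=\{CC_{\widetilde\Lambda}(\mathcal M)\mid\mathcal M\in\mathscr M\}$ is an $R$-linearly independent subset of the Laurent polynomial ring $R[x_1^{\pm1},\dots,x_n^{\pm1}]$.
   Context: Let $n\ge 1$, $m\ge 0$ be integers and $[\ell]=\{1,\dots,\ell\}$. Let $\widetilde Q$ be a finite quiver with vertex set $[n+m]$ and arrows $a\colon s(a)\to t(a)$; $Q$ is the quiver with the same vertex set $[n+m]$ whose arrows are the arrows of $\widetilde Q$ with both endpoints in $[n]$. Paths are composed from right to left. $\mathbb C\langle\langle \widetilde Q\rangle\rangle$ and $\mathbb C\langle\langle Q\rangle\rangle$ are the complete path algebras, with arrow ideals $\widetilde{\mathfrak m}$, $\mathfrak m$ and the corresponding adic topologies. $\widehat\rho\colon \mathbb C\langle\langle \widetilde Q\rangle\rangle\to\mathbb C\langle\langle Q\rangle\rangle$ is the continuous $\mathbb C$-algebra homomorphism that is the identity on vertex idempotents and on arrows of $Q$ and sends all other arrows to $0$. $\widetilde{\mathcal J}\subseteq\widetilde{\mathfrak m}^2$ is a closed two-sided ideal, $\mathcal J:=\widehat\rho(\widetilde{\mathcal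 J})$, $\widetilde\Lambda:=\mathbb C\langle\langle \widetilde Q\rangle\rangle/\widetilde{\mathcal J}$ and $\Lambda:=\mathbb C\langle\langle Q\rangle\rangle/\mathcal J$ (neither is assumed finite-dimensional). Via $\widehat\rho$, every left $\Lambda$-module is a left $\widetilde\Lambda$-module. $\widetilde B\in\mathbb Z^{(n+m)\times n}$ has entries $\widetilde b_{ij}=\#\{\text{arrows } j\to i\text{ in }\widetilde Q\}-\#\{\text{arrows } i\to j\text{ in }\widetilde Q\}$, and $B$ is its top $n\times n$ submatrix (skew-symmetric). No rank assumption is made on $B$ or $\widetilde B$. A decorated representation of $\Lambda$ is a pair $\mathcal M=(M,\mathbf v)$ with $M$ a finite-dimensional left $\Lambda$-module and $\mathbf v=(v_j)\in\mathbb Z_{\ge0}^{n+m}$; it is supported in $[n]$ if $M_j=0$ and $v_j=0$ for all $j\in\{n+1,\dots,n+m\}$. $S(i)$ is the simple module at vertex $i$. For $\mathcal M$ supported in $[n]$, $\mathbf g_{\mathcal M}^\Lambda=(g_i)_{i=1}^n$ and $\widetilde{\mathbf g}_{\mathcal M}^{\widetilde\Lambda}=(\widetilde g_i)_{i=1}^{n+m}$ are defined by $g_i=-\dim\mathrm{Hom}_\Lambda(S(i),M)+\dim\mathrm{Ext}^1_\Lambda(S(i),M)+v_i$ and $\widetilde g_i=-\dim\mathrm{Hom}_{\widetilde\Lambda}(S(i),M)+\dim\mathrm{Ext}^1_{\widetilde\Lambda}(S(i),M)+v_i$. Let $x_1,\dots,x_{n+m}$ be algebraically independent over $\mathbb Q$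 and $R:=\mathbb Q[x_{n+1}^{\pm1},\dots,x_{n+m}^{\pm1}]$. For $\mathcal M=(M,\mathbf v)$ supported in $[n]$, the Caldero–Chapoton function with coefficients extracted from $\widetilde\Lambda$ is $$CC_{\widetilde\Lambda}(\mathcal M):=\sum_{\mathbf e\in\mathbb Z_{\ge0}^n}\chi(\mathrm{Gr}_{\mathbf e}(M))\,\mathbf x^{\widetilde B\mathbf e+\widetilde{\mathbf g}_{\mathcal M}^{\widetilde\Lambda}},\qquad \mathbf x^{\mathbf f}:=x_1^{f_1}\cdots x_{n+m}^{f_{n+m}},$$ where $\mathrm{Gr}_{\mathbf e}(M)$ is the quiver Grassmannian of subrepresentations of $M$ with dimension vector $\mathbf e$ and $\chi$ is the Euler characteristic. *)

theory Defs
  imports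
    "HOL-Algebra.QuotRing"
    "HOL-Algebra.Ideal_Product"
    "HOL-Homology.Homology"
    "HOL-Library.Poly_Mapping"
    "Graph_Theory.Arc_Walk"
    "Jordan_Normal_Form.VS_Connect"
begin

hide_const (open) Wellorder_Constructions.zero

section \<open>Complete path algebras\<close>

text \<open>
  A quiver is a \<open>pre_digraph\<close> with vertices in \<open>nat\<close>; an arrow \<open>a\<close> has source \<open>tail Q a\<close> and
  target \<open>head Q a\<close>. The path \<open>a\<^sub>k \<dots> a\<^sub>1\<close> (composed from right to left) is encoded by its starting
  vertex together with the list \<open>[a\<^sub>1, \<dots>, a\<^sub>k]\<close> of its arrows in the order of traversal; the
  path of length 0 at \<open>u\<close> is \<open>(u, [])\<close>. An element of the complete path algebra is the
  function giving the coefficient of each path.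
\<close>

type_synonym 'a path_series = "nat \<times> 'a list \<Rightarrow> complex"

definition quiver_paths :: "(nat, 'a) pre_digraph \<Rightarrow> (nat \<times> 'a list) set" where
  "quiver_paths Q = {(u, p). \<exists>v. pre_digraph.awalk Q u p v}"

text \<open>
  In a product \<open>f g\<close> the right factor is traversed first: the coefficient of a path is the sum
  over its initial segments, read off from \<open>g\<close>, and the complementary final segments, read off
  from \<open>f\<close>.
\<close>

definition path_algebra :: "(nat, 'a) pre_digraph \<Rightarrow> 'a path_series ring" where
  "path_algebra Q = \<lparr>
     carrier = {f. \<forall>w. w \<notin> quiver_paths Q \<longrightarrow> f w = 0},
     mult = (\<lambda>f g (u, p). \<Sum>k\<le>length p.
        f (last (pre_digraph.awalk_verts Q u (take k p)), drop k p) * g (u, take k p)),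
     one = (\<lambda>(u, p). if u \<in> verts Q \<and> p = [] then 1 else 0),
     zero = (\<lambda>_. 0),
     add = (\<lambda>f g w. f w + g w)\<rparr>"

definition path_elt :: "nat \<times> 'a list \<Rightarrow> 'a path_series" where
  "path_elt w = (\<lambda>w'. if w' = w then 1 else 0)"

definition path_scalar :: "(nat, 'a) pre_digraph \<Rightarrow> complex \<Rightarrow> 'a path_series" where
  "path_scalar Q c = (\<lambda>w. c * \<one>\<^bsub>path_algebra Q\<^esub> w)"

definition arrow_ideal :: "(nat, 'a) pre_digraph \<Rightarrow> 'a path_series set" where
  "arrow_ideal Q = genideal (path_algebra Q) ((\<lambda>a. path_elt (tail Q a, [a])) ` arcs Q)"

primrec ideal_pow :: "('r, 'm) ring_scheme \<Rightarrow> 'r set \<Rightarrow> nat \<Rightarrow> 'r set" where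
  "ideal_pow R I 0 = carrier R"
| "ideal_pow R I (Suc k) = ideal_prod R I (ideal_pow R I k)"

definition adic_topology :: "('r, 'm) ring_scheme \<Rightarrow> 'r set \<Rightarrow> 'r topology" where
  "adic_topology R I = topology (\<lambda>U. U \<subseteq> carrier R \<and> (\<forall>f\<in>U. \<exists>k. ideal_pow R I k +>\<^bsub>R\<^esub> f \<subseteq> U))"

definition inner_quiver :: "nat \<Rightarrow> (nat, 'a) pre_digraph \<Rightarrow> (nat, 'a) pre_digraph" where
  "inner_quiver n Q = Q\<lparr>arcs := {a \<in> arcs Q. tail Q a \<in> {1..n} \<and> head Q a \<in> {1..n}}\<rparr>"

text \<open>
  \<open>inner_proj n Q\<close> is the continuous algebra homomorphism from \<open>path_algebra Q\<close> to
  \<open>path_algebra (inner_quiver n Q)\<close> that fixes the vertex idempotents and the arrows of the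
  subquiver and kills the other arrows: it deletes all paths using a killed arrow. These
  properties are verified below.
\<close>

definition inner_proj :: "nat \<Rightarrow> (nat, 'a) pre_digraph \<Rightarrow> 'a path_series \<Rightarrow> 'a path_series" where
  "inner_proj n Q f = (\<lambda>w. if w \<in> quiver_paths (inner_quiver n Q) then f w else 0)"

lemma last_awalk_verts:
  "last (pre_digraph.awalk_verts Q u p) = (if p = [] then u else head Q (last p))"
  by (simp add: pre_digraph.awalk_verts_conv)

lemma last_awalk_verts_append:
  "last (pre_digraph.awalk_verts Q (last (pre_digraph.awalk_verts Q u p)) q)
    = last (pre_digraph.awalk_verts Q u (p @ q))"
  by (simp add: last_awalk_verts)

lemma path_algebra_mult:
  "(f \<otimes>\<^bsub>path_algebra Q\<^esub> g) (u, p) = (\<Sum>k\<le>length p.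
     f (last (pre_digraph.awalk_verts Q u (take k p)), drop k p) * g (u, take k p))"
  by (simp add: path_algebra_def)

lemma path_algebra_simps:
  "f \<in> carrier (path_algebra Q) \<longleftrightarrow> (\<forall>w. w \<notin> quiver_paths Q \<longrightarrow> f w = 0)"
  "\<one>\<^bsub>path_algebra Q\<^esub> (u, p) = (if u \<in> verts Q \<and> p = [] then 1 else 0)"
  "\<zero>\<^bsub>path_algebra Q\<^esub> = (\<lambda>_. 0)"
  "f \<oplus>\<^bsub>path_algebra Q\<^esub> g = (\<lambda>w. f w + g w)"
  by (simp_all add: path_algebra_def)

lemma quiver_paths_Nil: "(u, []) \<in> quiver_paths Q \<longleftrightarrow> u \<in> verts Q"
  by (auto simp: quiver_paths_def pre_digraph.awalk_def pre_digraph.cas.simps)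

lemma quiver_paths_split:
  assumes "wf_digraph Q"
  shows "(u, p @ q) \<in> quiver_paths Q \<longleftrightarrow>
    (u, p) \<in> quiver_paths Q \<and> (last (pre_digraph.awalk_verts Q u p), q) \<in> quiver_paths Q"
proof -
  interpret wf_digraph Q by fact
  show ?thesis
    using awalk_append_iff[of u p q] awlast_if_cas[of u p]
    unfolding quiver_paths_def mem_Collect_eq case_prod_conv awalk_def by metis
qed

lemma last_awalk_verts_in_verts:
  assumes "wf_digraph Q" "(u, p) \<in> quiver_paths Q"
  shows "last (pre_digraph.awalk_verts Q u p) \<in> verts Q"
  using quiver_paths_split[OF assms(1), of u p "[]"] assms(2) by (simp add: quiver_paths_Nil)

lemma ring_path_algebra:
  fixes Q :: "(nat, 'a) pre_digraph"
  assumes "wf_digraph Q"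
  shows "ring (path_algebra Q)"
proof (rule ringI)
  let ?R = "path_algebra Q"
  let ?l = "\<lambda>u p. last (pre_digraph.awalk_verts Q u p)"
  show "abelian_group ?R"
  proof (rule abelian_groupI)
    fix f assume "f \<in> carrier ?R"
    then show "\<exists>g\<in>carrier ?R. g \<oplus>\<^bsub>?R\<^esub> f = \<zero>\<^bsub>?R\<^esub>"
      by (intro bexI[of _ "\<lambda>w. - f w"]) (auto simp: path_algebra_simps)
  qed (auto simp: path_algebra_simps algebra_simps)
  have closed: "f \<otimes>\<^bsub>?R\<^esub> g \<in> carrier ?R" if "f \<in> carrier ?R" "g \<in> carrier ?R" for f g
    unfolding path_algebra_simps(1)
  proof (intro allI impI)
    fix w assume w: "w \<notin> quiver_paths Q"
    obtain u p where [simp]: "w = (u, p)" by force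
    have "f (?l u (take k p), drop k p) * g (u, take k p) = 0" for k
      using quiver_paths_split[OF assms, of u "take k p" "drop k p"] w that
      by (auto simp: path_algebra_simps)
    then show "(f \<otimes>\<^bsub>?R\<^esub> g) w = 0" by (simp add: path_algebra_mult)
  qed
  show "monoid ?R"
  proof (rule monoidI)
    show "f \<otimes>\<^bsub>?R\<^esub> g \<in> carrier ?R" if "f \<in> carrier ?R" "g \<in> carrier ?R" for f g
      using closed that .
    show "\<one>\<^bsub>?R\<^esub> \<in> carrier ?R" by (auto simp: path_algebra_simps quiver_paths_Nil)
    show "f \<otimes>\<^bsub>?R\<^esub> g \<otimes>\<^bsub>?R\<^esub> h = f \<otimes>\<^bsub>?R\<^esub> (g \<otimes>\<^bsub>?R\<^esub> h)" for f g h
    proof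
      fix w :: "nat \<times> 'a list"
      obtain u p where [simp]: "w = (u, p)" by force
      have l: "?l (?l u (take k p)) (drop k (take (k + i) p)) = ?l u (take (k + i) p)" for k i
        using last_awalk_verts_append[of Q u "take k p" "take i (drop k p)"]
        by (simp only: drop_take diff_add_inverse take_add[symmetric])
      let ?t = "\<lambda>i k. f (?l u (take k p), drop k p) * g (?l u (take i p), drop i (take k p)) * h (u, take i p)"
      have "(f \<otimes>\<^bsub>?R\<^esub> g \<otimes>\<^bsub>?R\<^esub> h) w = (\<Sum>i\<le>length p. \<Sum>k\<le>length p - i.
          f (?l u (take (i + k) p), drop (i + k) p) * g (?l u (take i p), drop i (take (i + k) p)) * h (u, take i p))"
        by (simp add: path_algebra_mult sum_distrib_right l add.commute[of _ i for i :: nat] take_drop)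
      also have "\<dots> = (\<Sum>i\<le>length p. \<Sum>k\<in>{i..length p}. ?t i k)"
        by (intro sum.cong refl sum.reindex_bij_witness[of _ "\<lambda>k. k - i" "\<lambda>k. i + k" for i]) auto
      also have "\<dots> = (\<Sum>k\<le>length p. \<Sum>i\<le>k. ?t i k)"
        unfolding sum.Sigma[OF finite_atMost ballI[OF finite_atLeastAtMost]]
          sum.Sigma[OF finite_atMost ballI[OF finite_atMost]]
        by (intro sum.reindex_bij_witness[of _ "\<lambda>(a, b). (b, a)" "\<lambda>(a, b). (b, a)"]) auto
      also have "\<dots> = (f \<otimes>\<^bsub>?R\<^esub> (g \<otimes>\<^bsub>?R\<^esub> h)) w"
        by (auto simp: path_algebra_mult sum_distrib_left mult.assoc min_def intro!: sum.cong split: if_splits)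
      finally show "(f \<otimes>\<^bsub>?R\<^esub> g \<otimes>\<^bsub>?R\<^esub> h) w = (f \<otimes>\<^bsub>?R\<^esub> (g \<otimes>\<^bsub>?R\<^esub> h)) w" .
    qed
    show "\<one>\<^bsub>?R\<^esub> \<otimes>\<^bsub>?R\<^esub> f = f" if f: "f \<in> carrier ?R" for f
    proof
      fix w :: "nat \<times> 'a list"
      obtain u p where [simp]: "w = (u, p)" by force
      have "(\<one>\<^bsub>?R\<^esub> \<otimes>\<^bsub>?R\<^esub> f) w = (\<Sum>k\<le>length p. if k = length p then f (u, p) else 0)"
        unfolding path_algebra_mult \<open>w = (u, p)\<close>
        using last_awalk_verts_in_verts[OF assms, of u p] f
        by (intro sum.cong) (auto simp: path_algebra_simps)
      then show "(\<one>\<^bsub>?R\<^esub> \<otimes>\<^bsub>?R\<^esub> f) w = f w" by simp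
    qed
    show "f \<otimes>\<^bsub>?R\<^esub> \<one>\<^bsub>?R\<^esub> = f" if f: "f \<in> carrier ?R" for f
    proof
      fix w :: "nat \<times> 'a list"
      obtain u p where [simp]: "w = (u, p)" by force
      have "u \<in> verts Q" if "f (u, p) \<noteq> 0"
        using f that by (auto simp: path_algebra_simps quiver_paths_def pre_digraph.awalk_def)
      then have "(f \<otimes>\<^bsub>?R\<^esub> \<one>\<^bsub>?R\<^esub>) w = (\<Sum>k\<le>length p. if k = 0 then f (u, p) else 0)"
        unfolding path_algebra_mult \<open>w = (u, p)\<close>
        by (intro sum.cong) (auto simp: path_algebra_simps last_awalk_verts)
      then show "(f \<otimes>\<^bsub>?R\<^esub> \<one>\<^bsub>?R\<^esub>) w = f w" by simp
    qed
  qed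
  show "(f \<oplus>\<^bsub>?R\<^esub> g) \<otimes>\<^bsub>?R\<^esub> h = f \<otimes>\<^bsub>?R\<^esub> h \<oplus>\<^bsub>?R\<^esub> g \<otimes>\<^bsub>?R\<^esub> h" for f g h
    by (rule ext) (auto simp: path_algebra_mult path_algebra_simps distrib_right sum.distrib)
  show "h \<otimes>\<^bsub>?R\<^esub> (f \<oplus>\<^bsub>?R\<^esub> g) = h \<otimes>\<^bsub>?R\<^esub> f \<oplus>\<^bsub>?R\<^esub> h \<otimes>\<^bsub>?R\<^esub> g" for f g h
    by (rule ext) (auto simp: path_algebra_mult path_algebra_simps distrib_left sum.distrib)
qed

lemma path_elt_in_carrier: "w \<in> quiver_paths Q \<Longrightarrow> path_elt w \<in> carrier (path_algebra Q)"
  by (auto simp: path_elt_def path_algebra_simps)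

lemma arrow_in_paths:
  assumes "wf_digraph Q" "a \<in> arcs Q"
  shows "(tail Q a, [a]) \<in> quiver_paths Q"
  using assms by (auto simp: quiver_paths_def pre_digraph.awalk_def pre_digraph.cas.simps wf_digraph_def)

lemma ideal_arrow_ideal:
  assumes "wf_digraph Q"
  shows "ideal (arrow_ideal Q) (path_algebra Q)"
  unfolding arrow_ideal_def
  by (rule ring.genideal_ideal[OF ring_path_algebra[OF assms]])
    (auto intro!: path_elt_in_carrier arrow_in_paths assms)

lemma ideal_ideal_pow:
  assumes "ideal I R"
  shows "ideal (ideal_pow R I k) R"
proof -
  interpret ideal I R by fact
  show ?thesis
    by (induct k) (auto simp: oneideal intro: ideal_prod_is_ideal assms)
qed

lemma ideal_pow_antimono:
  assumes "ideal I R" "k \<le> l"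
  shows "ideal_pow R I l \<subseteq> ideal_pow R I k"
  using assms(2)
proof (induct l rule: dec_induct)
  case (step l)
  interpret ideal I R by fact
  have "ideal_pow R I (Suc l) \<subseteq> ideal_pow R I l"
    using ideal_prod_inter[OF assms(1) ideal_ideal_pow[OF assms(1)]] by auto
  then show ?case using step by blast
qed simp

lemma openin_adic_topology:
  assumes "ideal I R"
  shows "openin (adic_topology R I) U \<longleftrightarrow>
    U \<subseteq> carrier R \<and> (\<forall>f\<in>U. \<exists>k. ideal_pow R I k +>\<^bsub>R\<^esub> f \<subseteq> U)"
proof -
  have "istopology (\<lambda>U. U \<subseteq> carrier R \<and> (\<forall>f\<in>U. \<exists>k. ideal_pow R I k +>\<^bsub>R\<^esub> f \<subseteq> U))"
    unfolding istopology_def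
  proof safe
    fix S T f
    assume *: "\<forall>f\<in>S. \<exists>k. ideal_pow R I k +>\<^bsub>R\<^esub> f \<subseteq> S" "\<forall>f\<in>T. \<exists>k. ideal_pow R I k +>\<^bsub>R\<^esub> f \<subseteq> T"
      "f \<in> S" "f \<in> T"
    then obtain k l where "ideal_pow R I k +>\<^bsub>R\<^esub> f \<subseteq> S" "ideal_pow R I l +>\<^bsub>R\<^esub> f \<subseteq> T" by blast
    moreover have "ideal_pow R I (max k l) \<subseteq> ideal_pow R I k" "ideal_pow R I (max k l) \<subseteq> ideal_pow R I l"
      by (intro ideal_pow_antimono assms; simp)+
    ultimately have "ideal_pow R I (max k l) +>\<^bsub>R\<^esub> f \<subseteq> S \<inter> T"
      unfolding a_r_coset_def' by blast
    then show "\<exists>k. ideal_pow R I k +>\<^bsub>R\<^esub> f \<subseteq> S \<inter> T" by blast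
  next
    fix \<K> f S
    assume *: "\<forall>K\<in>\<K>. K \<subseteq> carrier R \<and> (\<forall>f\<in>K. \<exists>k. ideal_pow R I k +>\<^bsub>R\<^esub> f \<subseteq> K)" "f \<in> S" "S \<in> \<K>"
    then obtain k where "ideal_pow R I k +>\<^bsub>R\<^esub> f \<subseteq> S" by blast
    then show "\<exists>k. ideal_pow R I k +>\<^bsub>R\<^esub> f \<subseteq> \<Union>\<K>" using *(3) by blast
  qed blast+
  then show ?thesis unfolding adic_topology_def by (simp add: topology_inverse')
qed

lemma topspace_adic_topology:
  assumes "ideal I R"
  shows "topspace (adic_topology R I) = carrier R"
proof -
  interpret ideal I R by fact
  have "openin (adic_topology R I) (carrier R)"
    unfolding openin_adic_topology[OF assms]
    by (auto intro!: exI[of _ 0] simp: a_r_coset_def')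
  then show ?thesis
    using openin_subset openin_adic_topology[OF assms, of "topspace (adic_topology R I)"] by blast
qed

lemma wf_digraph_inner_quiver: "wf_digraph Q \<Longrightarrow> wf_digraph (inner_quiver n Q)"
  by (auto simp: wf_digraph_def inner_quiver_def)

lemma last_awalk_verts_inner_quiver:
  "last (pre_digraph.awalk_verts (inner_quiver n Q) u p) = last (pre_digraph.awalk_verts Q u p)"
  by (simp add: last_awalk_verts inner_quiver_def)

lemma quiver_paths_inner_quiver: "quiver_paths (inner_quiver n Q) \<subseteq> quiver_paths Q"
proof -
  have "pre_digraph.cas (inner_quiver n Q) u p v = pre_digraph.cas Q u p v" for u p v
    by (induct p arbitrary: u) (simp_all add: pre_digraph.cas.simps inner_quiver_def)
  then show ?thesis
    by (auto simp: quiver_paths_def pre_digraph.awalk_def) (auto simp: inner_quiver_def)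
qed

lemma inner_proj_ring_hom:
  fixes Q :: "(nat, 'a) pre_digraph"
  assumes "wf_digraph Q"
  shows "inner_proj n Q \<in> Ring.ring_hom (path_algebra Q) (path_algebra (inner_quiver n Q))"
proof (rule ring_hom_memI)
  let ?R = "path_algebra Q" and ?S = "path_algebra (inner_quiver n Q)"
  show "inner_proj n Q (f \<otimes>\<^bsub>?R\<^esub> g) = inner_proj n Q f \<otimes>\<^bsub>?S\<^esub> inner_proj n Q g" for f g
  proof
    fix w :: "nat \<times> 'a list"
    obtain u p where [simp]: "w = (u, p)" by force
    show "inner_proj n Q (f \<otimes>\<^bsub>?R\<^esub> g) w = (inner_proj n Q f \<otimes>\<^bsub>?S\<^esub> inner_proj n Q g) w"
      using quiver_paths_split[OF wf_digraph_inner_quiver[OF assms], of u "take k p" "drop k p" n for k]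
      by (auto simp: inner_proj_def path_algebra_mult last_awalk_verts_inner_quiver intro!: sum.cong
          sum.neutral[symmetric])
  qed
  show "inner_proj n Q \<one>\<^bsub>?R\<^esub> = \<one>\<^bsub>?S\<^esub>"
  proof
    fix w :: "nat \<times> 'a list"
    obtain u p where [simp]: "w = (u, p)" by force
    show "inner_proj n Q \<one>\<^bsub>?R\<^esub> w = \<one>\<^bsub>?S\<^esub> w"
      by (auto simp: inner_proj_def path_algebra_simps quiver_paths_Nil) (auto simp: inner_quiver_def)
  qed
qed (auto simp: inner_proj_def path_algebra_simps)

lemma inner_proj_scalar:
  fixes Q :: "(nat, 'a) pre_digraph"
  shows "inner_proj n Q (path_scalar Q c) = path_scalar (inner_quiver n Q) c"
proof
  fix w :: "nat \<times> 'a list"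
  obtain u p where [simp]: "w = (u, p)" by force
  show "inner_proj n Q (path_scalar Q c) w = path_scalar (inner_quiver n Q) c w"
    by (auto simp: inner_proj_def path_scalar_def path_algebra_simps quiver_paths_Nil)
      (auto simp: inner_quiver_def)
qed

lemma inner_proj_idempotent:
  "j \<in> verts Q \<Longrightarrow> inner_proj n Q (path_elt (j, [])) = path_elt (j, [])"
  using quiver_paths_Nil[of j "inner_quiver n Q"]
  by (auto simp: inner_proj_def path_elt_def inner_quiver_def fun_eq_iff)

lemma inner_proj_arrow:
  assumes "wf_digraph Q" "a \<in> arcs Q"
  shows "inner_proj n Q (path_elt (tail Q a, [a])) =
    (if a \<in> arcs (inner_quiver n Q) then path_elt (tail Q a, [a]) else (\<lambda>_. 0))"
proof -
  have "(tail Q a, [a]) \<in> quiver_paths (inner_quiver n Q) \<longleftrightarrow> a \<in> arcs (inner_quiver n Q)"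
    using arrow_in_paths[OF wf_digraph_inner_quiver[OF assms(1)], of a n]
    by (auto simp: quiver_paths_def pre_digraph.awalk_def) (auto simp: inner_quiver_def)
  then show ?thesis by (auto simp: inner_proj_def path_elt_def fun_eq_iff)
qed

lemma inner_proj_ideal_pow:
  assumes "wf_digraph Q"
  shows "inner_proj n Q ` ideal_pow (path_algebra Q) (arrow_ideal Q) k \<subseteq>
    ideal_pow (path_algebra (inner_quiver n Q)) (arrow_ideal (inner_quiver n Q)) k"
proof -
  let ?R = "path_algebra Q" and ?S = "path_algebra (inner_quiver n Q)"
  let ?I = "arrow_ideal Q" and ?J = "arrow_ideal (inner_quiver n Q)"
  note wf' = wf_digraph_inner_quiver[OF assms]
  interpret h: ring_hom_ring ?R ?S "inner_proj n Q"
    by (intro ring_hom_ringI2 ring_path_algebra inner_proj_ring_hom assms wf')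
  have J: "ideal ?J ?S" by (rule ideal_arrow_ideal[OF wf'])
  have "inner_proj n Q (path_elt (tail Q a, [a])) \<in> ?J" if "a \<in> arcs Q" for a
  proof (cases "a \<in> arcs (inner_quiver n Q)")
    case True
    have "(\<lambda>a. path_elt (tail (inner_quiver n Q) a, [a])) ` arcs (inner_quiver n Q) \<subseteq> ?J"
      unfolding arrow_ideal_def
      by (rule h.S.genideal_self) (auto intro!: path_elt_in_carrier arrow_in_paths wf')
    then show ?thesis using True inner_proj_arrow[OF assms that, of n]
      by (auto simp: inner_quiver_def)
  next
    case False
    then show ?thesis using inner_proj_arrow[OF assms that, of n]
        additive_subgroup.zero_closed[OF ideal.axioms(1)[OF J]]
      by (simp add: path_algebra_simps)
  qed
  then have "?I \<subseteq> {f \<in> carrier ?R. inner_proj n Q f \<in> ?J}"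
    unfolding arrow_ideal_def[of Q]
    by (intro h.R.genideal_minimal h.ideal_vimage J)
      (auto intro!: path_elt_in_carrier arrow_in_paths assms)
  then have I: "inner_proj n Q f \<in> ?J" if "f \<in> ?I" for f using that by blast
  have Ic: "f \<in> carrier ?R" if "f \<in> ideal_pow ?R ?I k" for f k
    using that ideal.Icarr[OF ideal_ideal_pow[OF ideal_arrow_ideal[OF assms]]] by blast
  show ?thesis
  proof (induct k)
    case 0
    show ?case by auto
  next
    case (Suc k)
    have "f \<in> carrier ?R \<and> inner_proj n Q f \<in> ideal_prod ?S ?J (ideal_pow ?S ?J k)"
      if "f \<in> ideal_prod ?R ?I (ideal_pow ?R ?I k)" for f
      using that
    proof induct
      case (prod i j)
      then have "i \<in> carrier ?R" "j \<in> carrier ?R"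
        using Ic ideal.Icarr[OF ideal_arrow_ideal[OF assms]] by blast+
      then show ?case using prod I Suc by (auto intro!: ideal_prod.prod)
    next
      case (sum s t)
      then show ?case by (auto intro!: ideal_prod.sum)
    qed
    then show ?case by auto
  qed
qed

lemma inner_proj_continuous:
  assumes "wf_digraph Q"
  shows "continuous_map (adic_topology (path_algebra Q) (arrow_ideal Q))
    (adic_topology (path_algebra (inner_quiver n Q)) (arrow_ideal (inner_quiver n Q))) (inner_proj n Q)"
proof -
  let ?R = "path_algebra Q" and ?S = "path_algebra (inner_quiver n Q)"
  note I = ideal_arrow_ideal[OF assms] and J = ideal_arrow_ideal[OF wf_digraph_inner_quiver[OF assms], of n]
  note h = inner_proj_ring_hom[OF assms, of n]
  show ?thesis
    unfolding continuous_map_def topspace_adic_topology[OF I] topspace_adic_topology[OF J]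
  proof (intro conjI allI impI)
    show "inner_proj n Q \<in> carrier ?R \<rightarrow> carrier ?S" using ring_hom_closed[OF h] by blast
    fix U assume U: "openin (adic_topology ?S (arrow_ideal (inner_quiver n Q))) U"
    show "openin (adic_topology ?R (arrow_ideal Q)) {f \<in> carrier ?R. inner_proj n Q f \<in> U}"
      unfolding openin_adic_topology[OF I]
    proof (intro conjI ballI)
      fix f assume f: "f \<in> {f \<in> carrier ?R. inner_proj n Q f \<in> U}"
      then obtain k where k:
        "ideal_pow ?S (arrow_ideal (inner_quiver n Q)) k +>\<^bsub>?S\<^esub> inner_proj n Q f \<subseteq> U"
        using U unfolding openin_adic_topology[OF J] by blast
      have "ideal_pow ?R (arrow_ideal Q) k +>\<^bsub>?R\<^esub> f \<subseteq> {f \<in> carrier ?R. inner_proj n Q f \<in> U}"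
      proof
        fix g assume "g \<in> ideal_pow ?R (arrow_ideal Q) k +>\<^bsub>?R\<^esub> f"
        then obtain i where i: "i \<in> ideal_pow ?R (arrow_ideal Q) k" "g = i \<oplus>\<^bsub>?R\<^esub> f"
          by (auto simp: a_r_coset_def')
        then have ic: "i \<in> carrier ?R" using ideal.Icarr[OF ideal_ideal_pow[OF I]] by blast
        have "inner_proj n Q g = inner_proj n Q i \<oplus>\<^bsub>?S\<^esub> inner_proj n Q f"
          using i ic f ring_hom_add[OF h] by auto
        moreover have "inner_proj n Q i \<in> ideal_pow ?S (arrow_ideal (inner_quiver n Q)) k"
          using inner_proj_ideal_pow[OF assms, of n k] i by blast
        ultimately have "inner_proj n Q g \<in> U" using k by (auto simp: a_r_coset_def')
        moreover have "g \<in> carrier ?R" using i ic f by (auto simp: path_algebra_simps)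
        ultimately show "g \<in> {f \<in> carrier ?R. inner_proj n Q f \<in> U}" by simp
      qed
      then show "\<exists>k. ideal_pow ?R (arrow_ideal Q) k +>\<^bsub>?R\<^esub> f \<subseteq> {f \<in> carrier ?R. inner_proj n Q f \<in> U}"
        by blast
    qed blast
  qed
qed

abbreviation quiver_algebra ::
  "(nat, 'a) pre_digraph \<Rightarrow> 'a path_series set \<Rightarrow> 'a path_series set ring" where
  "quiver_algebra Q J \<equiv> path_algebra Q Quot J"

definition path_class ::
  "(nat, 'a) pre_digraph \<Rightarrow> 'a path_series set \<Rightarrow> 'a path_series \<Rightarrow> 'a path_series set" where
  "path_class Q J f = J +>\<^bsub>path_algebra Q\<^esub> f"

definition scalar_class ::
  "(nat, 'a) pre_digraph \<Rightarrow> 'a path_series set \<Rightarrow> complex \<Rightarrow> 'a path_series set" where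
  "scalar_class Q J c = path_class Q J (path_scalar Q c)"


section \<open>Left modules, Hom and Ext\<close>

text \<open>
  The library's locale \<open>module\<close> demands a commutative ring of scalars; the record type
  \<open>('r, 'v) module\<close> is reused for left modules over arbitrary rings.
\<close>

locale left_module = R?: ring R + M?: abelian_group M
  for R :: "('r, 'k) ring_scheme" (structure) and M :: "('r, 'v, 'l) module_scheme" (structure) +
  assumes smult_closed: "a \<in> carrier R \<Longrightarrow> x \<in> carrier M \<Longrightarrow> a \<odot>\<^bsub>M\<^esub> x \<in> carrier M"
    and smult_l_distr: "a \<in> carrier R \<Longrightarrow> b \<in> carrier R \<Longrightarrow> x \<in> carrier M \<Longrightarrow>
      (a \<oplus>\<^bsub>R\<^esub> b) \<odot>\<^bsub>M\<^esub> x = a \<odot>\<^bsub>M\<^esub> x \<oplus>\<^bsub>M\<^esub> b \<odot>\<^bsub>M\<^esub> x"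
    and smult_r_distr: "a \<in> carrier R \<Longrightarrow> x \<in> carrier M \<Longrightarrow> y \<in> carrier M \<Longrightarrow>
      a \<odot>\<^bsub>M\<^esub> (x \<oplus>\<^bsub>M\<^esub> y) = a \<odot>\<^bsub>M\<^esub> x \<oplus>\<^bsub>M\<^esub> a \<odot>\<^bsub>M\<^esub> y"
    and smult_assoc: "a \<in> carrier R \<Longrightarrow> b \<in> carrier R \<Longrightarrow> x \<in> carrier M \<Longrightarrow>
      (a \<otimes>\<^bsub>R\<^esub> b) \<odot>\<^bsub>M\<^esub> x = a \<odot>\<^bsub>M\<^esub> (b \<odot>\<^bsub>M\<^esub> x)"
    and smult_one: "x \<in> carrier M \<Longrightarrow> \<one>\<^bsub>R\<^esub> \<odot>\<^bsub>M\<^esub> x = x"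

definition left_submodule ::
  "'v set \<Rightarrow> ('r, 'k) ring_scheme \<Rightarrow> ('r, 'v, 'l) module_scheme \<Rightarrow> bool" where
  "left_submodule N R M \<longleftrightarrow> subgroup N (add_monoid M) \<and>
     (\<forall>a\<in>carrier R. \<forall>x\<in>N. a \<odot>\<^bsub>M\<^esub> x \<in> N)"

text \<open>
  Throughout, \<open>\<iota>\<close> is the structure map of a complex algebra \<open>A\<close>; it turns every left
  \<open>A\<close>-module into a complex vector space. In vector spaces built as records of type
  \<open>(complex, 'v) module\<close>, the ring multiplication and unit are irrelevant.
\<close>

definition complex_space ::
  "(complex \<Rightarrow> 'r) \<Rightarrow> ('r, 'v) module \<Rightarrow> (complex, 'v) module" where
  "complex_space \<iota> M = \<lparr>carrier = carrier M, mult = mult M, one = \<one>\<^bsub>M\<^esub>,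
     zero = \<zero>\<^bsub>M\<^esub>, add = add M, smult = (\<lambda>c x. \<iota> c \<odot>\<^bsub>M\<^esub> x)\<rparr>"

abbreviation cdim :: "(complex, 'v) module \<Rightarrow> nat" where
  "cdim V \<equiv> vectorspace.dim class_ring V"

text \<open>Homomorphisms are made extensional, so that each one is represented by one function.\<close>

definition hom_space ::
  "('r, 'k) ring_scheme \<Rightarrow> (complex \<Rightarrow> 'r) \<Rightarrow> ('r, 'x) module \<Rightarrow> ('r, 'y) module
    \<Rightarrow> (complex, 'x \<Rightarrow> 'y) module" where
  "hom_space A \<iota> X Y = \<lparr>
     carrier = LinearCombinations.module_hom A X Y \<inter> extensional (carrier X),
     mult = undefined, one = undefined,
     zero = (\<lambda>x\<in>carrier X. \<zero>\<^bsub>Y\<^esub>),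
     add = (\<lambda>f g. \<lambda>x\<in>carrier X. f x \<oplus>\<^bsub>Y\<^esub> g x),
     smult = (\<lambda>c f. \<lambda>x\<in>carrier X. \<iota> c \<odot>\<^bsub>Y\<^esub> f x)\<rparr>"

definition quotient_space :: "(complex, 'v) module \<Rightarrow> 'v set \<Rightarrow> (complex, 'v set) module" where
  "quotient_space V W = \<lparr>carrier = a_rcosets\<^bsub>V\<^esub> W,
     mult = undefined, one = undefined,
     zero = W,
     add = set_add V,
     smult = (\<lambda>c X. \<Union>x\<in>X. W +>\<^bsub>V\<^esub> (c \<odot>\<^bsub>V\<^esub> x))\<rparr>"

definition free_left_module :: "('r, 'k) ring_scheme \<Rightarrow> 's set \<Rightarrow> ('r, 's \<Rightarrow> 'r) module" where
  "free_left_module A S = \<lparr>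
     carrier = {\<phi> \<in> S \<rightarrow>\<^sub>E carrier A. finite {s \<in> S. \<phi> s \<noteq> \<zero>\<^bsub>A\<^esub>}},
     mult = undefined, one = undefined,
     zero = (\<lambda>s\<in>S. \<zero>\<^bsub>A\<^esub>),
     add = (\<lambda>\<phi> \<psi>. \<lambda>s\<in>S. \<phi> s \<oplus>\<^bsub>A\<^esub> \<psi> s),
     smult = (\<lambda>r \<phi>. \<lambda>s\<in>S. r \<otimes>\<^bsub>A\<^esub> \<phi> s)\<rparr>"

text \<open>
  \<open>Ext\<^sup>1\<close> is computed from the standard free presentation
  \<open>0 \<rightarrow> K \<rightarrow> A\<^bsup>(X)\<^esup> \<rightarrow> X \<rightarrow> 0\<close>, as the cokernel of the restriction map
  \<open>Hom(A\<^bsup>(X)\<^esup>, Y) \<rightarrow> Hom(K, Y)\<close>.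
\<close>

definition free_eval ::
  "('r, 'k) ring_scheme \<Rightarrow> ('r, 'x) module \<Rightarrow> ('x \<Rightarrow> 'r) \<Rightarrow> 'x" where
  "free_eval A X \<phi> = (\<Oplus>\<^bsub>X\<^esub>x\<in>{x \<in> carrier X. \<phi> x \<noteq> \<zero>\<^bsub>A\<^esub>}. \<phi> x \<odot>\<^bsub>X\<^esub> x)"

definition syzygy ::
  "('r, 'k) ring_scheme \<Rightarrow> ('r, 'x) module \<Rightarrow> ('r, 'x \<Rightarrow> 'r) module" where
  "syzygy A X = (free_left_module A (carrier X))
     \<lparr>carrier := {\<phi> \<in> carrier (free_left_module A (carrier X)). free_eval A X \<phi> = \<zero>\<^bsub>X\<^esub>}\<rparr>"

definition ext1_space ::
  "('r, 'k) ring_scheme \<Rightarrow> (complex \<Rightarrow> 'r) \<Rightarrow> ('r, 'x) module \<Rightarrow> ('r, 'y) module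
    \<Rightarrow> (complex, (('x \<Rightarrow> 'r) \<Rightarrow> 'y) set) module" where
  "ext1_space A \<iota> X Y = quotient_space (hom_space A \<iota> (syzygy A X) Y)
     ((\<lambda>h. restrict h (carrier (syzygy A X)))
        ` carrier (hom_space A \<iota> (free_left_module A (carrier X)) Y))"


section \<open>Decorated representations and g-vectors\<close>

text \<open>
  The simple module at \<open>i\<close>: the class of a series \<open>f\<close> acts on the complex line by the constant
  coefficient of \<open>f\<close> at \<open>i\<close>. For ideals contained in the arrow ideal, this coefficient does not
  depend on the representative.
\<close>

definition simple_rep :: "nat \<Rightarrow> ('a path_series set, complex) module" where
  "simple_rep i = \<lparr>carrier = UNIV, mult = undefined, one = undefined, zero = 0, add = (+),
     smult = (\<lambda>X z. (SOME f. f \<in> X) (i, []) * z)\<rparr>"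

definition vertex_part :: "(nat, 'a) pre_digraph \<Rightarrow> 'a path_series set
    \<Rightarrow> ('a path_series set, 'v) module \<Rightarrow> 'v set \<Rightarrow> nat \<Rightarrow> 'v set" where
  "vertex_part Q J M N j = (\<lambda>x. path_class Q J (path_elt (j, [])) \<odot>\<^bsub>M\<^esub> x) ` N"

text \<open>Decorations are indexed by the vertices of \<open>Q\<close> and extended by 0.\<close>

type_synonym ('a, 'v) decorated = "('a path_series set, 'v) module \<times> (nat \<Rightarrow> nat)"

definition decorated_reps ::
  "(nat, 'a) pre_digraph \<Rightarrow> 'a path_series set \<Rightarrow> ('a, 'v) decorated set" where
  "decorated_reps Q J = {(M, v). left_module (quiver_algebra Q J) M \<and>
     vectorspace.fin_dim class_ring (complex_space (scalar_class Q J) M) \<and>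
     (\<forall>j. j \<notin> verts Q \<longrightarrow> v j = 0)}"

definition supported_in ::
  "nat set \<Rightarrow> (nat, 'a) pre_digraph \<Rightarrow> 'a path_series set \<Rightarrow> ('a, 'v) decorated \<Rightarrow> bool" where
  "supported_in I Q J = (\<lambda>(M, v). \<forall>j\<in>verts Q - I.
     vertex_part Q J M (carrier M) j = {\<zero>\<^bsub>M\<^esub>} \<and> v j = 0)"

definition g_vector ::
  "(nat, 'a) pre_digraph \<Rightarrow> 'a path_series set \<Rightarrow> ('a, 'v) decorated \<Rightarrow> nat \<Rightarrow> int" where
  "g_vector Q J = (\<lambda>(M, v) i.
     - int (cdim (hom_space (quiver_algebra Q J) (scalar_class Q J) (simple_rep i) M))
     + int (cdim (ext1_space (quiver_algebra Q J) (scalar_class Q J) (simple_rep i) M))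
     + int (v i))"

text \<open>
  Restriction of scalars along the algebra map induced by \<open>inner_proj\<close> on quotients, which sends
  a coset to its image.
\<close>

definition inflate :: "nat \<Rightarrow> (nat, 'a) pre_digraph \<Rightarrow> ('a, 'v) decorated \<Rightarrow> ('a, 'v) decorated" where
  "inflate n Q = (\<lambda>(M, v). (M\<lparr>smult := (\<lambda>X x. (inner_proj n Q ` X) \<odot>\<^bsub>M\<^esub> x)\<rparr>, v))"


section \<open>Quiver Grassmannians and their Euler characteristic\<close>

definition complex_line :: "(complex, complex) module" where
  "complex_line = \<lparr>carrier = UNIV, mult = (*), one = 1, zero = 0, add = (+), smult = (*)\<rparr>"

text \<open>
  On a finite-dimensional complex vector space, the initial topology of all linear functionals is
  the usual (Euclidean) topology.
\<close>

definition vs_topology :: "(complex, 'v) module \<Rightarrow> 'v topology" where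
  "vs_topology V = topology_generated_by
     {{x \<in> carrier V. \<phi> x \<in> U} | \<phi> U.
        \<phi> \<in> LinearCombinations.module_hom class_ring V complex_line \<and> open U}"

definition quotient_top :: "'x topology \<Rightarrow> ('x \<Rightarrow> 'y) \<Rightarrow> 'y topology" where
  "quotient_top X q = topology (\<lambda>U. U \<subseteq> q ` topspace X \<and> openin X {x \<in> topspace X. q x \<in> U})"

lemma openin_quotient_top:
  "openin (quotient_top X q) U \<longleftrightarrow> U \<subseteq> q ` topspace X \<and> openin X {x \<in> topspace X. q x \<in> U}"
proof -
  have "istopology (\<lambda>U. U \<subseteq> q ` topspace X \<and> openin X {x \<in> topspace X. q x \<in> U})"
    unfolding istopology_def
  proof (intro conjI allI impI)
    fix S T
    assume "S \<subseteq> q ` topspace X \<and> openin X {x \<in> topspace X. q x \<in> S}"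
      "T \<subseteq> q ` topspace X \<and> openin X {x \<in> topspace X. q x \<in> T}"
    moreover have "{x \<in> topspace X. q x \<in> S \<inter> T} =
      {x \<in> topspace X. q x \<in> S} \<inter> {x \<in> topspace X. q x \<in> T}" by blast
    ultimately show "S \<inter> T \<subseteq> q ` topspace X" "openin X {x \<in> topspace X. q x \<in> S \<inter> T}" by auto
  next
    fix \<K>
    assume *: "\<forall>K\<in>\<K>. K \<subseteq> q ` topspace X \<and> openin X {x \<in> topspace X. q x \<in> K}"
    have "{x \<in> topspace X. q x \<in> \<Union>\<K>} = (\<Union>K\<in>\<K>. {x \<in> topspace X. q x \<in> K})" by blast
    then show "\<Union>\<K> \<subseteq> q ` topspace X" "openin X {x \<in> topspace X. q x \<in> \<Union>\<K>}" using * by auto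
  qed
  then show ?thesis unfolding quotient_top_def by (simp add: topology_inverse')
qed

text \<open>
  The Grassmannian of \<open>k\<close>-dimensional subspaces carries the quotient topology of the space of
  linearly independent \<open>k\<close>-tuples (its classical, analytic topology).
\<close>

definition frames :: "(complex, 'v) module \<Rightarrow> nat \<Rightarrow> (nat \<Rightarrow> 'v) set" where
  "frames V k = {w \<in> {..<k} \<rightarrow>\<^sub>E carrier V.
     inj_on w {..<k} \<and> \<not> module.lin_dep class_ring V (w ` {..<k})}"

definition grassmannian :: "(complex, 'v) module \<Rightarrow> nat \<Rightarrow> 'v set topology" where
  "grassmannian V k = quotient_top
     (subtopology (product_topology (\<lambda>_. vs_topology V) {..<k}) (frames V k))
     (\<lambda>w. module.span class_ring V (w ` {..<k}))"

text \<open>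
  Dimension vectors are indexed by \<open>{1..n}\<close>: the modules in question are supported there, so that
  a subrepresentation of dimension vector \<open>e\<close> has total dimension \<open>\<Sum>j=1..n. e j\<close>.
\<close>

definition subreps :: "nat \<Rightarrow> (nat, 'a) pre_digraph \<Rightarrow> 'a path_series set
    \<Rightarrow> ('a path_series set, 'v) module \<Rightarrow> (nat \<Rightarrow> nat) \<Rightarrow> 'v set set" where
  "subreps n Q J M e = {N. left_submodule N (quiver_algebra Q J) M \<and>
     (\<forall>j\<in>{1..n}. cdim ((complex_space (scalar_class Q J) M)\<lparr>carrier := vertex_part Q J M N j\<rparr>) = e j)}"

definition quiver_grassmannian :: "nat \<Rightarrow> (nat, 'a) pre_digraph \<Rightarrow> 'a path_series set
    \<Rightarrow> ('a path_series set, 'v) module \<Rightarrow> (nat \<Rightarrow> nat) \<Rightarrow> 'v set topology" where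
  "quiver_grassmannian n Q J M e =
     subtopology (grassmannian (complex_space (scalar_class Q J) M) (\<Sum>j=1..n. e j))
       (subreps n Q J M e)"

definition abelian_rank :: "('g, 'm) monoid_scheme \<Rightarrow> nat" where
  "abelian_rank G = Sup {card S | S. finite S \<and> S \<subseteq> carrier G \<and>
     (\<forall>c :: 'g \<Rightarrow> int. (\<Otimes>\<^bsub>G\<^esub>s\<in>S. s [^]\<^bsub>G\<^esub> c s) = \<one>\<^bsub>G\<^esub> \<longrightarrow> (\<forall>s\<in>S. c s = 0))}"

text \<open>
  The alternating sum of the Betti numbers, for spaces (such as complex projective varieties)
  whose total singular homology is finitely generated.
\<close>

definition euler_char :: "'x topology \<Rightarrow> int" where
  "euler_char X = (\<Sum>p | abelian_rank (homology_group (int p) X) \<noteq> 0.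
     (- 1) ^ p * int (abelian_rank (homology_group (int p) X)))"


section \<open>Caldero--Chapoton functions\<close>

definition exchange_entry :: "(nat, 'a) pre_digraph \<Rightarrow> nat \<Rightarrow> nat \<Rightarrow> int" where
  "exchange_entry Q i j =
     int (card {a \<in> arcs Q. tail Q a = j \<and> head Q a = i})
     - int (card {a \<in> arcs Q. tail Q a = i \<and> head Q a = j})"

text \<open>
  \<open>exchange_mult n Q e i\<close> is the \<open>i\<close>-th entry of the product of the exchange matrix, whose columns
  are indexed by \<open>{1..n}\<close>, with the column vector \<open>e\<close>.
\<close>

definition exchange_mult :: "nat \<Rightarrow> (nat, 'a) pre_digraph \<Rightarrow> (nat \<Rightarrow> nat) \<Rightarrow> nat \<Rightarrow> int" where
  "exchange_mult n Q e i = (\<Sum>j=1..n. exchange_entry Q i j * int (e j))"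

text \<open>
  Laurent polynomials in variables \<open>x\<^sub>i\<close> are finitely supported rational coefficient functions on
  exponent vectors, with the convolution product of \<open>Poly_Mapping\<close>. \<open>laurent_ring I\<close> is the
  subring of the Laurent polynomials in the variables \<open>x\<^sub>i\<close> with \<open>i \<in> I\<close>.
\<close>

type_synonym laurent = "(nat \<Rightarrow>\<^sub>0 int) \<Rightarrow>\<^sub>0 rat"

definition laurent_ring :: "nat set \<Rightarrow> laurent set" where
  "laurent_ring I = {p. \<forall>f \<in> Poly_Mapping.keys p. Poly_Mapping.keys f \<subseteq> I}"

definition laurent_monom :: "nat set \<Rightarrow> (nat \<Rightarrow> int) \<Rightarrow> laurent" where
  "laurent_monom I f = Poly_Mapping.single (\<Sum>i\<in>I. Poly_Mapping.single i (f i)) 1"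

text \<open>
  \<open>CC n Q J\<close> is a function on decorated representations of the algebra of the subquiver
  \<open>inner_quiver n Q\<close> modulo the image of \<open>J\<close>. The sum is restricted to the finitely many
  dimension vectors for which the quiver Grassmannian is non-empty.
\<close>

definition CC :: "nat \<Rightarrow> (nat, 'a) pre_digraph \<Rightarrow> 'a path_series set \<Rightarrow> ('a, 'v) decorated \<Rightarrow> laurent" where
  "CC n Q J D =
     (\<Sum>e | (\<forall>j. j \<notin> {1..n} \<longrightarrow> e j = 0) \<and>
          subreps n (inner_quiver n Q) (inner_proj n Q ` J) (fst D) e \<noteq> {}.
        of_int (euler_char (quiver_grassmannian n (inner_quiver n Q) (inner_proj n Q ` J) (fst D) e))
        * laurent_monom (verts Q) (\<lambda>i. exchange_mult n Q e i + g_vector Q J (inflate n Q D) i))"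

definition linearly_independent_over :: "'b::comm_ring_1 set \<Rightarrow> 'b set \<Rightarrow> bool" where
  "linearly_independent_over R S \<longleftrightarrow>
     (\<forall>T c. finite T \<longrightarrow> T \<subseteq> S \<longrightarrow> (\<forall>t\<in>T. c t \<in> R) \<longrightarrow> (\<Sum>t\<in>T. c t * t) = 0 \<longrightarrow> (\<forall>t\<in>T. c t = 0))"

end

theory Submission
  imports Defs
begin

text \<open>
  Let \<open>D = (M, v)\<close> be supported in \<open>[n]\<close>, let \<open>B\<close> be the exchange matrix with rows and columns in \<open>[n]\<close>,
  and read off from a monomial only its degrees in \<open>x\<^sub>1, \<dots>, x\<^sub>n\<close>, a vector in \<open>\<int>\<^sup>n\<close>. The term of the
  Caldero--Chapoton function of \<open>D\<close> belonging to the dimension vector \<open>e\<close> has the degree \<open>g + B e\<close>,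
  where \<open>g\<close> consists of the first \<open>n\<close> entries of the extended g-vector. By \<open>g_vector_inflate\<close> these
  entries form the g-vector of \<open>D\<close> over the smaller algebra, so by hypothesis they determine \<open>D\<close>. Since
  no non-zero \<open>e \<ge> 0\<close> has \<open>B e = 0\<close>, the relation \<open>g' \<in> g + B e\<close> for some non-zero \<open>e \<ge> 0\<close> is
  a strict partial order, and the term \<open>e = 0\<close> is the only one of minimal degree. Its coefficient is 1,
  because the corresponding quiver Grassmannian is a single point. The scalars have degree 0, so in a
  linear relation the functions whose degree \<open>g\<close> is minimal keep their leading terms, and these do
  not cancel as the degrees are distinct. This argument is \<open>linearly_independent_over_pointed\<close>.
  
  The comparison of g-vectors is the algebraic part. Let \<open>I\<close> be the kernel of the surjection from the
  larger algebra to the smaller one and \<open>S\<close> a simple module at a vertex in \<open>[n]\<close>. The spaces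
  \<open>Hom(S, M)\<close> agree because the action factors through the surjection. For \<open>Ext\<^sup>1\<close> take the free
  presentation of \<open>S\<close> by the module \<open>F\<close> over the larger algebra, with syzygy \<open>K\<close>. Dividing by \<open>I F\<close>,
  which lies in \<open>K\<close>, yields the presentation over the smaller algebra, so \<open>Ext\<^sup>1\<close> is unchanged once every
  homomorphism \<open>h : K \<rightarrow> M\<close> kills \<open>I F\<close> (\<open>dim_ext1_space_restrict_scalars\<close>). An element of \<open>I\<close> is
  represented by a series \<open>f\<close> without constant terms, and collecting its paths by their first arrow gives a finite
  sum \<open>f = \<Sum> f\<^sub>a a\<close>. Arrows annihilate \<open>S\<close>, so \<open>a s\<close> lies in \<open>K\<close> for each generator \<open>s\<close> of \<open>F\<close>,
  and \<open>h(f\<^sub>a a s) = f\<^sub>a h(a s)\<close>. If \<open>a\<close> is an arrow of the smaller quiver, then \<open>f\<^sub>a\<close> represents an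
  element of \<open>I\<close> and acts by 0 on \<open>M\<close>; otherwise an end point of \<open>a\<close> is outside \<open>[n]\<close>, where \<open>M\<close>
  vanishes, and \<open>h(a s) = 0\<close> (\<open>syzygy_hom_vanishes\<close>).
\<close>

section \<open>Dimensions of spaces of homomorphisms and of quotient spaces\<close>

context left_module
begin

lemma zero_smult: "x \<in> carrier M \<Longrightarrow> \<zero>\<^bsub>R\<^esub> \<odot>\<^bsub>M\<^esub> x = \<zero>\<^bsub>M\<^esub>"
  using smult_l_distr[of "\<zero>\<^bsub>R\<^esub>" "\<zero>\<^bsub>R\<^esub>" x] smult_closed[of "\<zero>\<^bsub>R\<^esub>" x]
  by (simp add: M.add.l_cancel_one')

lemma smult_zero: "a \<in> carrier R \<Longrightarrow> a \<odot>\<^bsub>M\<^esub> \<zero>\<^bsub>M\<^esub> = \<zero>\<^bsub>M\<^esub>"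
  using smult_r_distr[of a "\<zero>\<^bsub>M\<^esub>" "\<zero>\<^bsub>M\<^esub>"] smult_closed[of a "\<zero>\<^bsub>M\<^esub>"]
  by (simp add: M.add.l_cancel_one')

lemma smult_finsum:
  assumes "a \<in> carrier R" "finite T" "f \<in> T \<rightarrow> carrier M"
  shows "a \<odot>\<^bsub>M\<^esub> (\<Oplus>\<^bsub>M\<^esub>x\<in>T. f x) = (\<Oplus>\<^bsub>M\<^esub>x\<in>T. a \<odot>\<^bsub>M\<^esub> f x)"
  using assms(2,3)
proof (induct T rule: finite_induct)
  case (insert x T)
  have "(\<lambda>x. a \<odot>\<^bsub>M\<^esub> f x) \<in> T \<rightarrow> carrier M" "a \<odot>\<^bsub>M\<^esub> f x \<in> carrier M"
    using insert assms(1) smult_closed by auto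
  then show ?case using insert assms(1) by (simp add: M.finsum_insert smult_r_distr M.finsum_closed)
qed (simp add: smult_zero assms)

end

text \<open>
  Since the scalars are central in \<open>A\<close>, scalar multiples of \<open>A\<close>-linear maps are again \<open>A\<close>-linear.
\<close>

lemma vectorspace_hom_space:
  assumes Y: "left_module A Y"
    and X_add: "\<And>x y. x \<in> carrier X \<Longrightarrow> y \<in> carrier X \<Longrightarrow> x \<oplus>\<^bsub>X\<^esub> y \<in> carrier X"
    and X_smult: "\<And>a x. a \<in> carrier A \<Longrightarrow> x \<in> carrier X \<Longrightarrow> a \<odot>\<^bsub>X\<^esub> x \<in> carrier X"
    and \<iota>: "\<iota> \<in> Ring.ring_hom class_ring A"
    and central: "\<And>c a. a \<in> carrier A \<Longrightarrow> \<iota> c \<otimes>\<^bsub>A\<^esub> a = a \<otimes>\<^bsub>A\<^esub> \<iota> c"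
  shows "vectorspace class_ring (hom_space A \<iota> X Y)"
proof -
  interpret Y: left_module A Y by fact
  let ?H = "hom_space A \<iota> X Y"
  note simps = hom_space_def LinearCombinations.module_hom_def X_add X_smult
  have \<iota>_closed [simp]: "\<iota> c \<in> carrier A" for c
    using ring_hom_closed[OF \<iota>] by simp
  have \<iota>_simps: "\<iota> (c + d) = \<iota> c \<oplus>\<^bsub>A\<^esub> \<iota> d" "\<iota> (c * d) = \<iota> c \<otimes>\<^bsub>A\<^esub> \<iota> d" "\<iota> 1 = \<one>\<^bsub>A\<^esub>" for c d
    using ring_hom_add[OF \<iota>, of c d] ring_hom_mult[OF \<iota>, of c d] ring_hom_one[OF \<iota>] by simp_all
  have smult_neg: "a \<odot>\<^bsub>Y\<^esub> (\<ominus>\<^bsub>Y\<^esub> y) = \<ominus>\<^bsub>Y\<^esub> (a \<odot>\<^bsub>Y\<^esub> y)" if "a \<in> carrier A" "y \<in> carrier Y" for a y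
    using Y.smult_r_distr[of a "\<ominus>\<^bsub>Y\<^esub> y" y] that Y.smult_zero[of a]
    by (metis Y.M.add.inv_closed Y.M.l_neg Y.M.minus_equality Y.smult_closed)
  have commute: "\<iota> c \<odot>\<^bsub>Y\<^esub> (a \<odot>\<^bsub>Y\<^esub> y) = a \<odot>\<^bsub>Y\<^esub> (\<iota> c \<odot>\<^bsub>Y\<^esub> y)"
    if "a \<in> carrier A" "y \<in> carrier Y" for a c y
    using that by (metis Y.smult_assoc \<iota>_closed central)
  have grp: "abelian_group ?H"
  proof (rule abelian_groupI)
    fix f assume f: "f \<in> carrier ?H"
    have "(\<lambda>x\<in>carrier X. \<ominus>\<^bsub>Y\<^esub> f x) \<in> carrier ?H"
      using f by (auto simp: simps Pi_iff smult_neg Y.M.minus_add Y.M.add.inv_mult_group Y.M.a_ac)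
    moreover have "(\<lambda>x\<in>carrier X. \<ominus>\<^bsub>Y\<^esub> f x) \<oplus>\<^bsub>?H\<^esub> f = \<zero>\<^bsub>?H\<^esub>"
      using f by (auto simp: simps Pi_iff Y.M.l_neg)
    ultimately show "\<exists>g\<in>carrier ?H. g \<oplus>\<^bsub>?H\<^esub> f = \<zero>\<^bsub>?H\<^esub>" by blast
  qed (auto simp: simps Pi_iff Y.smult_r_distr Y.M.a_ac Y.smult_zero fun_eq_iff extensional_def restrict_def)
  have mod: "module class_ring ?H"
  proof (rule moduleI)
    show "cring (class_ring :: complex ring)"
      by (rule domain.axioms(1)[OF field.axioms(1)[OF class_field.field_axioms]])
    show "c \<odot>\<^bsub>?H\<^esub> f \<in> carrier ?H" if "f \<in> carrier ?H" for c f
      using that by (auto simp: simps Pi_iff Y.smult_r_distr Y.smult_closed commute)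
  qed (use grp in \<open>auto simp: simps Pi_iff Y.smult_r_distr Y.smult_l_distr Y.smult_assoc Y.smult_one
      Y.smult_closed \<iota>_simps fun_eq_iff extensional_def restrict_def\<close>)
  show ?thesis
    by (intro vectorspace.intro mod class_field.field_axioms)
qed

lemma abelian_subgroup_of_submodule:
  assumes W: "LinearCombinations.submodule K W V"
  shows "abelian_subgroup W V"
proof -
  interpret W: LinearCombinations.submodule K W V by fact
  interpret V: module K V by (rule W.module)
  have neg: "\<ominus>\<^bsub>V\<^esub> w \<in> W" if "w \<in> W" for w
    using V.smult_minus_1[of w] W.subset W.smult_closed[of "\<ominus>\<^bsub>K\<^esub> \<one>\<^bsub>K\<^esub>" w] that
    by (metis V.R.add.inv_closed V.R.one_closed subsetD)
  have "subgroup W (add_monoid V)"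
  proof (rule V.add.subgroupI)
    show "W \<noteq> {}" using W.zero_closed by blast
  qed (use W.subset W.m_closed neg in auto)
  then show ?thesis
    by (intro abelian_subgroupI3 additive_subgroup.intro V.abelian_group_axioms)
qed

lemma quotient_space_coset_smult:
  assumes V: "module class_ring V" and W: "LinearCombinations.submodule class_ring W V"
    and v: "v \<in> carrier V"
  shows "c \<odot>\<^bsub>quotient_space V W\<^esub> (W +>\<^bsub>V\<^esub> v) = W +>\<^bsub>V\<^esub> (c \<odot>\<^bsub>V\<^esub> v)"
proof -
  interpret V: module class_ring V by fact
  interpret W: LinearCombinations.submodule class_ring W V by fact
  interpret S: abelian_subgroup W V by (rule abelian_subgroup_of_submodule[OF W])
  have "W +>\<^bsub>V\<^esub> (c \<odot>\<^bsub>V\<^esub> x) = W +>\<^bsub>V\<^esub> (c \<odot>\<^bsub>V\<^esub> v)" if x: "x \<in> W +>\<^bsub>V\<^esub> v" for x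
  proof -
    obtain w where w: "w \<in> W" "x = w \<oplus>\<^bsub>V\<^esub> v" using x by (auto simp: a_r_coset_def')
    have "c \<odot>\<^bsub>V\<^esub> x = c \<odot>\<^bsub>V\<^esub> w \<oplus>\<^bsub>V\<^esub> c \<odot>\<^bsub>V\<^esub> v"
      using w W.subset v by (auto intro: V.smult_r_distr)
    then have "c \<odot>\<^bsub>V\<^esub> x \<in> W +>\<^bsub>V\<^esub> (c \<odot>\<^bsub>V\<^esub> v)"
      using W.smult_closed[of c w] w by (auto simp: a_r_coset_def')
    then show ?thesis
      using V.a_repr_independence[of "c \<odot>\<^bsub>V\<^esub> x" W "c \<odot>\<^bsub>V\<^esub> v"] v S.a_subgroup by auto
  qed
  moreover have "W +>\<^bsub>V\<^esub> v \<noteq> {}" using S.a_rcos_self[OF v] by blast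
  ultimately have "(\<Union>x\<in>W +>\<^bsub>V\<^esub> v. W +>\<^bsub>V\<^esub> (c \<odot>\<^bsub>V\<^esub> x)) = W +>\<^bsub>V\<^esub> (c \<odot>\<^bsub>V\<^esub> v)"
    by (intro SUP_eq_const)
  then show ?thesis by (simp add: quotient_space_def)
qed

lemma vectorspace_quotient_space:
  assumes V: "vectorspace class_ring V" and W: "LinearCombinations.submodule class_ring W V"
  shows "vectorspace class_ring (quotient_space V W)"
proof -
  interpret V: vectorspace class_ring V by fact
  interpret S: abelian_subgroup W V by (rule abelian_subgroup_of_submodule[OF W])
  let ?Q = "quotient_space V W"
  have coset: "\<exists>v\<in>carrier V. X = W +>\<^bsub>V\<^esub> v" if "X \<in> carrier ?Q" for X
    using that by (auto simp: quotient_space_def A_RCOSETS_def')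
  have in_carrier: "W +>\<^bsub>V\<^esub> v \<in> carrier ?Q" if "v \<in> carrier V" for v
    using that by (auto simp: quotient_space_def A_RCOSETS_def')
  have add: "(W +>\<^bsub>V\<^esub> v) \<oplus>\<^bsub>?Q\<^esub> (W +>\<^bsub>V\<^esub> w) = W +>\<^bsub>V\<^esub> (v \<oplus>\<^bsub>V\<^esub> w)"
    if "v \<in> carrier V" "w \<in> carrier V" for v w
    using S.a_rcos_sum[OF that] by (simp add: quotient_space_def)
  note smult = quotient_space_coset_smult[OF V.module_axioms W]
  have zero: "\<zero>\<^bsub>?Q\<^esub> = W +>\<^bsub>V\<^esub> \<zero>\<^bsub>V\<^esub>"
    using V.a_coset_add_zero[OF S.a_subset] by (simp add: quotient_space_def)
  have grp: "abelian_group ?Q"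
  proof (rule abelian_groupI)
    fix X assume "X \<in> carrier ?Q"
    then obtain v where v: "v \<in> carrier V" "X = W +>\<^bsub>V\<^esub> v" using coset by blast
    then show "\<exists>Y\<in>carrier ?Q. Y \<oplus>\<^bsub>?Q\<^esub> X = \<zero>\<^bsub>?Q\<^esub>"
      by (intro bexI[of _ "W +>\<^bsub>V\<^esub> (\<ominus>\<^bsub>V\<^esub> v)"]) (auto simp: add zero in_carrier V.l_neg)
  qed (auto simp: add zero in_carrier V.a_ac dest!: coset)
  have "module class_ring ?Q"
  proof (rule moduleI)
    show "cring (class_ring :: complex ring)"
      by (rule domain.axioms(1)[OF field.axioms(1)[OF class_field.field_axioms]])
    show "abelian_group ?Q" by (rule grp)
    have V: "c \<odot>\<^bsub>V\<^esub> v \<in> carrier V" "(c + d) \<odot>\<^bsub>V\<^esub> v = c \<odot>\<^bsub>V\<^esub> v \<oplus>\<^bsub>V\<^esub> d \<odot>\<^bsub>V\<^esub> v"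
      "(c * d) \<odot>\<^bsub>V\<^esub> v = c \<odot>\<^bsub>V\<^esub> (d \<odot>\<^bsub>V\<^esub> v)" "1 \<odot>\<^bsub>V\<^esub> v = v" if "v \<in> carrier V" for c d v
      using V.smult_l_distr[of c d v] V.smult_assoc1[of c d v] V.smult_one[of v]
        V.smult_closed[of c v] that by simp_all
    have V': "c \<odot>\<^bsub>V\<^esub> (v \<oplus>\<^bsub>V\<^esub> w) = c \<odot>\<^bsub>V\<^esub> v \<oplus>\<^bsub>V\<^esub> c \<odot>\<^bsub>V\<^esub> w" if "v \<in> carrier V" "w \<in> carrier V" for c v w
      using V.smult_r_distr[of c v w] that by simp
    fix c X assume X: "X \<in> carrier ?Q"
    then obtain v where v: "v \<in> carrier V" "X = W +>\<^bsub>V\<^esub> v" using coset by meson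
    show "c \<odot>\<^bsub>?Q\<^esub> X \<in> carrier ?Q" using v V by (simp add: smult in_carrier)
    show "\<one>\<^bsub>class_ring\<^esub> \<odot>\<^bsub>?Q\<^esub> X = X"
      using v V by (simp add: smult)
    fix d
    show "(c \<oplus>\<^bsub>class_ring\<^esub> d) \<odot>\<^bsub>?Q\<^esub> X = c \<odot>\<^bsub>?Q\<^esub> X \<oplus>\<^bsub>?Q\<^esub> d \<odot>\<^bsub>?Q\<^esub> X"
      using v V by (simp add: smult add)
    show "(c \<otimes>\<^bsub>class_ring\<^esub> d) \<odot>\<^bsub>?Q\<^esub> X = c \<odot>\<^bsub>?Q\<^esub> (d \<odot>\<^bsub>?Q\<^esub> X)"
      using v V by (simp add: smult)
    fix Y assume "Y \<in> carrier ?Q"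
    then obtain w where "w \<in> carrier V" "Y = W +>\<^bsub>V\<^esub> w" using coset by meson
    then show "c \<odot>\<^bsub>?Q\<^esub> (X \<oplus>\<^bsub>?Q\<^esub> Y) = c \<odot>\<^bsub>?Q\<^esub> X \<oplus>\<^bsub>?Q\<^esub> c \<odot>\<^bsub>?Q\<^esub> Y"
      using v V V' by (simp add: smult add)
  qed
  then show ?thesis by (rule vectorspace.intro[OF _ class_field.field_axioms])
qed

lemma linear_mapI:
  assumes "vectorspace K V" "vectorspace K W" "T \<in> LinearCombinations.module_hom K V W"
  shows "linear_map K V W T"
  using assms by (intro linear_map.intro mod_hom.intro mod_hom_axioms.intro vectorspace.axioms(1)) blast+

text \<open>
  Infinite dimension is included, so that spaces of extensions can be compared without bounding
  their dimensions first.
\<close>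

lemma dim_eq_of_bij:
  assumes V: "vectorspace K V" and W: "vectorspace K W"
    and T_hom: "T \<in> LinearCombinations.module_hom K V W" and T: "bij_betw T (carrier V) (carrier W)"
  shows "vectorspace.dim K V = vectorspace.dim K W"
proof (cases "vectorspace.fin_dim K V")
  case True
  show ?thesis
    by (rule linear_map.dim_eq[OF linear_mapI[OF V W T_hom] True bij_betw_imp_inj_on[OF T] bij_betw_imp_surj_on[OF T]])
next
  \<comment> \<open>In infinite dimension both sides are the same default value, the least element of the empty set.\<close>
  case False
  interpret V: vectorspace K V by fact
  interpret W: vectorspace K W by fact
  define S where "S = inv_into (carrier V) T"
  have S: "bij_betw S (carrier W) (carrier V)" unfolding S_def by (rule bij_betw_inv_into[OF T])
  have ST: "S (T v) = v" if "v \<in> carrier V" for v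
    using bij_betw_inv_into_left[OF T that] unfolding S_def .
  have T_add: "T (v \<oplus>\<^bsub>V\<^esub> w) = T v \<oplus>\<^bsub>W\<^esub> T w" if "v \<in> carrier V" "w \<in> carrier V" for v w
    using T_hom that by (simp add: LinearCombinations.module_hom_def)
  have T_smult: "T (c \<odot>\<^bsub>V\<^esub> v) = c \<odot>\<^bsub>W\<^esub> T v" if "c \<in> carrier K" "v \<in> carrier V" for c v
    using T_hom that by (simp add: LinearCombinations.module_hom_def)
  have W_eq: "carrier W = T ` carrier V" using T by (simp add: bij_betw_def)
  have "S (x \<oplus>\<^bsub>W\<^esub> y) = S x \<oplus>\<^bsub>V\<^esub> S y" if "x \<in> carrier W" "y \<in> carrier W" for x y
    using that ST unfolding W_eq by (auto simp flip: T_add)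
  moreover have "S (c \<odot>\<^bsub>W\<^esub> x) = c \<odot>\<^bsub>V\<^esub> S x" if "c \<in> carrier K" "x \<in> carrier W" for c x
    using that ST unfolding W_eq by (auto simp flip: T_smult)
  moreover have "S \<in> carrier W \<rightarrow> carrier V" by (rule bij_betw_imp_funcset[OF S])
  ultimately have "S \<in> LinearCombinations.module_hom K W V"
    unfolding LinearCombinations.module_hom_def by blast
  from linear_map.surj_fin_dim[OF linear_mapI[OF W V this]]
  have "\<not> W.fin_dim" using False bij_betw_imp_surj_on[OF S] by blast
  then have "\<not> (finite A \<and> card A = n \<and> A \<subseteq> carrier W \<and> W.span A = carrier W)" for A n
    unfolding W.fin_dim_def by blast
  moreover have "\<not> (finite A \<and> card A = n \<and> A \<subseteq> carrier V \<and> V.span A = carrier V)" for A n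
    using False unfolding V.fin_dim_def by blast
  ultimately show ?thesis unfolding V.dim_def W.dim_def by (simp only: simp_thms)
qed

lemma dim_quotient_space_eq:
  assumes V1: "vectorspace class_ring V1" and V2: "vectorspace class_ring V2"
    and W1: "LinearCombinations.submodule class_ring W1 V1"
    and T: "T \<in> LinearCombinations.module_hom class_ring V1 V2"
    and bij: "bij_betw T (carrier V1) (carrier V2)"
  shows "cdim (quotient_space V1 W1) = cdim (quotient_space V2 (T ` W1))"
proof -
  interpret V1: vectorspace class_ring V1 by fact
  interpret V2: vectorspace class_ring V2 by fact
  have T_add: "T (v \<oplus>\<^bsub>V1\<^esub> w) = T v \<oplus>\<^bsub>V2\<^esub> T w" if "v \<in> carrier V1" "w \<in> carrier V1" for v w
    using T that by (simp add: LinearCombinations.module_hom_def)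
  have T_smult: "T (c \<odot>\<^bsub>V1\<^esub> v) = c \<odot>\<^bsub>V2\<^esub> T v" if "v \<in> carrier V1" for c v
    using T that by (simp add: LinearCombinations.module_hom_def)
  have T_closed: "T v \<in> carrier V2" if "v \<in> carrier V1" for v
    using bij that by (auto simp: bij_betw_def)
  have T_zero: "T \<zero>\<^bsub>V1\<^esub> = \<zero>\<^bsub>V2\<^esub>"
    using T_add[OF V1.M.zero_closed V1.M.zero_closed] T_closed[OF V1.M.zero_closed]
    by (simp add: V2.M.add.l_cancel_one')
  have W1_subset: "W1 \<subseteq> carrier V1" and W1_zero: "\<zero>\<^bsub>V1\<^esub> \<in> W1"
    and W1_add: "\<And>v w. v \<in> W1 \<Longrightarrow> w \<in> W1 \<Longrightarrow> v \<oplus>\<^bsub>V1\<^esub> w \<in> W1"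
    and W1_smult: "\<And>c v. v \<in> W1 \<Longrightarrow> c \<odot>\<^bsub>V1\<^esub> v \<in> W1"
    using W1 by (simp_all add: LinearCombinations.submodule_def)
  let ?W2 = "T ` W1"
  have W2: "LinearCombinations.submodule class_ring ?W2 V2"
  proof (rule submodule.intro)
    show "v \<oplus>\<^bsub>V2\<^esub> w \<in> ?W2" if vw: "v \<in> ?W2" "w \<in> ?W2" for v w
    proof -
      obtain a b where "a \<in> W1" "b \<in> W1" "v = T a" "w = T b" using vw by auto
      then have "v \<oplus>\<^bsub>V2\<^esub> w = T (a \<oplus>\<^bsub>V1\<^esub> b)" "a \<oplus>\<^bsub>V1\<^esub> b \<in> W1"
        using W1_subset[THEN subsetD] by (simp_all add: T_add W1_add)
      then show ?thesis by (rule image_eqI)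
    qed
    show "c \<odot>\<^bsub>V2\<^esub> v \<in> ?W2" if cv: "c \<in> carrier class_ring" "v \<in> ?W2" for c v
    proof -
      obtain a where "a \<in> W1" "v = T a" using cv by auto
      then have "c \<odot>\<^bsub>V2\<^esub> v = T (c \<odot>\<^bsub>V1\<^esub> a)" "c \<odot>\<^bsub>V1\<^esub> a \<in> W1"
        using W1_subset[THEN subsetD] by (simp_all add: T_smult W1_smult)
      then show ?thesis by (rule image_eqI)
    qed
    show "\<zero>\<^bsub>V2\<^esub> \<in> ?W2" using W1_zero T_zero by (metis imageI)
    show "?W2 \<subseteq> carrier V2" using W1_subset T_closed by blast
    show "module class_ring V2" by (rule V2.module_axioms)
  qed
  let ?Q1 = "quotient_space V1 W1" and ?Q2 = "quotient_space V2 ?W2"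
  interpret S1: abelian_subgroup W1 V1 by (rule abelian_subgroup_of_submodule[OF W1])
  interpret S2: abelian_subgroup ?W2 V2 by (rule abelian_subgroup_of_submodule[OF W2])
  have coset: "T ` (W1 +>\<^bsub>V1\<^esub> v) = ?W2 +>\<^bsub>V2\<^esub> T v" if "v \<in> carrier V1" for v
  proof -
    have "T (w \<oplus>\<^bsub>V1\<^esub> v) = T w \<oplus>\<^bsub>V2\<^esub> T v" if "w \<in> W1" for w
      using that \<open>v \<in> carrier V1\<close> W1_subset by (intro T_add) auto
    then show ?thesis by (auto simp: a_r_coset_def' image_iff)
  qed
  have carrier1: "carrier ?Q1 = (\<lambda>v. W1 +>\<^bsub>V1\<^esub> v) ` carrier V1"
    by (auto simp: quotient_space_def A_RCOSETS_def')
  have carrier2: "carrier ?Q2 = (\<lambda>v. ?W2 +>\<^bsub>V2\<^esub> v) ` carrier V2"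
    by (auto simp: quotient_space_def A_RCOSETS_def')
  have img: "image T ` carrier ?Q1 = carrier ?Q2"
    unfolding carrier1 carrier2 bij_betw_imp_surj_on[OF bij, symmetric]
    by (simp add: image_image coset cong: image_cong)
  have inj: "inj_on (image T) (carrier ?Q1)"
  proof (rule inj_on_image)
    have "\<Union> (carrier ?Q1) \<subseteq> carrier V1"
      unfolding carrier1 by (intro Union_least, elim imageE) (simp add: V1.a_r_coset_subset_G[OF W1_subset])
    then show "inj_on T (\<Union> (carrier ?Q1))"
      using bij by (rule inj_on_subset[rotated, OF _ bij_betw_imp_inj_on])
  qed
  have "image T \<in> LinearCombinations.module_hom class_ring ?Q1 ?Q2"
    unfolding LinearCombinations.module_hom_def
  proof (intro CollectI conjI allI impI)
    show "image T \<in> carrier ?Q1 \<rightarrow> carrier ?Q2" using img by blast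
    show "T ` (X \<oplus>\<^bsub>?Q1\<^esub> Y) = T ` X \<oplus>\<^bsub>?Q2\<^esub> T ` Y" if XY: "X \<in> carrier ?Q1 \<and> Y \<in> carrier ?Q1" for X Y
    proof -
      obtain v w where [simp]: "v \<in> carrier V1" "w \<in> carrier V1"
        and [simp]: "X = W1 +>\<^bsub>V1\<^esub> v" "Y = W1 +>\<^bsub>V1\<^esub> w"
        using XY unfolding carrier1 by blast
      have "X \<oplus>\<^bsub>?Q1\<^esub> Y = W1 +>\<^bsub>V1\<^esub> (v \<oplus>\<^bsub>V1\<^esub> w)"
        using S1.a_rcos_sum[of v w] by (simp add: quotient_space_def)
      moreover have "T ` X \<oplus>\<^bsub>?Q2\<^esub> T ` Y = ?W2 +>\<^bsub>V2\<^esub> (T v \<oplus>\<^bsub>V2\<^esub> T w)"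
        using S2.a_rcos_sum[of "T v" "T w"] by (simp add: quotient_space_def coset T_closed)
      ultimately show ?thesis by (simp add: coset T_add T_smult)
    qed
    show "T ` (c \<odot>\<^bsub>?Q1\<^esub> X) = c \<odot>\<^bsub>?Q2\<^esub> T ` X" if cX: "c \<in> carrier class_ring \<and> X \<in> carrier ?Q1" for c X
    proof -
      obtain v where [simp]: "v \<in> carrier V1" "X = W1 +>\<^bsub>V1\<^esub> v"
        using cX unfolding carrier1 by blast
      show ?thesis
        using quotient_space_coset_smult[OF V1.module_axioms W1, of v c]
          quotient_space_coset_smult[OF V2.module_axioms W2, of "T v" c] T_closed T_smult by (simp add: coset)
    qed
  qed
  then show ?thesis
    using dim_eq_of_bij[OF vectorspace_quotient_space[OF V1 W1] vectorspace_quotient_space[OF V2 W2]]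
      img inj by (simp add: bij_betw_def)
qed

section \<open>Free modules and syzygies\<close>

lemma free_left_module_simps:
  "carrier (free_left_module A S) = {\<phi> \<in> S \<rightarrow>\<^sub>E carrier A. finite {s \<in> S. \<phi> s \<noteq> \<zero>\<^bsub>A\<^esub>}}"
  "\<zero>\<^bsub>free_left_module A S\<^esub> = (\<lambda>s\<in>S. \<zero>\<^bsub>A\<^esub>)"
  "\<phi> \<oplus>\<^bsub>free_left_module A S\<^esub> \<psi> = (\<lambda>s\<in>S. \<phi> s \<oplus>\<^bsub>A\<^esub> \<psi> s)"
  "r \<odot>\<^bsub>free_left_module A S\<^esub> \<phi> = (\<lambda>s\<in>S. r \<otimes>\<^bsub>A\<^esub> \<phi> s)"
  by (simp_all add: free_left_module_def)

lemma syzygy_simps: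
  "carrier (syzygy A X) = {\<phi> \<in> carrier (free_left_module A (carrier X)). free_eval A X \<phi> = \<zero>\<^bsub>X\<^esub>}"
  "\<zero>\<^bsub>syzygy A X\<^esub> = \<zero>\<^bsub>free_left_module A (carrier X)\<^esub>"
  "\<phi> \<oplus>\<^bsub>syzygy A X\<^esub> \<psi> = \<phi> \<oplus>\<^bsub>free_left_module A (carrier X)\<^esub> \<psi>"
  "r \<odot>\<^bsub>syzygy A X\<^esub> \<phi> = r \<odot>\<^bsub>free_left_module A (carrier X)\<^esub> \<phi>"
  by (simp_all add: syzygy_def)

definition free_single :: "('r, 'k) ring_scheme \<Rightarrow> 's set \<Rightarrow> 's \<Rightarrow> 'r \<Rightarrow> 's \<Rightarrow> 'r" where
  "free_single A S s a = (\<lambda>t\<in>S. if t = s then a else \<zero>\<^bsub>A\<^esub>)"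

lemma free_single_in_carrier:
  assumes "ring A" "a \<in> carrier A"
  shows "free_single A S s a \<in> carrier (free_left_module A S)"
proof -
  interpret A: ring A by fact
  have "{t \<in> S. free_single A S s a t \<noteq> \<zero>\<^bsub>A\<^esub>} \<subseteq> {s}" by (auto simp: free_single_def)
  then have "finite {t \<in> S. free_single A S s a t \<noteq> \<zero>\<^bsub>A\<^esub>}" by (rule finite_subset) simp
  then show ?thesis using assms by (auto simp: free_left_module_simps free_single_def)
qed

lemma free_left_module_closed:
  assumes "ring A"
  shows "\<phi> \<in> carrier (free_left_module A S) \<Longrightarrow> \<psi> \<in> carrier (free_left_module A S) \<Longrightarrow>
      \<phi> \<oplus>\<^bsub>free_left_module A S\<^esub> \<psi> \<in> carrier (free_left_module A S)"
    and "r \<in> carrier A \<Longrightarrow> \<phi> \<in> carrier (free_left_module A S) \<Longrightarrow>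
      r \<odot>\<^bsub>free_left_module A S\<^esub> \<phi> \<in> carrier (free_left_module A S)"
proof -
  interpret A: ring A by fact
  show "\<phi> \<oplus>\<^bsub>free_left_module A S\<^esub> \<psi> \<in> carrier (free_left_module A S)"
    if \<phi>: "\<phi> \<in> carrier (free_left_module A S)" and \<psi>: "\<psi> \<in> carrier (free_left_module A S)"
  proof -
    have "{s \<in> S. \<phi> s \<oplus>\<^bsub>A\<^esub> \<psi> s \<noteq> \<zero>\<^bsub>A\<^esub>} \<subseteq> {s \<in> S. \<phi> s \<noteq> \<zero>\<^bsub>A\<^esub>} \<union> {s \<in> S. \<psi> s \<noteq> \<zero>\<^bsub>A\<^esub>}"
      by auto
    then have "finite {s \<in> S. \<phi> s \<oplus>\<^bsub>A\<^esub> \<psi> s \<noteq> \<zero>\<^bsub>A\<^esub>}"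
      using \<phi> \<psi> by (auto simp: free_left_module_simps intro: finite_subset)
    then show ?thesis using \<phi> \<psi> by (auto simp: free_left_module_simps PiE_iff cong: conj_cong)
  qed
  show "r \<odot>\<^bsub>free_left_module A S\<^esub> \<phi> \<in> carrier (free_left_module A S)"
    if r: "r \<in> carrier A" and \<phi>: "\<phi> \<in> carrier (free_left_module A S)"
  proof -
    have "{s \<in> S. r \<otimes>\<^bsub>A\<^esub> \<phi> s \<noteq> \<zero>\<^bsub>A\<^esub>} \<subseteq> {s \<in> S. \<phi> s \<noteq> \<zero>\<^bsub>A\<^esub>}"
      using r by auto
    then have "finite {s \<in> S. r \<otimes>\<^bsub>A\<^esub> \<phi> s \<noteq> \<zero>\<^bsub>A\<^esub>}"
      using \<phi> by (auto simp: free_left_module_simps intro: finite_subset)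
    then show ?thesis using r \<phi> by (auto simp: free_left_module_simps PiE_iff cong: conj_cong)
  qed
qed

text \<open>
  The presentation of a module uses records of type \<open>('r, 'v) module\<close> without further fields.
\<close>

locale left_module_record = left_module R M
  for R :: "('r, 'k) ring_scheme" and M :: "('r, 'v) module"
begin

lemma free_eval_eq:
  assumes \<phi>: "\<phi> \<in> carrier (free_left_module R (carrier M))"
    and T: "finite T" "T \<subseteq> carrier M" "{x \<in> carrier M. \<phi> x \<noteq> \<zero>\<^bsub>R\<^esub>} \<subseteq> T"
  shows "free_eval R M \<phi> = (\<Oplus>\<^bsub>M\<^esub>x\<in>T. \<phi> x \<odot>\<^bsub>M\<^esub> x)"
proof -
  have "\<phi> x \<odot>\<^bsub>M\<^esub> x \<in> carrier M" if "x \<in> T" for x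
    using that T \<phi> by (auto simp: free_left_module_simps intro!: smult_closed)
  then show ?thesis
    unfolding free_eval_def
    using T zero_smult by (intro M.add.finprod_mono_neutral_cong_left) auto
qed

lemma free_eval_add:
  assumes \<phi>: "\<phi> \<in> carrier (free_left_module R (carrier M))" and \<psi>: "\<psi> \<in> carrier (free_left_module R (carrier M))"
  shows "free_eval R M (\<phi> \<oplus>\<^bsub>free_left_module R (carrier M)\<^esub> \<psi>) = free_eval R M \<phi> \<oplus>\<^bsub>M\<^esub> free_eval R M \<psi>"
proof -
  let ?T = "{x \<in> carrier M. \<phi> x \<noteq> \<zero>\<^bsub>R\<^esub>} \<union> {x \<in> carrier M. \<psi> x \<noteq> \<zero>\<^bsub>R\<^esub>}"
  have T: "finite ?T" "?T \<subseteq> carrier M" using \<phi> \<psi> by (auto simp: free_left_module_simps)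
  have c: "\<phi> x \<in> carrier R" "\<psi> x \<in> carrier R" if "x \<in> carrier M" for x
    using that \<phi> \<psi> by (auto simp: free_left_module_simps)
  let ?s = "\<phi> \<oplus>\<^bsub>free_left_module R (carrier M)\<^esub> \<psi>"
  have cM: "\<phi> x \<odot>\<^bsub>M\<^esub> x \<in> carrier M" "\<psi> x \<odot>\<^bsub>M\<^esub> x \<in> carrier M" if "x \<in> ?T" for x
    using that c smult_closed by auto
  have s: "?s \<in> carrier (free_left_module R (carrier M))"
    by (rule free_left_module_closed(1)[OF R.ring_axioms \<phi> \<psi>])
  have supp: "{x \<in> carrier M. ?s x \<noteq> \<zero>\<^bsub>R\<^esub>} \<subseteq> ?T"
    by (auto simp: free_left_module_simps)
  have s_eq: "?s x \<odot>\<^bsub>M\<^esub> x = \<phi> x \<odot>\<^bsub>M\<^esub> x \<oplus>\<^bsub>M\<^esub> \<psi> x \<odot>\<^bsub>M\<^esub> x" if "x \<in> ?T" for x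
    using that c T(2) by (auto simp: free_left_module_simps smult_l_distr)
  have "free_eval R M ?s = (\<Oplus>\<^bsub>M\<^esub>x\<in>?T. ?s x \<odot>\<^bsub>M\<^esub> x)"
    by (rule free_eval_eq[OF s T supp])
  also have "\<dots> = (\<Oplus>\<^bsub>M\<^esub>x\<in>?T. \<phi> x \<odot>\<^bsub>M\<^esub> x \<oplus>\<^bsub>M\<^esub> \<psi> x \<odot>\<^bsub>M\<^esub> x)"
    using cM s_eq by (intro M.add.finprod_cong') (simp_all add: Pi_iff)
  also have "\<dots> = (\<Oplus>\<^bsub>M\<^esub>x\<in>?T. \<phi> x \<odot>\<^bsub>M\<^esub> x) \<oplus>\<^bsub>M\<^esub> (\<Oplus>\<^bsub>M\<^esub>x\<in>?T. \<psi> x \<odot>\<^bsub>M\<^esub> x)"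
    using cM by (intro M.finsum_addf) (simp_all add: Pi_iff)
  also have "(\<Oplus>\<^bsub>M\<^esub>x\<in>?T. \<phi> x \<odot>\<^bsub>M\<^esub> x) = free_eval R M \<phi>"
    by (rule free_eval_eq[OF \<phi> T, symmetric]) simp
  also have "(\<Oplus>\<^bsub>M\<^esub>x\<in>?T. \<psi> x \<odot>\<^bsub>M\<^esub> x) = free_eval R M \<psi>"
    by (rule free_eval_eq[OF \<psi> T, symmetric]) simp
  finally show ?thesis .
qed

lemma free_eval_smult:
  assumes r: "r \<in> carrier R" and \<phi>: "\<phi> \<in> carrier (free_left_module R (carrier M))"
  shows "free_eval R M (r \<odot>\<^bsub>free_left_module R (carrier M)\<^esub> \<phi>) = r \<odot>\<^bsub>M\<^esub> free_eval R M \<phi>"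
proof -
  let ?T = "{x \<in> carrier M. \<phi> x \<noteq> \<zero>\<^bsub>R\<^esub>}"
  have T: "finite ?T" "?T \<subseteq> carrier M" using \<phi> by (auto simp: free_left_module_simps)
  have c: "\<phi> x \<in> carrier R" if "x \<in> carrier M" for x
    using that \<phi> by (auto simp: free_left_module_simps)
  let ?s = "r \<odot>\<^bsub>free_left_module R (carrier M)\<^esub> \<phi>"
  have cM: "\<phi> x \<odot>\<^bsub>M\<^esub> x \<in> carrier M" if "x \<in> ?T" for x
    using that c smult_closed by auto
  have s: "?s \<in> carrier (free_left_module R (carrier M))"
    by (rule free_left_module_closed(2)[OF R.ring_axioms r \<phi>])
  have supp: "{x \<in> carrier M. ?s x \<noteq> \<zero>\<^bsub>R\<^esub>} \<subseteq> ?T"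
    using r by (auto simp: free_left_module_simps)
  have s_eq: "?s x \<odot>\<^bsub>M\<^esub> x = r \<odot>\<^bsub>M\<^esub> (\<phi> x \<odot>\<^bsub>M\<^esub> x)" if "x \<in> ?T" for x
    using that c r by (auto simp: free_left_module_simps smult_assoc)
  have "free_eval R M ?s = (\<Oplus>\<^bsub>M\<^esub>x\<in>?T. ?s x \<odot>\<^bsub>M\<^esub> x)"
    by (rule free_eval_eq[OF s T supp])
  also have "\<dots> = (\<Oplus>\<^bsub>M\<^esub>x\<in>?T. r \<odot>\<^bsub>M\<^esub> (\<phi> x \<odot>\<^bsub>M\<^esub> x))"
    using cM s_eq smult_closed[OF r] by (intro M.add.finprod_cong') (simp_all add: Pi_iff)
  also have "\<dots> = r \<odot>\<^bsub>M\<^esub> (\<Oplus>\<^bsub>M\<^esub>x\<in>?T. \<phi> x \<odot>\<^bsub>M\<^esub> x)"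
    using cM r T by (intro smult_finsum[symmetric]) (simp_all add: Pi_iff)
  also have "(\<Oplus>\<^bsub>M\<^esub>x\<in>?T. \<phi> x \<odot>\<^bsub>M\<^esub> x) = free_eval R M \<phi>"
    by (rule free_eval_eq[OF \<phi> T, symmetric]) simp
  finally show ?thesis .
qed

lemma free_eval_single:
  assumes "x \<in> carrier M" "a \<in> carrier R"
  shows "free_eval R M (free_single R (carrier M) x a) = a \<odot>\<^bsub>M\<^esub> x"
proof -
  have "free_eval R M (free_single R (carrier M) x a)
      = (\<Oplus>\<^bsub>M\<^esub>y\<in>{x}. free_single R (carrier M) x a y \<odot>\<^bsub>M\<^esub> y)"
  proof (rule free_eval_eq)
    show "free_single R (carrier M) x a \<in> carrier (free_left_module R (carrier M))"
      by (rule free_single_in_carrier[OF R.ring_axioms assms(2)])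
    show "{y \<in> carrier M. free_single R (carrier M) x a y \<noteq> \<zero>\<^bsub>R\<^esub>} \<subseteq> {x}"
      by (auto simp: free_single_def)
  qed (use assms in simp_all)
  then show ?thesis using assms smult_closed by (simp add: free_single_def)
qed

lemma syzygy_closed:
  "\<phi> \<in> carrier (syzygy R M) \<Longrightarrow> \<psi> \<in> carrier (syzygy R M) \<Longrightarrow> \<phi> \<oplus>\<^bsub>syzygy R M\<^esub> \<psi> \<in> carrier (syzygy R M)"
  "r \<in> carrier R \<Longrightarrow> \<phi> \<in> carrier (syzygy R M) \<Longrightarrow> r \<odot>\<^bsub>syzygy R M\<^esub> \<phi> \<in> carrier (syzygy R M)"
  by (auto simp: syzygy_simps free_left_module_closed[OF R.ring_axioms] free_eval_add free_eval_smult smult_zero)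

end

section \<open>Restriction of scalars along a surjection\<close>

text \<open>
  A surjection of complex algebras. Both algebras have elements of the same type, so that one record
  can serve as a module over either of them.
\<close>

locale restriction_of_scalars =
  fixes A :: "('r, 'k) ring_scheme" and B :: "('r, 'l) ring_scheme" and \<pi> :: "'r \<Rightarrow> 'r"
    and \<iota>A \<iota>B :: "complex \<Rightarrow> 'r"
  assumes ring_A: "ring A" and ring_B: "ring B"
    and hom: "\<pi> \<in> Ring.ring_hom A B" and surj: "\<pi> ` carrier A = carrier B"
    and \<iota>A: "\<iota>A \<in> Ring.ring_hom class_ring A" and \<iota>B: "\<iota>B \<in> Ring.ring_hom class_ring B"
    and central_A: "\<And>c a. a \<in> carrier A \<Longrightarrow> \<iota>A c \<otimes>\<^bsub>A\<^esub> a = a \<otimes>\<^bsub>A\<^esub> \<iota>A c"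
    and central_B: "\<And>c b. b \<in> carrier B \<Longrightarrow> \<iota>B c \<otimes>\<^bsub>B\<^esub> b = b \<otimes>\<^bsub>B\<^esub> \<iota>B c"
    and \<iota>_compat: "\<And>c. \<pi> (\<iota>A c) = \<iota>B c"
begin

definition restrict_scalars :: "('r, 'y) module \<Rightarrow> ('r, 'y) module" where
  "restrict_scalars Y = Y\<lparr>smult := (\<lambda>a y. \<pi> a \<odot>\<^bsub>Y\<^esub> y)\<rparr>"

lemma restrict_scalars_simps [simp]:
  "carrier (restrict_scalars Y) = carrier Y" "\<zero>\<^bsub>restrict_scalars Y\<^esub> = \<zero>\<^bsub>Y\<^esub>" "add (restrict_scalars Y) = add Y"
  "a \<odot>\<^bsub>restrict_scalars Y\<^esub> y = \<pi> a \<odot>\<^bsub>Y\<^esub> y"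
  by (simp_all add: restrict_scalars_def)

lemma \<pi>_closed: "a \<in> carrier A \<Longrightarrow> \<pi> a \<in> carrier B"
  using ring_hom_closed[OF hom] .

lemma \<pi>_zero: "\<pi> \<zero>\<^bsub>A\<^esub> = \<zero>\<^bsub>B\<^esub>"
  using ring_hom_zero[OF hom ring_A ring_B] .

lemma left_module_restrict_scalars:
  assumes "left_module B Y"
  shows "left_module A (restrict_scalars Y)"
proof -
  interpret Y: left_module B Y by fact
  have "abelian_group (restrict_scalars Y)"
    by (rule abelian_groupI) (auto simp: Y.M.a_ac intro: Y.M.l_neg Y.M.add.l_inv_ex)
  then show ?thesis
    by (intro left_module.intro left_module_axioms.intro ring_A)
      (simp_all add: \<pi>_closed Y.smult_closed Y.smult_l_distr Y.smult_r_distr Y.smult_assoc Y.smult_one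
        ring_hom_add[OF hom] ring_hom_mult[OF hom] ring_hom_one[OF hom])
qed

lemma hom_space_restrict_scalars:
  assumes X: "\<And>a x. a \<in> carrier A \<Longrightarrow> x \<in> carrier X \<Longrightarrow> \<pi> a \<odot>\<^bsub>X\<^esub> x = a \<odot>\<^bsub>X\<^esub> x"
  shows "hom_space A \<iota>A X (restrict_scalars Y) = hom_space B \<iota>B X Y"
proof -
  have "(\<forall>a x. a \<in> carrier A \<and> x \<in> carrier X \<longrightarrow> f (a \<odot>\<^bsub>X\<^esub> x) = \<pi> a \<odot>\<^bsub>Y\<^esub> f x) \<longleftrightarrow>
      (\<forall>b x. b \<in> carrier B \<and> x \<in> carrier X \<longrightarrow> f (b \<odot>\<^bsub>X\<^esub> x) = b \<odot>\<^bsub>Y\<^esub> f x)" for f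
  proof -
    have "(\<forall>b x. b \<in> carrier B \<and> x \<in> carrier X \<longrightarrow> f (b \<odot>\<^bsub>X\<^esub> x) = b \<odot>\<^bsub>Y\<^esub> f x) \<longleftrightarrow>
      (\<forall>a\<in>carrier A. \<forall>x\<in>carrier X. f (\<pi> a \<odot>\<^bsub>X\<^esub> x) = \<pi> a \<odot>\<^bsub>Y\<^esub> f x)"
      unfolding surj[symmetric] by blast
    also have "\<dots> \<longleftrightarrow> (\<forall>a\<in>carrier A. \<forall>x\<in>carrier X. f (a \<odot>\<^bsub>X\<^esub> x) = \<pi> a \<odot>\<^bsub>Y\<^esub> f x)"
      by (simp add: X)
    finally show ?thesis by blast
  qed
  then have "LinearCombinations.module_hom A X (restrict_scalars Y) = LinearCombinations.module_hom B X Y"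
    unfolding LinearCombinations.module_hom_def by simp
  then show ?thesis by (simp add: hom_space_def \<iota>_compat)
qed

text \<open>
  If \<open>p : N \<rightarrow> N'\<close> is a surjection that is semilinear along \<open>\<pi>\<close>, composition with \<open>p\<close> is injective, and
  its image consists of the homomorphisms that are constant on the fibres of \<open>p\<close>: on such an \<open>h\<close> the
  values at preimages define the inverse. Applied to free modules and to syzygies this compares
  the two spaces in the definition of \<open>Ext\<^sup>1\<close>.
\<close>

lemma hom_space_descent:
  fixes N :: "('r, 'm) module" and N' :: "('r, 'm') module" and p :: "'m \<Rightarrow> 'm'"
  assumes Y: "left_module B Y"
    and N_add: "\<And>x y. x \<in> carrier N \<Longrightarrow> y \<in> carrier N \<Longrightarrow> x \<oplus>\<^bsub>N\<^esub> y \<in> carrier N"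
    and N_smult: "\<And>a x. a \<in> carrier A \<Longrightarrow> x \<in> carrier N \<Longrightarrow> a \<odot>\<^bsub>N\<^esub> x \<in> carrier N"
    and p_surj: "p ` carrier N = carrier N'"
    and p_add: "\<And>x y. x \<in> carrier N \<Longrightarrow> y \<in> carrier N \<Longrightarrow> p (x \<oplus>\<^bsub>N\<^esub> y) = p x \<oplus>\<^bsub>N'\<^esub> p y"
    and p_smult: "\<And>a x. a \<in> carrier A \<Longrightarrow> x \<in> carrier N \<Longrightarrow> p (a \<odot>\<^bsub>N\<^esub> x) = \<pi> a \<odot>\<^bsub>N'\<^esub> p x"
    and fibres: "\<And>h x y. h \<in> LinearCombinations.module_hom A N (restrict_scalars Y) \<Longrightarrow> x \<in> carrier N \<Longrightarrow>
      y \<in> carrier N \<Longrightarrow> p x = p y \<Longrightarrow> h x = h y"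
  shows "vectorspace class_ring (hom_space A \<iota>A N (restrict_scalars Y))" (is ?vs1)
    and "vectorspace class_ring (hom_space B \<iota>B N' Y)" (is ?vs2)
    and "(\<lambda>g. \<lambda>x\<in>carrier N. g (p x)) \<in> LinearCombinations.module_hom class_ring
        (hom_space B \<iota>B N' Y) (hom_space A \<iota>A N (restrict_scalars Y))" (is ?linear)
    and "bij_betw (\<lambda>g. \<lambda>x\<in>carrier N. g (p x))
        (carrier (hom_space B \<iota>B N' Y)) (carrier (hom_space A \<iota>A N (restrict_scalars Y)))" (is ?bij)
proof -
  let ?HA = "hom_space A \<iota>A N (restrict_scalars Y)" and ?HB = "hom_space B \<iota>B N' Y"
  let ?T = "\<lambda>g. \<lambda>x\<in>carrier N. g (p x)"
  have in_N': "p x \<in> carrier N'" if "x \<in> carrier N" for x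
    using that p_surj by blast
  have lift: "\<exists>x\<in>carrier N. y = p x" if "y \<in> carrier N'" for y
    using that p_surj by blast
  have lift_B: "\<exists>a\<in>carrier A. b = \<pi> a" if "b \<in> carrier B" for b
    using that surj by blast
  have N'_add: "x \<oplus>\<^bsub>N'\<^esub> y \<in> carrier N'" if xy: "x \<in> carrier N'" "y \<in> carrier N'" for x y
  proof -
    obtain x0 y0 where "x0 \<in> carrier N" "x = p x0" "y0 \<in> carrier N" "y = p y0"
      using lift xy by blast
    then show ?thesis using in_N'[OF N_add[of x0 y0]] p_add[of x0 y0] by simp
  qed
  have N'_smult: "b \<odot>\<^bsub>N'\<^esub> x \<in> carrier N'" if bx: "b \<in> carrier B" "x \<in> carrier N'" for b x
  proof -
    obtain x0 a where "x0 \<in> carrier N" "x = p x0" "a \<in> carrier A" "b = \<pi> a"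
      using lift lift_B bx by blast
    then show ?thesis using in_N'[OF N_smult[of a x0]] p_smult[of a x0] by simp
  qed
  show ?vs1
    by (rule vectorspace_hom_space[OF left_module_restrict_scalars[OF Y] N_add N_smult \<iota>A central_A])
  show ?vs2
    by (rule vectorspace_hom_space[OF Y N'_add N'_smult \<iota>B central_B])
  have T_closed: "?T g \<in> carrier ?HA" if g: "g \<in> carrier ?HB" for g
    using g by (auto simp: hom_space_def LinearCombinations.module_hom_def in_N' N_add N_smult p_add p_smult \<pi>_closed)
  show ?linear
    unfolding LinearCombinations.module_hom_def[of class_ring]
    using T_closed by (auto simp: hom_space_def in_N' \<iota>_compat)
  have inj: "inj_on ?T (carrier ?HB)"
  proof (rule inj_onI)
    fix g g' assume g: "g \<in> carrier ?HB" "g' \<in> carrier ?HB" "?T g = ?T g'"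
    show "g = g'"
    proof (rule extensionalityI[of _ "carrier N'"])
      show "g y = g' y" if y: "y \<in> carrier N'" for y
      proof -
        obtain x where x: "x \<in> carrier N" "y = p x" using lift[OF y] by blast
        then show ?thesis using fun_cong[OF g(3), of x] by simp
      qed
    qed (use g in \<open>auto simp: hom_space_def\<close>)
  qed
  have "\<exists>g\<in>carrier ?HB. h = ?T g" if h: "h \<in> carrier ?HA" for h
  proof -
    have h_hom: "h \<in> LinearCombinations.module_hom A N (restrict_scalars Y)" and h_ext: "h \<in> extensional (carrier N)"
      using h by (simp_all add: hom_space_def)
    define s where "s y = (SOME x. x \<in> carrier N \<and> p x = y)" for y
    have "s y \<in> carrier N \<and> p (s y) = y" if "y \<in> carrier N'" for y
      unfolding s_def by (rule someI_ex) (use lift[OF that] in blast)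
    then have s: "s y \<in> carrier N" "p (s y) = y" if "y \<in> carrier N'" for y
      using that by auto
    define g where "g = (\<lambda>y\<in>carrier N'. h (s y))"
    have gp: "g (p x) = h x" if "x \<in> carrier N" for x
      using fibres[OF h_hom s(1)[OF in_N'[OF that]] that] s(2)[OF in_N'[OF that]] in_N'[OF that]
      by (simp add: g_def)
    have "g \<in> LinearCombinations.module_hom B N' Y"
      unfolding LinearCombinations.module_hom_def
    proof (intro CollectI conjI allI impI)
      show "g \<in> carrier N' \<rightarrow> carrier Y"
        using h_hom s(1) by (auto simp: LinearCombinations.module_hom_def g_def)
      show "g (x \<oplus>\<^bsub>N'\<^esub> y) = g x \<oplus>\<^bsub>Y\<^esub> g y" if xy: "x \<in> carrier N' \<and> y \<in> carrier N'" for x y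
      proof -
        obtain x0 y0 where "x0 \<in> carrier N" "x = p x0" "y0 \<in> carrier N" "y = p y0"
          using lift xy by blast
        then show ?thesis
          using gp[OF N_add[of x0 y0]] p_add[of x0 y0] gp[of x0] gp[of y0] h_hom
          by (simp add: LinearCombinations.module_hom_def)
      qed
      show "g (b \<odot>\<^bsub>N'\<^esub> x) = b \<odot>\<^bsub>Y\<^esub> g x" if bx: "b \<in> carrier B \<and> x \<in> carrier N'" for b x
      proof -
        obtain x0 a where "x0 \<in> carrier N" "x = p x0" "a \<in> carrier A" "b = \<pi> a"
          using lift lift_B bx by blast
        then show ?thesis
          using gp[OF N_smult[of a x0]] p_smult[of a x0] gp[of x0] h_hom
          by (simp add: LinearCombinations.module_hom_def)
      qed
    qed
    then have "g \<in> carrier ?HB" by (simp add: hom_space_def g_def)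
    moreover have "h = ?T g"
      using h_ext by (intro extensionalityI[of _ "carrier N"]) (auto simp: gp)
    ultimately show ?thesis by blast
  qed
  then show ?bij using inj T_closed unfolding bij_betw_def by blast
qed

text \<open>
  Applying \<open>\<pi>\<close> to the coefficients is a surjection \<open>p\<close> from the free \<open>A\<close>-module onto the free \<open>B\<close>-module
  on \<open>X\<close>. It commutes with the evaluation maps to \<open>X\<close>, hence the syzygy over \<open>A\<close> is the full preimage of
  the syzygy over \<open>B\<close>. The kernel of \<open>p\<close> is generated as an additive group by the elements \<open>a s\<close> with
  \<open>\<pi> a = 0\<close>. A homomorphism on the free module kills them, since \<open>a s\<close> is the multiple by \<open>a\<close> of the
  generator \<open>s\<close>. The syzygy need not contain \<open>s\<close>, and there the condition \<open>kill\<close> takes the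
  place of this argument.
\<close>

lemma dim_ext1_space_restrict_scalars:
  fixes X :: "('r, 'x) module" and Y :: "('r, 'y) module"
  assumes XA: "left_module A X" and XB: "left_module B X" and Y: "left_module B Y"
    and X: "\<And>a x. a \<in> carrier A \<Longrightarrow> x \<in> carrier X \<Longrightarrow> \<pi> a \<odot>\<^bsub>X\<^esub> x = a \<odot>\<^bsub>X\<^esub> x"
    and kill: "\<And>h a x. h \<in> LinearCombinations.module_hom A (syzygy A X) (restrict_scalars Y) \<Longrightarrow>
      a \<in> carrier A \<Longrightarrow> \<pi> a = \<zero>\<^bsub>B\<^esub> \<Longrightarrow> x \<in> carrier X \<Longrightarrow> h (free_single A (carrier X) x a) = \<zero>\<^bsub>Y\<^esub>"
  shows "cdim (ext1_space A \<iota>A X (restrict_scalars Y)) = cdim (ext1_space B \<iota>B X Y)"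
proof -
  interpret A: ring A by (rule ring_A)
  interpret B: ring B by (rule ring_B)
  interpret XA: left_module_record A X using XA by (simp add: left_module_record_def)
  interpret XB: left_module_record B X using XB by (simp add: left_module_record_def)
  interpret Y: left_module B Y by (rule Y)
  let ?S = "carrier X"
  let ?FA = "free_left_module A ?S" and ?FB = "free_left_module B ?S"
  let ?KA = "syzygy A X" and ?KB = "syzygy B X"
  define p where "p = (\<lambda>\<phi>. \<lambda>s\<in>?S. \<pi> (\<phi> s))"
  have p_closed: "p \<phi> \<in> carrier ?FB" if \<phi>: "\<phi> \<in> carrier ?FA" for \<phi>
  proof -
    have "{s \<in> ?S. \<pi> (\<phi> s) \<noteq> \<zero>\<^bsub>B\<^esub>} \<subseteq> {s \<in> ?S. \<phi> s \<noteq> \<zero>\<^bsub>A\<^esub>}" by (auto simp: \<pi>_zero)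
    then have "finite {s \<in> ?S. \<pi> (\<phi> s) \<noteq> \<zero>\<^bsub>B\<^esub>}"
      using \<phi> by (auto simp: free_left_module_simps intro: finite_subset)
    then show ?thesis using \<phi>
      by (auto simp: p_def free_left_module_simps PiE_iff \<pi>_closed cong: conj_cong)
  qed
  have p_add: "p (\<phi> \<oplus>\<^bsub>?FA\<^esub> \<psi>) = p \<phi> \<oplus>\<^bsub>?FB\<^esub> p \<psi>" if "\<phi> \<in> carrier ?FA" "\<psi> \<in> carrier ?FA" for \<phi> \<psi>
    using that by (auto simp: p_def free_left_module_simps PiE_iff ring_hom_add[OF hom] intro!: restrict_ext)
  have p_smult: "p (a \<odot>\<^bsub>?FA\<^esub> \<phi>) = \<pi> a \<odot>\<^bsub>?FB\<^esub> p \<phi>" if "a \<in> carrier A" "\<phi> \<in> carrier ?FA" for a \<phi>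
    using that by (auto simp: p_def free_left_module_simps PiE_iff ring_hom_mult[OF hom] intro!: restrict_ext)
  have p_surj: "\<exists>\<phi>\<in>carrier ?FA. \<psi> = p \<phi>" if \<psi>: "\<psi> \<in> carrier ?FB" for \<psi>
  proof -
    \<comment> \<open>The lift of 0 is chosen to be 0, which keeps the lifted function finitely supported.\<close>
    define r where "r b = (if b = \<zero>\<^bsub>B\<^esub> then \<zero>\<^bsub>A\<^esub> else inv_into (carrier A) \<pi> b)" for b
    have r: "r b \<in> carrier A" "\<pi> (r b) = b" if "b \<in> carrier B" for b
      using that inv_into_into[of b \<pi> "carrier A"] f_inv_into_f[of b \<pi> "carrier A"]
      unfolding r_def surj by (auto simp: \<pi>_zero)
    have "{s \<in> ?S. r (\<psi> s) \<noteq> \<zero>\<^bsub>A\<^esub>} \<subseteq> {s \<in> ?S. \<psi> s \<noteq> \<zero>\<^bsub>B\<^esub>}" by (auto simp: r_def)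
    then have "finite {s \<in> ?S. r (\<psi> s) \<noteq> \<zero>\<^bsub>A\<^esub>}"
      using \<psi> by (auto simp: free_left_module_simps intro: finite_subset)
    then have "(\<lambda>s\<in>?S. r (\<psi> s)) \<in> carrier ?FA"
      using \<psi> r by (auto simp: free_left_module_simps PiE_iff cong: conj_cong)
    moreover have "\<psi> = p (\<lambda>s\<in>?S. r (\<psi> s))"
      using \<psi> r by (intro extensionalityI[of _ ?S]) (auto simp: p_def free_left_module_simps PiE_iff)
    ultimately show ?thesis by blast
  qed
  have eval: "free_eval B X (p \<phi>) = free_eval A X \<phi>" if \<phi>: "\<phi> \<in> carrier ?FA" for \<phi>
  proof -
    let ?T = "{s \<in> ?S. \<phi> s \<noteq> \<zero>\<^bsub>A\<^esub>}"
    have T: "finite ?T" "?T \<subseteq> ?S" and c: "\<And>s. s \<in> ?S \<Longrightarrow> \<phi> s \<in> carrier A"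
      using \<phi> by (auto simp: free_left_module_simps)
    have "free_eval B X (p \<phi>) = (\<Oplus>\<^bsub>X\<^esub>s\<in>?T. p \<phi> s \<odot>\<^bsub>X\<^esub> s)"
      by (rule XB.free_eval_eq[OF p_closed[OF \<phi>] T]) (auto simp: p_def \<pi>_zero)
    also have "\<dots> = (\<Oplus>\<^bsub>X\<^esub>s\<in>?T. \<phi> s \<odot>\<^bsub>X\<^esub> s)"
      using c XA.smult_closed X by (intro XA.M.add.finprod_cong') (simp_all add: Pi_iff p_def)
    also have "\<dots> = free_eval A X \<phi>"
      by (rule XA.free_eval_eq[OF \<phi> T, symmetric]) simp
    finally show ?thesis .
  qed
  have in_KA: "\<phi> \<in> carrier ?KA \<longleftrightarrow> p \<phi> \<in> carrier ?KB" if "\<phi> \<in> carrier ?FA" for \<phi>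
    using eval[OF that] p_closed[OF that] that by (simp add: syzygy_simps)
  have KA_FA: "\<phi> \<in> carrier ?FA" if "\<phi> \<in> carrier ?KA" for \<phi>
    using that by (simp add: syzygy_simps)
  have p_KA: "p ` carrier ?KA = carrier ?KB"
    using p_surj in_KA KA_FA by (auto simp: syzygy_simps(1)[of B])
  have p_FA: "p ` carrier ?FA = carrier ?FB"
    using p_surj p_closed by blast

  \<comment> \<open>Induction on the support, splitting off one generator at a time; all intermediate elements stay
    in the kernel of \<open>p\<close>, so additivity of \<open>h\<close> is only needed there.\<close>
  have vanish: "h \<phi> = \<zero>\<^bsub>Y\<^esub>"
    if h_add: "\<And>\<phi> \<psi>. p \<phi> = p \<zero>\<^bsub>?FA\<^esub> \<Longrightarrow> p \<psi> = p \<zero>\<^bsub>?FA\<^esub> \<Longrightarrow> \<phi> \<in> carrier ?FA \<Longrightarrow> \<psi> \<in> carrier ?FA \<Longrightarrow>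
          h (\<phi> \<oplus>\<^bsub>?FA\<^esub> \<psi>) = h \<phi> \<oplus>\<^bsub>Y\<^esub> h \<psi>"
      and h_single: "\<And>s a. s \<in> ?S \<Longrightarrow> a \<in> carrier A \<Longrightarrow> \<pi> a = \<zero>\<^bsub>B\<^esub> \<Longrightarrow> h (free_single A ?S s a) = \<zero>\<^bsub>Y\<^esub>"
      and h_zero: "h \<zero>\<^bsub>?FA\<^esub> = \<zero>\<^bsub>Y\<^esub>"
      and \<phi>: "\<phi> \<in> carrier ?FA" "p \<phi> = p \<zero>\<^bsub>?FA\<^esub>" for h :: "('x \<Rightarrow> 'r) \<Rightarrow> 'y" and \<phi>
  proof -
    have ker: "p \<phi> = p \<zero>\<^bsub>?FA\<^esub> \<longleftrightarrow> (\<forall>s\<in>?S. \<pi> (\<phi> s) = \<zero>\<^bsub>B\<^esub>)" for \<phi>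
      by (auto simp: p_def free_left_module_simps \<pi>_zero fun_eq_iff)
    have "\<phi> \<in> carrier ?FA \<Longrightarrow> p \<phi> = p \<zero>\<^bsub>?FA\<^esub> \<Longrightarrow> {s \<in> ?S. \<phi> s \<noteq> \<zero>\<^bsub>A\<^esub>} \<subseteq> T \<Longrightarrow> h \<phi> = \<zero>\<^bsub>Y\<^esub>" if "finite T" for T \<phi>
      using that
    proof (induct T arbitrary: \<phi> rule: finite_induct)
      case empty
      then have "\<phi> = \<zero>\<^bsub>?FA\<^esub>"
        by (intro extensionalityI[of _ ?S]) (auto simp: free_left_module_simps PiE_iff)
      then show ?case by (simp only: h_zero)
    next
      case (insert t T)
      show ?case
      proof (cases "t \<in> ?S")
        case True
        define \<psi> where "\<psi> = \<phi>(t := \<zero>\<^bsub>A\<^esub>)"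
        have supp: "{s \<in> ?S. \<psi> s \<noteq> \<zero>\<^bsub>A\<^esub>} \<subseteq> {s \<in> ?S. \<phi> s \<noteq> \<zero>\<^bsub>A\<^esub>}" by (auto simp: \<psi>_def)
        then have "finite {s \<in> ?S. \<psi> s \<noteq> \<zero>\<^bsub>A\<^esub>}"
          using insert.prems(1) by (auto simp: free_left_module_simps intro: finite_subset)
        then have \<psi>: "\<psi> \<in> carrier ?FA"
          using insert.prems(1) True by (auto simp: free_left_module_simps \<psi>_def PiE_iff extensional_def)
        have \<psi>_ker: "p \<psi> = p \<zero>\<^bsub>?FA\<^esub>"
          using insert.prems(2) unfolding ker by (simp add: \<psi>_def \<pi>_zero)
        have "h \<psi> = \<zero>\<^bsub>Y\<^esub>"
          using insert.prems(3) by (intro insert.hyps(3) \<psi> \<psi>_ker) (auto simp: \<psi>_def)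
        have t: "\<phi> t \<in> carrier A" "\<pi> (\<phi> t) = \<zero>\<^bsub>B\<^esub>"
          using insert.prems(1,2) True unfolding ker by (auto simp: free_left_module_simps)
        let ?\<delta> = "free_single A ?S t (\<phi> t)"
        have \<delta>: "?\<delta> \<in> carrier ?FA" by (rule free_single_in_carrier[OF ring_A t(1)])
        have \<delta>_ker: "p ?\<delta> = p \<zero>\<^bsub>?FA\<^esub>"
          unfolding ker using t by (simp add: free_single_def \<pi>_zero)
        have "\<phi> = ?\<delta> \<oplus>\<^bsub>?FA\<^esub> \<psi>"
          using insert.prems(1) by (intro extensionalityI[of _ ?S])
            (auto simp: free_left_module_simps free_single_def \<psi>_def PiE_iff)
        then show ?thesis
          using h_add[OF \<delta>_ker \<psi>_ker \<delta> \<psi>] h_single[OF True t] \<open>h \<psi> = \<zero>\<^bsub>Y\<^esub>\<close> by simp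
      next
        case False
        then show ?thesis using insert.prems insert.hyps(3)[of \<phi>] by auto
      qed
    qed
    from this[OF _ \<phi> subset_refl] show ?thesis using \<phi>(1) by (auto simp: free_left_module_simps)
  qed
  have fibres: "h \<phi> = h \<psi>"
    if N: "carrier N \<subseteq> carrier ?FA" "\<And>\<phi> \<psi>. \<phi> \<oplus>\<^bsub>N\<^esub> \<psi> = \<phi> \<oplus>\<^bsub>?FA\<^esub> \<psi>"
        "\<And>\<phi>. \<phi> \<in> carrier ?FA \<Longrightarrow> p \<phi> = p \<zero>\<^bsub>?FA\<^esub> \<Longrightarrow> \<phi> \<in> carrier N"
      and h: "h \<in> LinearCombinations.module_hom A N (restrict_scalars Y)"
      and h_single: "\<And>s a. s \<in> ?S \<Longrightarrow> a \<in> carrier A \<Longrightarrow> \<pi> a = \<zero>\<^bsub>B\<^esub> \<Longrightarrow> h (free_single A ?S s a) = \<zero>\<^bsub>Y\<^esub>"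
      and \<phi>\<psi>: "\<phi> \<in> carrier N" "\<psi> \<in> carrier N" "p \<phi> = p \<psi>" for N :: "('r, 'x \<Rightarrow> 'r) module" and h \<phi> \<psi>
  proof -
    have h_add: "h (\<phi> \<oplus>\<^bsub>?FA\<^esub> \<psi>) = h \<phi> \<oplus>\<^bsub>Y\<^esub> h \<psi>" and h_closed: "h \<phi> \<in> carrier Y"
      if "\<phi> \<in> carrier N" "\<psi> \<in> carrier N" for \<phi> \<psi>
      using h that by (auto simp: LinearCombinations.module_hom_def N(2))
    have zero_FA: "\<zero>\<^bsub>?FA\<^esub> \<in> carrier ?FA" by (simp add: free_left_module_simps)
    then have zero_N: "\<zero>\<^bsub>?FA\<^esub> \<in> carrier N" by (intro N(3)) simp_all
    have "\<zero>\<^bsub>?FA\<^esub> \<oplus>\<^bsub>?FA\<^esub> \<zero>\<^bsub>?FA\<^esub> = \<zero>\<^bsub>?FA\<^esub>"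
      by (auto simp: free_left_module_simps intro!: restrict_ext)
    then have h_zero: "h \<zero>\<^bsub>?FA\<^esub> = \<zero>\<^bsub>Y\<^esub>"
      using h_add[OF zero_N zero_N] h_closed[OF zero_N zero_N] by (simp add: Y.M.add.l_cancel_one')
    define \<delta> where "\<delta> = (\<lambda>s\<in>?S. \<psi> s \<ominus>\<^bsub>A\<^esub> \<phi> s)"
    have \<phi>\<psi>_FA: "\<phi> \<in> carrier ?FA" "\<psi> \<in> carrier ?FA" using \<phi>\<psi> N(1) by auto
    have "{s \<in> ?S. \<psi> s \<ominus>\<^bsub>A\<^esub> \<phi> s \<noteq> \<zero>\<^bsub>A\<^esub>} \<subseteq> {s \<in> ?S. \<phi> s \<noteq> \<zero>\<^bsub>A\<^esub>} \<union> {s \<in> ?S. \<psi> s \<noteq> \<zero>\<^bsub>A\<^esub>}"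
      by (auto simp: a_minus_def)
    then have "finite {s \<in> ?S. \<psi> s \<ominus>\<^bsub>A\<^esub> \<phi> s \<noteq> \<zero>\<^bsub>A\<^esub>}"
      using \<phi>\<psi>_FA by (auto simp: free_left_module_simps intro: finite_subset)
    then have \<delta>: "\<delta> \<in> carrier ?FA"
      using \<phi>\<psi>_FA by (auto simp: \<delta>_def free_left_module_simps PiE_iff cong: conj_cong)
    have eq: "\<psi> = \<phi> \<oplus>\<^bsub>?FA\<^esub> \<delta>"
    proof (rule extensionalityI[of _ ?S])
      fix s assume "s \<in> ?S"
      then have "\<phi> s \<in> carrier A" "\<psi> s \<in> carrier A"
        using \<phi>\<psi>_FA by (auto simp: free_left_module_simps)
      then have "\<psi> s = \<phi> s \<oplus>\<^bsub>A\<^esub> (\<psi> s \<ominus>\<^bsub>A\<^esub> \<phi> s)" by algebra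
      then show "\<psi> s = (\<phi> \<oplus>\<^bsub>?FA\<^esub> \<delta>) s"
        using \<open>s \<in> ?S\<close> by (simp add: \<delta>_def free_left_module_simps)
    qed (use \<phi>\<psi>_FA in \<open>auto simp: free_left_module_simps PiE_iff\<close>)
    have "\<pi> (\<delta> s) = \<zero>\<^bsub>B\<^esub>" if "s \<in> ?S" for s
    proof -
      have c: "\<phi> s \<in> carrier A" "\<psi> s \<in> carrier A" "\<delta> s \<in> carrier A"
        using \<phi>\<psi>_FA \<delta> that by (auto simp: free_left_module_simps)
      have "(\<phi> \<oplus>\<^bsub>?FA\<^esub> \<delta>) s = \<phi> s \<oplus>\<^bsub>A\<^esub> \<delta> s"
        using that by (simp add: free_left_module_simps)
      then have "\<pi> (\<psi> s) = \<pi> (\<phi> s) \<oplus>\<^bsub>B\<^esub> \<pi> (\<delta> s)"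
        by (subst eq) (simp add: ring_hom_add[OF hom c(1,3)])
      moreover have "\<pi> (\<phi> s) = \<pi> (\<psi> s)"
        using fun_cong[OF \<phi>\<psi>(3), of s] that by (simp add: p_def)
      ultimately show ?thesis
        using B.add.l_cancel_one'[OF \<pi>_closed[OF c(1)] \<pi>_closed[OF c(3)]] by metis
    qed
    then have \<delta>_ker: "p \<delta> = p \<zero>\<^bsub>?FA\<^esub>"
      by (auto simp: p_def free_left_module_simps \<pi>_zero fun_eq_iff)
    have "h \<delta> = \<zero>\<^bsub>Y\<^esub>"
      by (rule vanish[OF _ h_single h_zero \<delta> \<delta>_ker]) (auto intro: h_add N(3))
    then show ?thesis
      using h_add[OF \<phi>\<psi>(1) N(3)[OF \<delta> \<delta>_ker]] h_closed[OF \<phi>\<psi>(1) \<phi>\<psi>(1)] eq by simp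
  qed
  have zero_KB: "p \<phi> \<in> carrier ?KB" if "p \<phi> = p \<zero>\<^bsub>?FA\<^esub>" for \<phi>
  proof -
    have "\<zero>\<^bsub>?FA\<^esub> \<in> carrier ?FA" by (simp add: free_left_module_simps)
    moreover have "free_eval A X \<zero>\<^bsub>?FA\<^esub> = \<zero>\<^bsub>X\<^esub>"
    proof -
      have "{x \<in> ?S. (\<lambda>s\<in>?S. \<zero>\<^bsub>A\<^esub>) x \<noteq> \<zero>\<^bsub>A\<^esub>} = {}" by auto
      then show ?thesis unfolding free_eval_def free_left_module_simps by (simp only: XA.M.finsum_empty)
    qed
    ultimately show ?thesis using that in_KA by (simp add: syzygy_simps)
  qed
  have fibres_K: "h \<phi> = h \<psi>" if h: "h \<in> LinearCombinations.module_hom A ?KA (restrict_scalars Y)"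
    "\<phi> \<in> carrier ?KA" "\<psi> \<in> carrier ?KA" "p \<phi> = p \<psi>" for h \<phi> \<psi>
  proof (rule fibres[OF _ _ _ h(1) _ h(2-4)])
    show "h (free_single A ?S s a) = \<zero>\<^bsub>Y\<^esub>" if "s \<in> ?S" "a \<in> carrier A" "\<pi> a = \<zero>\<^bsub>B\<^esub>" for s a
      by (rule kill[OF h(1) that(2,3,1)])
    show "\<phi> \<in> carrier ?KA" if "\<phi> \<in> carrier ?FA" "p \<phi> = p \<zero>\<^bsub>?FA\<^esub>" for \<phi>
      using in_KA[OF that(1)] zero_KB[OF that(2)] by simp
  qed (auto simp: syzygy_simps)
  have fibres_F: "h \<phi> = h \<psi>" if h: "h \<in> LinearCombinations.module_hom A ?FA (restrict_scalars Y)"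
    "\<phi> \<in> carrier ?FA" "\<psi> \<in> carrier ?FA" "p \<phi> = p \<psi>" for h \<phi> \<psi>
  proof (rule fibres[OF _ _ _ h(1) _ h(2-4)])
    show "h (free_single A ?S s a) = \<zero>\<^bsub>Y\<^esub>" if a: "s \<in> ?S" "a \<in> carrier A" "\<pi> a = \<zero>\<^bsub>B\<^esub>" for s a
    proof -
      have one: "free_single A ?S s \<one>\<^bsub>A\<^esub> \<in> carrier ?FA"
        by (rule free_single_in_carrier[OF ring_A A.one_closed])
      have "free_single A ?S s a = a \<odot>\<^bsub>?FA\<^esub> free_single A ?S s \<one>\<^bsub>A\<^esub>"
        using a by (auto simp: free_single_def free_left_module_simps intro!: restrict_ext)
      then have "h (free_single A ?S s a) = \<pi> a \<odot>\<^bsub>Y\<^esub> h (free_single A ?S s \<one>\<^bsub>A\<^esub>)"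
        using h(1) a one by (simp add: LinearCombinations.module_hom_def)
      moreover have "h (free_single A ?S s \<one>\<^bsub>A\<^esub>) \<in> carrier Y"
        using h(1) one by (auto simp: LinearCombinations.module_hom_def)
      ultimately show ?thesis using a Y.zero_smult by simp
    qed
  qed auto
  let ?HKA = "hom_space A \<iota>A ?KA (restrict_scalars Y)" and ?HKB = "hom_space B \<iota>B ?KB Y"
  let ?HFA = "hom_space A \<iota>A ?FA (restrict_scalars Y)" and ?HFB = "hom_space B \<iota>B ?FB Y"
  let ?T = "\<lambda>g. \<lambda>x\<in>carrier ?KA. g (p x)" and ?TF = "\<lambda>g. \<lambda>x\<in>carrier ?FA. g (p x)"
  have p_add_K: "p (\<phi> \<oplus>\<^bsub>?KA\<^esub> \<psi>) = p \<phi> \<oplus>\<^bsub>?KB\<^esub> p \<psi>" if "\<phi> \<in> carrier ?KA" "\<psi> \<in> carrier ?KA" for \<phi> \<psi>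
    using p_add[OF KA_FA[OF that(1)] KA_FA[OF that(2)]] by (simp add: syzygy_simps)
  have p_smult_K: "p (a \<odot>\<^bsub>?KA\<^esub> \<phi>) = \<pi> a \<odot>\<^bsub>?KB\<^esub> p \<phi>" if "a \<in> carrier A" "\<phi> \<in> carrier ?KA" for a \<phi>
    using p_smult[OF that(1) KA_FA[OF that(2)]] by (simp add: syzygy_simps)
  note K = hom_space_descent[where N = ?KA and N' = ?KB and p = p, OF Y XA.syzygy_closed p_KA p_add_K p_smult_K fibres_K]
  note F = hom_space_descent[where N = ?FA and N' = ?FB and p = p, OF Y free_left_module_closed[OF ring_A] p_FA p_add p_smult fibres_F]
  let ?WA = "(\<lambda>h. restrict h (carrier ?KA)) ` carrier ?HFA"
  let ?WB = "(\<lambda>h. restrict h (carrier ?KB)) ` carrier ?HFB"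
  have KB_FB: "carrier ?KB \<subseteq> carrier ?FB" by (auto simp: syzygy_simps)
  have res: "?T (restrict g (carrier ?KB)) = restrict (?TF g) (carrier ?KA)" for g
  proof
    have "p \<phi> \<in> carrier ?KB" if "\<phi> \<in> carrier ?KA" for \<phi> using p_KA that by blast
    then show "?T (restrict g (carrier ?KB)) \<phi> = restrict (?TF g) (carrier ?KA) \<phi>" for \<phi>
      using KA_FA[of \<phi>] by (cases "\<phi> \<in> carrier ?KA") simp_all
  qed
  \<comment> \<open>Composition with \<open>p\<close> commutes with restriction to syzygies, so it matches the two subspaces that
    are divided out.\<close>
  have WA: "?WA = ?T ` ?WB"
  proof -
    have "carrier ?HFA = ?TF ` carrier ?HFB" by (rule bij_betw_imp_surj_on[OF F(4), symmetric])
    then have "?WA = (\<lambda>g. restrict (?TF g) (carrier ?KA)) ` carrier ?HFB"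
      by (simp only: image_image)
    then show ?thesis by (simp only: image_image res)
  qed
  have WB: "LinearCombinations.submodule class_ring ?WB ?HKB"
  proof (rule submodule.intro)
    have HFB: "module class_ring ?HFB" by (rule vectorspace.axioms(1)[OF F(2)])
    note HFB_monoid = abelian_group.axioms(1)[OF module.axioms(2)[OF HFB]]
    show "module class_ring ?HKB" by (rule vectorspace.axioms(1)[OF K(2)])
    show "?WB \<subseteq> carrier ?HKB"
    proof
      fix g assume "g \<in> ?WB"
      then obtain h where h: "h \<in> carrier ?HFB" "g = restrict h (carrier ?KB)" by blast
      have sub: "\<phi> \<in> carrier ?FB" if "\<phi> \<in> carrier ?KB" for \<phi> using that KB_FB by blast
      have ops: "\<phi> \<oplus>\<^bsub>?KB\<^esub> \<psi> = \<phi> \<oplus>\<^bsub>?FB\<^esub> \<psi>" "b \<odot>\<^bsub>?KB\<^esub> \<phi> = b \<odot>\<^bsub>?FB\<^esub> \<phi>" for \<phi> \<psi> b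
        by (simp_all add: syzygy_simps)
      show "g \<in> carrier ?HKB"
        using h XB.syzygy_closed[unfolded ops] sub
        by (auto simp: hom_space_def LinearCombinations.module_hom_def ops)
    qed
    have res_add: "restrict h (carrier ?KB) \<oplus>\<^bsub>?HKB\<^esub> restrict h' (carrier ?KB)
        = restrict (h \<oplus>\<^bsub>?HFB\<^esub> h') (carrier ?KB)" for h h'
      using KB_FB by (auto simp: hom_space_def fun_eq_iff)
    have res_smult: "c \<odot>\<^bsub>?HKB\<^esub> restrict h (carrier ?KB) = restrict (c \<odot>\<^bsub>?HFB\<^esub> h) (carrier ?KB)" for c h
      using KB_FB by (auto simp: hom_space_def fun_eq_iff)
    have res_zero: "\<zero>\<^bsub>?HKB\<^esub> = restrict \<zero>\<^bsub>?HFB\<^esub> (carrier ?KB)"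
      using KB_FB by (auto simp: hom_space_def fun_eq_iff)
    show "v \<oplus>\<^bsub>?HKB\<^esub> w \<in> ?WB" if vw: "v \<in> ?WB" "w \<in> ?WB" for v w
    proof -
      obtain h h' where h: "h \<in> carrier ?HFB" "h' \<in> carrier ?HFB"
        and vw_eq: "v = restrict h (carrier ?KB)" "w = restrict h' (carrier ?KB)"
        using vw by (elim imageE)
      show ?thesis
        unfolding vw_eq res_add by (rule imageI[OF abelian_monoid.a_closed[OF HFB_monoid h]])
    qed
    show "c \<odot>\<^bsub>?HKB\<^esub> v \<in> ?WB" if cv: "c \<in> carrier class_ring" "v \<in> ?WB" for c v
    proof -
      obtain h where h: "h \<in> carrier ?HFB" and v_eq: "v = restrict h (carrier ?KB)"
        using cv(2) by (elim imageE)
      show ?thesis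
        unfolding v_eq res_smult by (rule imageI[OF module.smult_closed[OF HFB cv(1) h]])
    qed
    show "\<zero>\<^bsub>?HKB\<^esub> \<in> ?WB"
      unfolding res_zero by (rule imageI[OF abelian_monoid.zero_closed[OF HFB_monoid]])
  qed
  show ?thesis
    unfolding ext1_space_def WA
    by (rule dim_quotient_space_eq[OF K(2,1) WB K(3,4), symmetric])
qed

end

section \<open>Quotients of path algebras and simple modules\<close>

lemma ideal_image_of_surj:
  assumes h: "h \<in> Ring.ring_hom R S" and R: "ring R" and S: "ring S"
    and surj: "h ` carrier R = carrier S" and I: "ideal I R"
  shows "ideal (h ` I) S"
proof -
  interpret h: ring_hom_ring R S h by (rule ring_hom_ringI2[OF R S h])
  interpret I: ideal I R by fact
  have sub: "I \<subseteq> carrier R" by (rule I.a_subset)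
  show ?thesis
  proof (rule idealI)
    show "subgroup (h ` I) (add_monoid S)"
    proof (rule h.S.add.subgroupI)
      show "h ` I \<noteq> {}" using I.zero_closed by blast
      show "\<ominus>\<^bsub>S\<^esub> b \<in> h ` I" if b: "b \<in> h ` I" for b
      proof -
        obtain a where "a \<in> I" "b = h a" using b by blast
        then show ?thesis using sub by (intro image_eqI[of _ h "\<ominus>\<^bsub>R\<^esub> a"]) auto
      qed
      show "b \<oplus>\<^bsub>S\<^esub> c \<in> h ` I" if bc: "b \<in> h ` I" "c \<in> h ` I" for b c
      proof -
        obtain a d where "a \<in> I" "b = h a" "d \<in> I" "c = h d" using bc by blast
        then show ?thesis using sub by (intro image_eqI[of _ h "a \<oplus>\<^bsub>R\<^esub> d"]) auto
      qed
    qed (use sub in auto)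
    show "x \<otimes>\<^bsub>S\<^esub> b \<in> h ` I" "b \<otimes>\<^bsub>S\<^esub> x \<in> h ` I" if bx: "b \<in> h ` I" "x \<in> carrier S" for b x
    proof -
      obtain a y where "a \<in> I" "b = h a" "y \<in> carrier R" "x = h y" using bx surj by blast
      then have "x \<otimes>\<^bsub>S\<^esub> b = h (y \<otimes>\<^bsub>R\<^esub> a)" "b \<otimes>\<^bsub>S\<^esub> x = h (a \<otimes>\<^bsub>R\<^esub> y)"
        and "y \<otimes>\<^bsub>R\<^esub> a \<in> I" "a \<otimes>\<^bsub>R\<^esub> y \<in> I"
        using sub I.I_l_closed I.I_r_closed by auto
      then show "x \<otimes>\<^bsub>S\<^esub> b \<in> h ` I" "b \<otimes>\<^bsub>S\<^esub> x \<in> h ` I" by simp_all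
    qed
  qed (rule S)
qed

lemma const_coeff_mult: "(f \<otimes>\<^bsub>path_algebra Q\<^esub> g) (i, []) = f (i, []) * g (i, [])"
  by (simp add: path_algebra_mult last_awalk_verts)

lemma path_scalar_eq: "path_scalar Q c (u, p) = (if u \<in> verts Q \<and> p = [] then c else 0)"
  by (simp add: path_scalar_def path_algebra_simps)

lemma path_scalar_in_carrier: "path_scalar Q c \<in> carrier (path_algebra Q)"
  by (auto simp: path_algebra_simps path_scalar_eq quiver_paths_Nil)

lemma path_scalar_mult:
  assumes "wf_digraph Q" "f \<in> carrier (path_algebra Q)"
  shows "path_scalar Q c \<otimes>\<^bsub>path_algebra Q\<^esub> f = (\<lambda>w. c * f w)"
    and "f \<otimes>\<^bsub>path_algebra Q\<^esub> path_scalar Q c = (\<lambda>w. c * f w)"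
proof -
  interpret P: ring "path_algebra Q" by (rule ring_path_algebra[OF assms(1)])
  have "(path_scalar Q c \<otimes>\<^bsub>path_algebra Q\<^esub> f) (u, p) = c * (\<one>\<^bsub>path_algebra Q\<^esub> \<otimes>\<^bsub>path_algebra Q\<^esub> f) (u, p)" for u p
    by (simp only: path_algebra_mult path_scalar_def sum_distrib_left mult.assoc)
  then show "path_scalar Q c \<otimes>\<^bsub>path_algebra Q\<^esub> f = (\<lambda>w. c * f w)"
    by (simp only: P.l_one[OF assms(2)] fun_eq_iff split_paired_All) simp
  have "(f \<otimes>\<^bsub>path_algebra Q\<^esub> path_scalar Q c) (u, p) = c * (f \<otimes>\<^bsub>path_algebra Q\<^esub> \<one>\<^bsub>path_algebra Q\<^esub>) (u, p)" for u p
    by (simp only: path_algebra_mult path_scalar_def sum_distrib_left mult.left_commute)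
  then show "f \<otimes>\<^bsub>path_algebra Q\<^esub> path_scalar Q c = (\<lambda>w. c * f w)"
    by (simp only: P.r_one[OF assms(2)] fun_eq_iff split_paired_All) simp
qed

lemma path_scalar_ring_hom:
  assumes "wf_digraph Q"
  shows "path_scalar Q \<in> Ring.ring_hom class_ring (path_algebra Q)"
proof (rule ring_hom_memI)
  show "path_scalar Q (x \<otimes>\<^bsub>class_ring\<^esub> y) = path_scalar Q x \<otimes>\<^bsub>path_algebra Q\<^esub> path_scalar Q y" for x y
    unfolding path_scalar_mult(1)[OF assms path_scalar_in_carrier] by (simp add: fun_eq_iff path_scalar_eq)
qed (simp_all add: path_scalar_in_carrier fun_eq_iff path_scalar_eq path_algebra_simps(2,4))

context
  fixes Q :: "(nat, 'a) pre_digraph" and J :: "'a path_series set"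
  assumes wf: "wf_digraph Q" and J: "ideal J (path_algebra Q)"
begin

lemma path_class_hom: "path_class Q J \<in> Ring.ring_hom (path_algebra Q) (quiver_algebra Q J)"
  using ideal.rcos_ring_hom[OF J] unfolding path_class_def[abs_def] .

lemma carrier_quiver_algebra: "carrier (quiver_algebra Q J) = path_class Q J ` carrier (path_algebra Q)"
  by (auto simp: FactRing_def A_RCOSETS_def' path_class_def)

lemma ring_quiver_algebra: "ring (quiver_algebra Q J)"
  by (rule ideal.quotient_is_ring[OF J])

lemma scalar_class_hom: "scalar_class Q J \<in> Ring.ring_hom class_ring (quiver_algebra Q J)"
proof (rule ring_hom_memI)
  note s = path_scalar_ring_hom[OF wf] and c = path_class_hom and cl = path_scalar_in_carrier[of Q]
  show "scalar_class Q J (x \<otimes>\<^bsub>class_ring\<^esub> y) = scalar_class Q J x \<otimes>\<^bsub>quiver_algebra Q J\<^esub> scalar_class Q J y" for x y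
    unfolding scalar_class_def using ring_hom_mult[OF s, of x y, simplified] ring_hom_mult[OF c cl cl] by simp
  show "scalar_class Q J (x \<oplus>\<^bsub>class_ring\<^esub> y) = scalar_class Q J x \<oplus>\<^bsub>quiver_algebra Q J\<^esub> scalar_class Q J y" for x y
    unfolding scalar_class_def using ring_hom_add[OF s, of x y, simplified] ring_hom_add[OF c cl cl] by simp
  show "scalar_class Q J \<one>\<^bsub>class_ring\<^esub> = \<one>\<^bsub>quiver_algebra Q J\<^esub>"
    unfolding scalar_class_def using ring_hom_one[OF s] ring_hom_one[OF c] by simp
  show "scalar_class Q J x \<in> carrier (quiver_algebra Q J)" for x
    unfolding scalar_class_def by (rule ring_hom_closed[OF c cl])
qed

lemma scalar_class_central:
  assumes "X \<in> carrier (quiver_algebra Q J)"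
  shows "scalar_class Q J c \<otimes>\<^bsub>quiver_algebra Q J\<^esub> X = X \<otimes>\<^bsub>quiver_algebra Q J\<^esub> scalar_class Q J c"
proof -
  obtain f where f: "f \<in> carrier (path_algebra Q)" "X = path_class Q J f"
    using assms unfolding carrier_quiver_algebra by blast
  show ?thesis
    unfolding f(2) scalar_class_def
    by (simp add: ring_hom_mult[OF path_class_hom, symmetric] f(1) path_scalar_in_carrier path_scalar_mult[OF wf])
qed

context
  assumes J_const: "\<And>f u. f \<in> J \<Longrightarrow> f (u, []) = 0"
begin

text \<open>
  Two representatives of a class differ by an element of \<open>J\<close>, which has no constant terms.
\<close>

lemma simple_rep_smult: "path_class Q J f \<odot>\<^bsub>simple_rep i\<^esub> z = f (i, []) * z"
proof -
  have "\<zero>\<^bsub>path_algebra Q\<^esub> \<in> J"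
    using J by (simp add: ideal_def additive_subgroup.zero_closed)
  then have f: "f \<in> path_class Q J f"
    unfolding path_class_def a_r_coset_def'
    by (auto simp: path_algebra_simps intro!: bexI[of _ "\<lambda>_. 0"])
  define g where "g = (SOME g. g \<in> path_class Q J f)"
  have "g \<in> path_class Q J f"
    unfolding g_def by (rule someI[of "\<lambda>g. g \<in> path_class Q J f", OF f])
  then obtain j where "j \<in> J" "g = (\<lambda>w. j w + f w)"
    by (auto simp: path_class_def a_r_coset_def' path_algebra_simps)
  then have "g (i, []) = f (i, [])" using J_const by simp
  then show ?thesis by (simp add: simple_rep_def g_def)
qed

lemma left_module_simple_rep:
  assumes "i \<in> verts Q"
  shows "left_module (quiver_algebra Q J) (simple_rep i)"
proof (intro left_module.intro ring_quiver_algebra left_module_axioms.intro)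
  show "abelian_group (simple_rep i)"
    by (rule abelian_groupI) (auto simp: simple_rep_def intro: exI[of _ "- x" for x])
  have rep: "\<exists>f\<in>carrier (path_algebra Q). X = path_class Q J f" if "X \<in> carrier (quiver_algebra Q J)" for X
    using that unfolding carrier_quiver_algebra by blast
  note c = path_class_hom
  fix X assume "X \<in> carrier (quiver_algebra Q J)"
  then obtain f where f: "f \<in> carrier (path_algebra Q)" "X = path_class Q J f" using rep by blast
  show "X \<odot>\<^bsub>simple_rep i\<^esub> z \<in> carrier (simple_rep i)" for z by (simp add: simple_rep_def)
  show "X \<odot>\<^bsub>simple_rep i\<^esub> (z \<oplus>\<^bsub>simple_rep i\<^esub> z') = X \<odot>\<^bsub>simple_rep i\<^esub> z \<oplus>\<^bsub>simple_rep i\<^esub> X \<odot>\<^bsub>simple_rep i\<^esub> z'" for z z'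
    by (simp add: simple_rep_def distrib_left)
  fix Y assume "Y \<in> carrier (quiver_algebra Q J)"
  then obtain g where g: "g \<in> carrier (path_algebra Q)" "Y = path_class Q J g" using rep by blast
  show "(X \<oplus>\<^bsub>quiver_algebra Q J\<^esub> Y) \<odot>\<^bsub>simple_rep i\<^esub> z = X \<odot>\<^bsub>simple_rep i\<^esub> z \<oplus>\<^bsub>simple_rep i\<^esub> Y \<odot>\<^bsub>simple_rep i\<^esub> z" for z
    unfolding f(2) g(2) ring_hom_add[OF c f(1) g(1), symmetric] simple_rep_smult
    by (simp add: simple_rep_def distrib_right path_algebra_simps)
  show "(X \<otimes>\<^bsub>quiver_algebra Q J\<^esub> Y) \<odot>\<^bsub>simple_rep i\<^esub> z = X \<odot>\<^bsub>simple_rep i\<^esub> (Y \<odot>\<^bsub>simple_rep i\<^esub> z)" for z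
    unfolding f(2) g(2) ring_hom_mult[OF c f(1) g(1), symmetric] simple_rep_smult
    by (simp add: const_coeff_mult)
next
  show "\<one>\<^bsub>quiver_algebra Q J\<^esub> \<odot>\<^bsub>simple_rep i\<^esub> z = z" for z
    unfolding ring_hom_one[OF path_class_hom, symmetric] simple_rep_smult
    using assms by (simp add: path_algebra_simps)
qed

end
end

section \<open>Decomposition of a series by first arrows\<close>

text \<open>
  The series \<open>f\<^sub>a\<close> in \<open>f = \<Sum> f\<^sub>a a\<close>. As \<open>a\<close> is traversed first, it stands at the head of the list of
  arrows, and \<open>f\<^sub>a\<close> is supported on paths that start where \<open>a\<close> ends.
\<close>

definition strip_first_arrow :: "(nat, 'a) pre_digraph \<Rightarrow> 'a path_series \<Rightarrow> 'a \<Rightarrow> 'a path_series" where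
  "strip_first_arrow Q f a = (\<lambda>(u, q). if u = head Q a then f (tail Q a, a # q) else 0)"

lemma quiver_paths_Cons:
  assumes "wf_digraph Q"
  shows "(u, a # q) \<in> quiver_paths Q \<longleftrightarrow> a \<in> arcs Q \<and> u = tail Q a \<and> (head Q a, q) \<in> quiver_paths Q"
proof -
  interpret wf_digraph Q by fact
  show ?thesis
    by (auto simp: quiver_paths_def awalk_Cons_iff)
qed

lemma strip_first_arrow_in_carrier:
  assumes "wf_digraph Q" "f \<in> carrier (path_algebra Q)" "a \<in> arcs Q"
  shows "strip_first_arrow Q f a \<in> carrier (path_algebra Q)"
  using assms by (auto simp: path_algebra_simps strip_first_arrow_def quiver_paths_Cons)

lemma mult_arrow:
  "(g \<otimes>\<^bsub>path_algebra Q\<^esub> path_elt (tail Q a, [a])) (u, p) =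
    (case p of [] \<Rightarrow> 0 | b # q \<Rightarrow> if b = a \<and> u = tail Q a then g (head Q a, q) else 0)"
proof (cases p)
  case (Cons b q)
  have "(g \<otimes>\<^bsub>path_algebra Q\<^esub> path_elt (tail Q a, [a])) (u, p) =
      (\<Sum>k\<le>length p. if k = 1 then (if b = a \<and> u = tail Q a then g (head Q a, q) else 0) else 0)"
    unfolding path_algebra_mult
  proof (rule sum.cong)
    fix k assume "k \<in> {..length p}"
    then show "g (last (pre_digraph.awalk_verts Q u (take k p)), drop k p) * path_elt (tail Q a, [a]) (u, take k p) =
        (if k = 1 then (if b = a \<and> u = tail Q a then g (head Q a, q) else 0) else 0)"
      using Cons by (cases k) (auto simp: path_elt_def last_awalk_verts take_eq_Nil)
  qed simp
  then show ?thesis using Cons by (simp only: sum.delta finite_atMost) simp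
qed (simp add: path_algebra_mult path_elt_def)

lemma mult_vertex_left:
  "(path_elt (v, []) \<otimes>\<^bsub>path_algebra Q\<^esub> f) (u, p) = (if last (pre_digraph.awalk_verts Q u p) = v then f (u, p) else 0)"
proof -
  have "(path_elt (v, []) \<otimes>\<^bsub>path_algebra Q\<^esub> f) (u, p) =
      (\<Sum>k\<le>length p. if k = length p then (if last (pre_digraph.awalk_verts Q u p) = v then f (u, p) else 0) else 0)"
    unfolding path_algebra_mult by (intro sum.cong) (auto simp: path_elt_def)
  then show ?thesis by (simp only: sum.delta finite_atMost) simp
qed

lemma mult_vertex_right:
  "(f \<otimes>\<^bsub>path_algebra Q\<^esub> path_elt (v, [])) (u, p) = (if u = v then f (u, p) else 0)"
proof -
  have "(f \<otimes>\<^bsub>path_algebra Q\<^esub> path_elt (v, [])) (u, p) =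
      (\<Sum>k\<le>length p. if k = 0 then (if u = v then f (u, p) else 0) else 0)"
    unfolding path_algebra_mult by (intro sum.cong) (auto simp: path_elt_def last_awalk_verts)
  then show ?thesis by (simp only: sum.delta finite_atMost) simp
qed

lemma arrow_decomposition:
  assumes "wf_digraph Q" "finite (arcs Q)" "f \<in> carrier (path_algebra Q)" "\<And>u. f (u, []) = 0"
  shows "f w = (\<Sum>a\<in>arcs Q. (strip_first_arrow Q f a \<otimes>\<^bsub>path_algebra Q\<^esub> path_elt (tail Q a, [a])) w)"
proof -
  obtain u p where w: "w = (u, p)" by force
  show ?thesis
  proof (cases p)
    case Nil
    then show ?thesis using assms(4) by (simp add: w mult_arrow)
  next
    case (Cons b q)
    have "(\<Sum>a\<in>arcs Q. (strip_first_arrow Q f a \<otimes>\<^bsub>path_algebra Q\<^esub> path_elt (tail Q a, [a])) w)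
      = (\<Sum>a\<in>arcs Q. if a = b then (if u = tail Q b then f (u, b # q) else 0) else 0)"
      by (intro sum.cong) (auto simp: w Cons mult_arrow strip_first_arrow_def)
    also have "\<dots> = f (u, b # q)"
      using assms quiver_paths_Cons[OF assms(1), of u b q] by (auto simp: path_algebra_simps)
    finally show ?thesis by (simp add: w Cons)
  qed
qed

lemma ideal_const_coeff_zero:
  assumes "wf_digraph Q"
  shows "ideal {f \<in> carrier (path_algebra Q). \<forall>u. f (u, []) = 0} (path_algebra Q)" (is "ideal ?V _")
proof -
  interpret P: ring "path_algebra Q" by (rule ring_path_algebra[OF assms])
  show ?thesis
  proof (rule idealI[OF P.ring_axioms])
    show "subgroup ?V (add_monoid (path_algebra Q))"
    proof (rule P.add.subgroupI)
      show "?V \<noteq> {}" by (auto simp: path_algebra_simps)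
      show "\<ominus>\<^bsub>path_algebra Q\<^esub> f \<in> ?V" if f: "f \<in> ?V" for f
      proof -
        have "\<ominus>\<^bsub>path_algebra Q\<^esub> f = (\<lambda>w. - f w)"
          using f by (intro P.minus_equality) (auto simp: path_algebra_simps)
        then show ?thesis using f by (auto simp: path_algebra_simps)
      qed
    qed (auto simp: path_algebra_simps)
  qed (auto simp: const_coeff_mult)
qed

lemma arrow_ideal_const_coeff:
  assumes "wf_digraph Q" "f \<in> arrow_ideal Q"
  shows "f (u, []) = 0"
proof -
  have "path_elt (tail Q a, [a]) \<in> {f \<in> carrier (path_algebra Q). \<forall>u. f (u, []) = 0}" if "a \<in> arcs Q" for a
    using path_elt_in_carrier[OF arrow_in_paths[OF assms(1) that]] by (simp add: path_elt_def)
  then have "arrow_ideal Q \<subseteq> {f \<in> carrier (path_algebra Q). \<forall>u. f (u, []) = 0}"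
    unfolding arrow_ideal_def
    by (intro ring.genideal_minimal[OF ring_path_algebra[OF assms(1)] ideal_const_coeff_zero[OF assms(1)]]) blast
  then show ?thesis using assms(2) by blast
qed

section \<open>Comparison of g-vectors\<close>

locale quiver_restriction =
  fixes n :: nat and Qt :: "(nat, 'a) pre_digraph" and Jt :: "'a path_series set"
  assumes fin: "fin_digraph Qt"
    and ideal_Jt: "ideal Jt (path_algebra Qt)"
    and Jt_const: "\<And>f u. f \<in> Jt \<Longrightarrow> f (u, []) = 0"
begin

abbreviation "Q \<equiv> inner_quiver n Qt"
abbreviation "J \<equiv> inner_proj n Qt ` Jt"
abbreviation "proj \<equiv> inner_proj n Qt"
abbreviation "At \<equiv> quiver_algebra Qt Jt"
abbreviation "A \<equiv> quiver_algebra Q J"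

lemma wf: "wf_digraph Qt" and finite_arcs: "finite (arcs Qt)"
  using fin by (simp_all add: fin_digraph_def fin_digraph_axioms_def)

lemma wf_inner: "wf_digraph Q" by (rule wf_digraph_inner_quiver[OF wf])

lemma proj_hom: "proj \<in> Ring.ring_hom (path_algebra Qt) (path_algebra Q)"
  by (rule inner_proj_ring_hom[OF wf])

lemma proj_surj: "proj ` carrier (path_algebra Qt) = carrier (path_algebra Q)"
proof
  show "proj ` carrier (path_algebra Qt) \<subseteq> carrier (path_algebra Q)"
    using ring_hom_closed[OF proj_hom] by blast
  show "carrier (path_algebra Q) \<subseteq> proj ` carrier (path_algebra Qt)"
  proof
    fix f assume f: "f \<in> carrier (path_algebra Q)"
    then have "f \<in> carrier (path_algebra Qt)"
      using quiver_paths_inner_quiver[of n Qt] by (auto simp: path_algebra_simps)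
    moreover have "f = proj f" using f by (auto simp: inner_proj_def path_algebra_simps)
    ultimately show "f \<in> proj ` carrier (path_algebra Qt)" by blast
  qed
qed

lemma ideal_J: "ideal J (path_algebra Q)"
  by (rule ideal_image_of_surj[OF proj_hom ring_path_algebra[OF wf] ring_path_algebra[OF wf_inner]
        proj_surj ideal_Jt])

lemma J_const: "f \<in> J \<Longrightarrow> f (u, []) = 0"
  using Jt_const by (auto simp: inner_proj_def)

lemma image_path_class: "proj ` path_class Qt Jt f = path_class Q J (proj f)" if "f \<in> carrier (path_algebra Qt)"
proof -
  have "proj (j \<oplus>\<^bsub>path_algebra Qt\<^esub> f) = proj j \<oplus>\<^bsub>path_algebra Q\<^esub> proj f" if "j \<in> Jt" for j
    using that \<open>f \<in> carrier _\<close> ideal.Icarr[OF ideal_Jt] by (intro ring_hom_add[OF proj_hom]) auto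
  then show ?thesis
    by (simp add: path_class_def a_r_coset_def' image_UN)
qed

lemma image_proj_hom: "image proj \<in> Ring.ring_hom At A"
proof (rule ring_hom_memI)
  note ct = path_class_hom[OF wf ideal_Jt] and c = path_class_hom[OF wf_inner ideal_J]
  note closed = ring_hom_closed[OF proj_hom]
  have rep: "\<exists>f\<in>carrier (path_algebra Qt). X = path_class Qt Jt f" if "X \<in> carrier At" for X
    using that unfolding carrier_quiver_algebra[OF wf ideal_Jt] by blast
  show "proj ` \<one>\<^bsub>At\<^esub> = \<one>\<^bsub>A\<^esub>"
    unfolding ring_hom_one[OF ct, symmetric] ring_hom_one[OF c, symmetric] ring_hom_one[OF proj_hom, symmetric]
    by (rule image_path_class) (rule ring.ring_simprules(6)[OF ring_path_algebra[OF wf]])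
  fix X assume "X \<in> carrier At"
  then obtain f where f: "f \<in> carrier (path_algebra Qt)" "X = path_class Qt Jt f" using rep by blast
  show "proj ` X \<in> carrier A"
    unfolding f(2) image_path_class[OF f(1)] by (rule ring_hom_closed[OF c closed[OF f(1)]])
  fix Y assume "Y \<in> carrier At"
  then obtain g where g: "g \<in> carrier (path_algebra Qt)" "Y = path_class Qt Jt g" using rep by blast
  note R = ring.ring_simprules[OF ring_path_algebra[OF wf]]
  show "proj ` (X \<otimes>\<^bsub>At\<^esub> Y) = proj ` X \<otimes>\<^bsub>A\<^esub> proj ` Y"
    unfolding f(2) g(2) ring_hom_mult[OF ct f(1) g(1), symmetric] image_path_class[OF f(1)] image_path_class[OF g(1)]
      image_path_class[OF R(5)[OF f(1) g(1)]] ring_hom_mult[OF proj_hom f(1) g(1)]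
    by (rule ring_hom_mult[OF c closed[OF f(1)] closed[OF g(1)]])
  show "proj ` (X \<oplus>\<^bsub>At\<^esub> Y) = proj ` X \<oplus>\<^bsub>A\<^esub> proj ` Y"
    unfolding f(2) g(2) ring_hom_add[OF ct f(1) g(1), symmetric] image_path_class[OF f(1)] image_path_class[OF g(1)]
      image_path_class[OF R(1)[OF f(1) g(1)]] ring_hom_add[OF proj_hom f(1) g(1)]
    by (rule ring_hom_add[OF c closed[OF f(1)] closed[OF g(1)]])
qed

lemma image_proj_surj: "image proj ` carrier At = carrier A"
proof -
  have "image proj ` carrier At = (\<lambda>f. path_class Q J (proj f)) ` carrier (path_algebra Qt)"
    unfolding carrier_quiver_algebra[OF wf ideal_Jt] image_image by (intro image_cong refl image_path_class)
  also have "\<dots> = path_class Q J ` proj ` carrier (path_algebra Qt)"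
    by (simp only: image_image)
  also have "\<dots> = carrier A"
    by (simp only: proj_surj carrier_quiver_algebra[OF wf_inner ideal_J])
  finally show ?thesis .
qed

sublocale restriction_of_scalars At A "image proj" "scalar_class Qt Jt" "scalar_class Q J"
proof (rule restriction_of_scalars.intro)
  show "proj ` scalar_class Qt Jt c = scalar_class Q J c" for c
    unfolding scalar_class_def image_path_class[OF path_scalar_in_carrier] inner_proj_scalar ..
qed (rule ring_quiver_algebra[OF wf ideal_Jt] ring_quiver_algebra[OF wf_inner ideal_J] image_proj_hom
    image_proj_surj scalar_class_hom[OF wf ideal_Jt] scalar_class_hom[OF wf_inner ideal_J]
    scalar_class_central[OF wf ideal_Jt] scalar_class_central[OF wf_inner ideal_J], assumption?)+

lemma inflate_eq: "inflate n Qt (M, v) = (restrict_scalars M, v)"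
  by (simp add: inflate_def restrict_scalars_def)

lemma simple_rep_smult_At: "path_class Qt Jt f \<odot>\<^bsub>simple_rep i\<^esub> z = f (i, []) * z"
  by (rule simple_rep_smult[OF wf ideal_Jt]) (rule Jt_const)

lemma simple_rep_smult_A: "path_class Q J f \<odot>\<^bsub>simple_rep i\<^esub> z = f (i, []) * z"
  by (rule simple_rep_smult[OF wf_inner ideal_J]) (rule J_const)

lemma simple_rep_compat:
  assumes "i \<in> verts Qt" "X \<in> carrier At"
  shows "(proj ` X) \<odot>\<^bsub>simple_rep i\<^esub> z = X \<odot>\<^bsub>simple_rep i\<^esub> z"
proof -
  obtain f where f: "f \<in> carrier (path_algebra Qt)" "X = path_class Qt Jt f"
    using assms(2) unfolding carrier_quiver_algebra[OF wf ideal_Jt] by blast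
  have "(i, []) \<in> quiver_paths Q"
    using assms(1) by (simp add: quiver_paths_Nil) (simp add: inner_quiver_def)
  then show ?thesis
    unfolding f(2) image_path_class[OF f(1)] simple_rep_smult_At simple_rep_smult_A
    by (simp add: inner_proj_def)
qed

text \<open>
  A representative \<open>f\<close> of \<open>X\<close> has its projection in \<open>J\<close>, and every element of \<open>J\<close> is the projection of an
  element of \<open>Jt\<close>, which can be subtracted from \<open>f\<close>.
\<close>

lemma representative_in_kernel:
  assumes X: "X \<in> carrier At" and ker: "proj ` X = \<zero>\<^bsub>A\<^esub>"
  obtains f where "f \<in> carrier (path_algebra Qt)" "X = path_class Qt Jt f" "proj f = (\<lambda>_. 0)"
proof -
  interpret Pt: ring "path_algebra Qt" by (rule ring_path_algebra[OF wf])
  obtain f where f: "f \<in> carrier (path_algebra Qt)" "X = path_class Qt Jt f"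
    using X unfolding carrier_quiver_algebra[OF wf ideal_Jt] by blast
  have f_X: "f \<in> X"
    using f additive_subgroup.zero_closed[OF ideal.axioms(1)[OF ideal_Jt]]
    by (auto simp: path_class_def a_r_coset_def' path_algebra_simps intro!: bexI[of _ "\<lambda>_. 0"])
  then have "proj f \<in> J" using ker by (auto simp: FactRing_def)
  then obtain j where j: "j \<in> Jt" "proj f = proj j" by blast
  define f' where "f' = (\<lambda>w. f w - j w)"
  have jc: "j \<in> carrier (path_algebra Qt)" using ideal.Icarr[OF ideal_Jt j(1)] .
  have f'_eq: "f' = \<ominus>\<^bsub>path_algebra Qt\<^esub> j \<oplus>\<^bsub>path_algebra Qt\<^esub> f"
  proof -
    have "\<ominus>\<^bsub>path_algebra Qt\<^esub> j = (\<lambda>w. - j w)"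
      using jc by (intro Pt.minus_equality) (auto simp: path_algebra_simps)
    then show ?thesis by (simp add: f'_def path_algebra_simps)
  qed
  have "\<ominus>\<^bsub>path_algebra Qt\<^esub> j \<in> Jt"
    by (rule additive_subgroup.a_inv_closed[OF ideal.axioms(1)[OF ideal_Jt] j(1)])
  then have "f' \<in> path_class Qt Jt f"
    unfolding f'_eq path_class_def a_r_coset_def' by blast
  then have X_eq: "X = path_class Qt Jt f'"
    unfolding f(2) path_class_def
    by (intro Pt.a_repr_independence f(1) additive_subgroup.a_subgroup[OF ideal.axioms(1)[OF ideal_Jt]])
  have f'_carrier: "f' \<in> carrier (path_algebra Qt)"
    using jc f(1) by (auto simp: f'_def path_algebra_simps)
  have "proj f' = (\<lambda>_. 0)"
    using j(2) by (auto simp: f'_def inner_proj_def fun_eq_iff split: if_splits)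
  then show thesis by (rule that[OF f'_carrier X_eq])
qed

text \<open>
  A representative \<open>f\<close> of \<open>X\<close> that is killed by the projection has no constant terms, because the smaller
  quiver has the same vertices. In the sum \<open>f = \<Sum> f\<^sub>a a\<close> each term is mapped to \<open>f\<^sub>a h(a z)\<close>. For an
  arrow \<open>a\<close> of the smaller quiver \<open>f\<^sub>a\<close> is again killed by the projection and thus acts by 0. Any other
  arrow has its head or its tail outside \<open>[n]\<close>. In the first case \<open>h(a z)\<close> is fixed by an idempotent that
  acts by 0 on \<open>M\<close>. In the second case the idempotent \<open>e\<close> at the tail annihilates the simple module, so
  \<open>e z\<close> is in the syzygy; then \<open>h(e z) = e h(e z) = 0\<close> and \<open>h(a z) = a h(e z) = 0\<close>.
\<close>

lemma syzygy_hom_vanishes: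
  assumes i: "i \<in> verts Qt" "i \<in> {1..n}"
    and M: "left_module A M"
    and supp: "\<And>j x. j \<in> verts Qt \<Longrightarrow> j \<notin> {1..n} \<Longrightarrow> x \<in> carrier M \<Longrightarrow>
      path_class Q J (path_elt (j, [])) \<odot>\<^bsub>M\<^esub> x = \<zero>\<^bsub>M\<^esub>"
    and h: "h \<in> LinearCombinations.module_hom At (syzygy At (simple_rep i)) (restrict_scalars M)"
    and X: "X \<in> carrier At" "proj ` X = \<zero>\<^bsub>A\<^esub>"
    and z: "z \<in> carrier (simple_rep i :: ('a path_series set, complex) module)"
  shows "h (free_single At (carrier (simple_rep i :: ('a path_series set, complex) module)) z X) = \<zero>\<^bsub>M\<^esub>"
proof -
  interpret M: left_module A M by (rule M)
  interpret S: left_module_record At "simple_rep i"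
    unfolding left_module_record_def by (rule left_module_simple_rep[OF wf ideal_Jt _ i(1)]) (rule Jt_const)
  let ?S = "carrier (simple_rep i :: ('a path_series set, complex) module)"
  let ?P = "path_algebra Qt"
  let ?V = "{f \<in> carrier ?P. \<forall>u. f (u, []) = 0}"
  let ?single = "\<lambda>f. free_single At ?S z (path_class Qt Jt f)"
  note ct = path_class_hom[OF wf ideal_Jt]
  \<comment> \<open>The image under \<open>h\<close> of the element \<open>f z\<close>, which is in the syzygy if \<open>f\<close> has no constant term at \<open>i\<close>.\<close>
  define \<Phi> where "\<Phi> f = h (?single f)" for f

  have single_syz: "?single f \<in> carrier (syzygy At (simple_rep i))"
    if f: "f \<in> carrier ?P" "f (i, []) = 0" for f
    using S.free_eval_single[OF z ring_hom_closed[OF ct f(1)]]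
      free_single_in_carrier[OF ring_A ring_hom_closed[OF ct f(1)]] f(2)
    by (simp add: syzygy_simps simple_rep_smult_At) (simp add: simple_rep_def)
  have \<Phi>_closed: "\<Phi> f \<in> carrier M" if "f \<in> carrier ?P" "f (i, []) = 0" for f
    using h single_syz[OF that] by (auto simp: \<Phi>_def LinearCombinations.module_hom_def)
  have \<Phi>_add: "\<Phi> (\<lambda>w. f w + g w) = \<Phi> f \<oplus>\<^bsub>M\<^esub> \<Phi> g"
    if f: "f \<in> carrier ?P" "f (i, []) = 0" and g: "g \<in> carrier ?P" "g (i, []) = 0" for f g
  proof -
    have "?single (\<lambda>w. f w + g w) = ?single f \<oplus>\<^bsub>syzygy At (simple_rep i)\<^esub> ?single g"
      using ring_hom_add[OF ct f(1) g(1)] 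
      by (auto simp: syzygy_simps free_left_module_simps free_single_def path_algebra_simps intro!: restrict_ext)
    then show ?thesis
      using h single_syz[OF f] single_syz[OF g] by (simp add: \<Phi>_def LinearCombinations.module_hom_def)
  qed
  have \<Phi>_mult: "\<Phi> (g \<otimes>\<^bsub>?P\<^esub> f) = path_class Q J (proj g) \<odot>\<^bsub>M\<^esub> \<Phi> f"
    if f: "f \<in> carrier ?P" "f (i, []) = 0" and g: "g \<in> carrier ?P" for f g
  proof -
    have "?single (g \<otimes>\<^bsub>?P\<^esub> f) = path_class Qt Jt g \<odot>\<^bsub>syzygy At (simple_rep i)\<^esub> ?single f"
      using ring_hom_mult[OF ct g f(1)] ring.ring_simprules(25)[OF ring_A ring_hom_closed[OF ct g]]
      by (auto simp: syzygy_simps free_left_module_simps free_single_def intro!: restrict_ext)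
    then show ?thesis
      using h single_syz[OF f] ring_hom_closed[OF ct g]
      by (simp add: \<Phi>_def LinearCombinations.module_hom_def image_path_class[OF g])
  qed
  obtain f where f: "f \<in> carrier ?P" "X = path_class Qt Jt f" "proj f = (\<lambda>_. 0)"
    using representative_in_kernel[OF X] .
  have f_const: "f (u, []) = 0" for u
  proof (cases "u \<in> verts Qt")
    case True
    then have "(u, []) \<in> quiver_paths Q" by (simp add: quiver_paths_Nil) (simp add: inner_quiver_def)
    then show ?thesis using fun_cong[OF f(3), of "(u, [])"] by (simp add: inner_proj_def)
  qed (use f(1) in \<open>simp add: path_algebra_simps quiver_paths_Nil\<close>)
  have \<Phi>_zero: "\<Phi> (\<lambda>_. 0) = \<zero>\<^bsub>M\<^esub>"
    using \<Phi>_add[of "\<lambda>_. 0" "\<lambda>_. 0"] \<Phi>_closed[of "\<lambda>_. 0"]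
    by (simp add: path_algebra_simps M.M.add.l_cancel_one')
  let ?g = "strip_first_arrow Qt f"
  let ?p = "\<lambda>a. path_elt (tail Qt a, [a])"
  have p: "?p a \<in> carrier ?P" "\<And>u. ?p a (u, []) = 0" if "a \<in> arcs Qt" for a
    using path_elt_in_carrier[OF arrow_in_paths[OF wf that]] by (simp_all add: path_elt_def)
  have g: "?g a \<in> carrier ?P" if "a \<in> arcs Qt" for a
    by (rule strip_first_arrow_in_carrier[OF wf f(1) that])
  have frozen: "path_class Q J (proj (path_elt (j, []))) \<odot>\<^bsub>M\<^esub> x = \<zero>\<^bsub>M\<^esub>"
    if "j \<in> verts Qt" "j \<notin> {1..n}" "x \<in> carrier M" for j x
    using supp[OF that] inner_proj_idempotent[OF that(1), of n] by simp
  have vertex: "path_elt (j, []) \<in> carrier ?P" if "j \<in> verts Qt" for j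
    using that by (intro path_elt_in_carrier) (simp add: quiver_paths_Nil)
  have \<Phi>_outer: "\<Phi> (?p a) = \<zero>\<^bsub>M\<^esub>" if a: "a \<in> arcs Qt" "a \<notin> arcs Q" for a
  proof -
    have ends: "tail Qt a \<in> verts Qt" "head Qt a \<in> verts Qt"
      using wf a by (auto simp: wf_digraph_def)
    consider "head Qt a \<notin> {1..n}" | "tail Qt a \<notin> {1..n}"
      using a by (auto simp: inner_quiver_def)
    then show ?thesis
    proof cases
      case 1
      have "?p a = path_elt (head Qt a, []) \<otimes>\<^bsub>?P\<^esub> ?p a"
        by (auto simp: fun_eq_iff mult_vertex_left) (auto simp: path_elt_def last_awalk_verts)
      then have "\<Phi> (?p a) = \<Phi> (path_elt (head Qt a, []) \<otimes>\<^bsub>?P\<^esub> ?p a)" by simp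
      also have "\<dots> = path_class Q J (proj (path_elt (head Qt a, []))) \<odot>\<^bsub>M\<^esub> \<Phi> (?p a)"
        by (rule \<Phi>_mult[OF p[OF a(1)] vertex[OF ends(2)]])
      also have "\<dots> = \<zero>\<^bsub>M\<^esub>"
        by (rule frozen[OF ends(2) 1 \<Phi>_closed[OF p[OF a(1)]]])
      finally show ?thesis .
    next
      case 2
      let ?e = "path_elt (tail Qt a, []) :: 'a path_series"
      have e: "?e \<in> carrier ?P" "?e (i, []) = 0"
        using vertex[OF ends(1)] 2 i by (auto simp: path_elt_def)
      have "?e = ?e \<otimes>\<^bsub>?P\<^esub> ?e"
        by (auto simp: fun_eq_iff mult_vertex_right) (auto simp: path_elt_def)
      then have "\<Phi> ?e = \<Phi> (?e \<otimes>\<^bsub>?P\<^esub> ?e)" by simp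
      also have "\<dots> = path_class Q J (proj ?e) \<odot>\<^bsub>M\<^esub> \<Phi> ?e"
        by (rule \<Phi>_mult[OF e e(1)])
      also have "\<dots> = \<zero>\<^bsub>M\<^esub>" by (rule frozen[OF ends(1) 2 \<Phi>_closed[OF e]])
      finally have \<Phi>_e: "\<Phi> ?e = \<zero>\<^bsub>M\<^esub>" .
      have "?p a = ?p a \<otimes>\<^bsub>?P\<^esub> ?e"
        by (auto simp: fun_eq_iff mult_vertex_right) (auto simp: path_elt_def)
      then have "\<Phi> (?p a) = \<Phi> (?p a \<otimes>\<^bsub>?P\<^esub> ?e)" by simp
      also have "\<dots> = path_class Q J (proj (?p a)) \<odot>\<^bsub>M\<^esub> \<Phi> ?e"
        by (rule \<Phi>_mult[OF e p(1)[OF a(1)]])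
      finally show ?thesis
        unfolding \<Phi>_e
        using M.smult_zero ring_hom_closed[OF path_class_hom[OF wf_inner ideal_J] ring_hom_closed[OF proj_hom p(1)[OF a(1)]]]
        by simp
    qed
  qed
  have \<Phi>_term: "\<Phi> (?g a \<otimes>\<^bsub>?P\<^esub> ?p a) = \<zero>\<^bsub>M\<^esub>" if a: "a \<in> arcs Qt" for a
  proof (cases "a \<in> arcs Q")
    case True
    have "proj (?g a) w = 0" for w
    proof -
      obtain u q where w: "w = (u, q)" by force
      have "f (tail Qt a, a # q) = 0" if "(head Qt a, q) \<in> quiver_paths Q"
      proof -
        have "(tail Qt a, a # q) \<in> quiver_paths Q"
          using quiver_paths_Cons[OF wf_inner, of "tail Qt a" a q] True that by (simp add: inner_quiver_def)
        then show ?thesis using fun_cong[OF f(3), of "(tail Qt a, a # q)"] by (simp add: inner_proj_def)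
      qed
      then show ?thesis by (simp add: w inner_proj_def strip_first_arrow_def)
    qed
    then have "proj (?g a) = \<zero>\<^bsub>path_algebra Q\<^esub>" by (simp add: fun_eq_iff path_algebra_simps)
    moreover have "path_class Q J \<zero>\<^bsub>path_algebra Q\<^esub> = \<zero>\<^bsub>A\<^esub>"
      by (rule ring_hom_zero[OF path_class_hom[OF wf_inner ideal_J] ring_path_algebra[OF wf_inner] ring_B])
    ultimately show ?thesis
      using M.zero_smult[OF \<Phi>_closed[OF p[OF a]]] by (simp add: \<Phi>_mult[OF p[OF a] g[OF a]])
  next
    case False
    then show ?thesis
      using M.smult_zero ring_hom_closed[OF path_class_hom[OF wf_inner ideal_J] ring_hom_closed[OF proj_hom g[OF a]]]
      by (simp add: \<Phi>_mult[OF p[OF a] g[OF a]] \<Phi>_outer[OF a])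
  qed
  have "finite F \<Longrightarrow> F \<subseteq> arcs Qt \<Longrightarrow> \<Phi> (\<lambda>w. \<Sum>a\<in>F. (?g a \<otimes>\<^bsub>?P\<^esub> ?p a) w) = \<zero>\<^bsub>M\<^esub>" for F
  proof (induct F rule: finite_induct)
    case (insert a F)
    have t: "?g a \<otimes>\<^bsub>?P\<^esub> ?p a \<in> carrier ?P" "(?g a \<otimes>\<^bsub>?P\<^esub> ?p a) (i, []) = 0" if "a \<in> arcs Qt" for a
      using ring.ring_simprules(5)[OF ring_path_algebra[OF wf] g[OF that] p(1)[OF that]] p(2)[OF that]
      by (simp_all add: const_coeff_mult)
    have "(\<lambda>w. \<Sum>a\<in>F. (?g a \<otimes>\<^bsub>?P\<^esub> ?p a) w) \<in> carrier ?P"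
      unfolding path_algebra_simps(1)
    proof (intro allI impI sum.neutral ballI)
      fix w a assume "w \<notin> quiver_paths Qt" "a \<in> F"
      then show "(?g a \<otimes>\<^bsub>?P\<^esub> ?p a) w = 0"
        using t(1)[of a] insert.prems unfolding path_algebra_simps(1) by blast
    qed
    moreover have "(\<Sum>a\<in>F. (?g a \<otimes>\<^bsub>?P\<^esub> ?p a) (i, [])) = 0"
      using t(2) insert.prems by (intro sum.neutral) blast
    ultimately show ?case
      using \<Phi>_add[OF t[of a]] \<Phi>_term[of a] insert by simp
  qed (simp add: \<Phi>_zero)
  from this[OF finite_arcs subset_refl] have "\<Phi> f = \<zero>\<^bsub>M\<^esub>"
    by (simp only: arrow_decomposition[OF wf finite_arcs f(1) f_const, symmetric])
  then show ?thesis by (simp add: \<Phi>_def f(2))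
qed

text \<open>
  At the vertices in \<open>[n]\<close> the extended g-vector is the g-vector over the smaller algebra: neither \<open>Hom\<close>
  nor \<open>Ext\<^sup>1\<close> from the simple module changes.
\<close>

theorem g_vector_inflate:
  assumes D: "D \<in> decorated_reps Q J" "supported_in {1..n} Q J D"
    and i: "i \<in> verts Qt" "i \<in> {1..n}"
  shows "g_vector Qt Jt (inflate n Qt D) i = g_vector Q J D i"
proof -
  obtain M v where [simp]: "D = (M, v)" by force
  have M: "left_module A M" using D(1) by (simp add: decorated_reps_def)
  have verts: "verts Q = verts Qt" by (simp add: inner_quiver_def)
  have supp: "path_class Q J (path_elt (j, [])) \<odot>\<^bsub>M\<^esub> x = \<zero>\<^bsub>M\<^esub>"
    if "j \<in> verts Qt" "j \<notin> {1..n}" "x \<in> carrier M" for j x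
  proof -
    have "(\<lambda>x. path_class Q J (path_elt (j, [])) \<odot>\<^bsub>M\<^esub> x) ` carrier M = {\<zero>\<^bsub>M\<^esub>}"
      using D(2) that(1,2) by (simp add: supported_in_def vertex_part_def verts)
    then show ?thesis using that(3) by blast
  qed
  have "hom_space At (scalar_class Qt Jt) (simple_rep i) (restrict_scalars M) = hom_space A (scalar_class Q J) (simple_rep i) M"
    by (rule hom_space_restrict_scalars) (rule simple_rep_compat[OF i(1)])
  moreover have "cdim (ext1_space At (scalar_class Qt Jt) (simple_rep i) (restrict_scalars M))
      = cdim (ext1_space A (scalar_class Q J) (simple_rep i) M)"
  proof (rule dim_ext1_space_restrict_scalars[OF _ _ M])
    show "left_module At (simple_rep i)"
      by (rule left_module_simple_rep[OF wf ideal_Jt _ i(1)]) (rule Jt_const)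
    show "left_module A (simple_rep i)"
      using i(1) by (intro left_module_simple_rep[OF wf_inner ideal_J]) (simp_all add: J_const verts)
    show "(proj ` X) \<odot>\<^bsub>simple_rep i\<^esub> z = X \<odot>\<^bsub>simple_rep i\<^esub> z" if "X \<in> carrier At" for X z
      by (rule simple_rep_compat[OF i(1) that])
  qed (rule syzygy_hom_vanishes[OF i M supp])
  ultimately show ?thesis
    by (simp add: g_vector_def inflate_eq)
qed

end

section \<open>The quiver Grassmannian at dimension vector zero\<close>

lemma (in vectorspace) subspace_dim_le:
  assumes "fin_dim" and W: "VectorSpace.subspace K W V"
  shows "vectorspace.dim K (vs W) \<le> dim"
proof -
  interpret W: vectorspace K "vs W" by (rule subspace_is_vs[OF W])
  have sub: "LinearCombinations.submodule K W V" by (rule is_module[OF W])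
  then have W_V: "W \<subseteq> carrier V" by (simp add: LinearCombinations.submodule_def)
  have li: "W.lin_dep S \<longleftrightarrow> lin_dep S" if "S \<subseteq> W" for S
    by (rule span_li_not_depend(2)[OF that sub])
  let ?P = "\<lambda>S. S \<subseteq> W \<and> lin_indpt S"
  have bound: "finite S \<and> card S \<le> dim" if "?P S" for S
    using li_le_dim[OF assms(1) subset_trans[OF conjunct1[OF that] W_V] conjunct2[OF that]] by (rule conjI)
  have empty: "?P {}" by (simp add: lin_dep_def)
  have "\<exists>B. finite B \<and> maximal B ?P"
    by (rule maximal_exists[where P = ?P and B = "{}" and N = dim]) (rule bound, assumption, rule empty)
  then obtain B where B: "finite B" "maximal B ?P" by (elim exE conjE)
  then have PB: "?P B" unfolding maximal_def by (elim conjE) (intro conjI)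
  have "(\<lambda>S. S \<subseteq> carrier (vs W) \<and> W.lin_indpt S) = ?P"
    by (intro ext) (simp add: li cong: conj_cong)
  then have "W.basis B" using W.max_li_is_basis[of B] B(2) by (simp only:)
  then have "W.dim = card B" by (rule W.dim_basis[OF B(1)])
  then show ?thesis using bound[OF PB] by (simp only:)
qed

lemma abelian_rank_trivial:
  assumes G: "comm_group G" and "trivial_group G"
  shows "abelian_rank G = 0"
proof -
  interpret G: comm_group G by fact
  have carrier: "carrier G = {\<one>\<^bsub>G\<^esub>}" using assms(2) by (simp add: trivial_group_def)
  have "S = {}" if S: "S \<subseteq> carrier G"
    "\<forall>c :: 'a \<Rightarrow> int. (\<Otimes>\<^bsub>G\<^esub>s\<in>S. s [^]\<^bsub>G\<^esub> c s) = \<one>\<^bsub>G\<^esub> \<longrightarrow> (\<forall>s\<in>S. c s = 0)" for S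
  proof -
    have "(\<Otimes>\<^bsub>G\<^esub>s\<in>S. s [^]\<^bsub>G\<^esub> (1 :: int)) = \<one>\<^bsub>G\<^esub>"
      using S(1) carrier by (intro G.finprod_one_eqI) auto
    then show ?thesis using S(2)[rule_format, of "\<lambda>_. 1"] by auto
  qed
  then have "{card S | S. finite S \<and> S \<subseteq> carrier G \<and>
     (\<forall>c :: 'a \<Rightarrow> int. (\<Otimes>\<^bsub>G\<^esub>s\<in>S. s [^]\<^bsub>G\<^esub> c s) = \<one>\<^bsub>G\<^esub> \<longrightarrow> (\<forall>s\<in>S. c s = 0))} = {0}"
    by (auto intro!: exI[of _ "{}"])
  then show ?thesis by (simp add: abelian_rank_def)
qed

text \<open>
  Two distinct elements \<open>a\<close> and \<open>b\<close> of an infinite cyclic group \<open>\<phi> : G \<cong> \<int>\<close> are never independent, since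
  \<open>a\<^bsup>\<phi> b\<^esup> b\<^bsup>- \<phi> a\<^esup> = 1\<close>.
\<close>

lemma abelian_rank_infinite_cyclic:
  assumes G: "comm_group G" and "G \<cong> integer_group"
  shows "abelian_rank G = 1"
proof -
  interpret G: comm_group G by fact
  obtain \<phi> where \<phi>: "\<phi> \<in> iso G integer_group" using assms(2) by (auto simp: is_iso_def)
  then have bij: "bij_betw \<phi> (carrier G) UNIV" and hom: "\<phi> \<in> hom G integer_group"
    by (auto simp: iso_def)
  have mult: "\<phi> (x \<otimes>\<^bsub>G\<^esub> y) = \<phi> x + \<phi> y" if "x \<in> carrier G" "y \<in> carrier G" for x y
    using hom_mult[OF hom that] by simp
  have pow: "\<phi> (x [^]\<^bsub>G\<^esub> k) = k * \<phi> x" if "x \<in> carrier G" for x and k :: int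
    using hom_int_pow[OF hom that G.is_group group_integer_group, of k]
    by (simp add: group_int_pow_integer_group mult.commute)
  have one: "\<phi> \<one>\<^bsub>G\<^esub> = 0" using pow[OF G.one_closed, of 0] by simp
  have inj: "x = y" if "\<phi> x = \<phi> y" "x \<in> carrier G" "y \<in> carrier G" for x y
    using bij that by (auto simp: bij_betw_def inj_on_def)
  let ?indep = "\<lambda>S. \<forall>c :: 'a \<Rightarrow> int. (\<Otimes>\<^bsub>G\<^esub>s\<in>S. s [^]\<^bsub>G\<^esub> c s) = \<one>\<^bsub>G\<^esub> \<longrightarrow> (\<forall>s\<in>S. c s = 0)"
  have card_le: "card S \<le> 1" if S: "finite S" "S \<subseteq> carrier G" "?indep S" for S
  proof -
    have "a = b" if ab: "a \<in> S" "b \<in> S" for a b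
    proof (rule ccontr)
      assume "a \<noteq> b"
      have carr: "a \<in> carrier G" "b \<in> carrier G" using ab S by auto
      define c where "c = (\<lambda>_. 0 :: int)(a := \<phi> b, b := - \<phi> a)"
      have c: "c a = \<phi> b" "c b = - \<phi> a" using \<open>a \<noteq> b\<close> by (auto simp: c_def)
      have "(\<Otimes>\<^bsub>G\<^esub>s\<in>S. s [^]\<^bsub>G\<^esub> c s) = (\<Otimes>\<^bsub>G\<^esub>s\<in>{a, b}. s [^]\<^bsub>G\<^esub> c s)"
        using S ab by (intro G.finprod_mono_neutral_cong_left[symmetric]) (auto simp: c_def)
      also have "\<dots> = a [^]\<^bsub>G\<^esub> c a \<otimes>\<^bsub>G\<^esub> b [^]\<^bsub>G\<^esub> c b"
        using \<open>a \<noteq> b\<close> carr by simp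
      also have "\<dots> = \<one>\<^bsub>G\<^esub>"
        using carr by (intro inj) (simp_all add: mult pow one c)
      finally have prod_eq: "(\<Otimes>\<^bsub>G\<^esub>s\<in>S. s [^]\<^bsub>G\<^esub> c s) = \<one>\<^bsub>G\<^esub>" .
      have "\<forall>s\<in>S. c s = 0" by (rule S(3)[rule_format, OF prod_eq, THEN ballI])
      from bspec[OF this ab(1)] bspec[OF this ab(2)] have "\<phi> a = \<phi> b" unfolding c by simp
      then show False using inj[OF _ carr] \<open>a \<noteq> b\<close> by simp
    qed
    then show ?thesis using S(1) by (simp add: card_le_Suc0_iff_eq)
  qed
  obtain g where g: "g \<in> carrier G" "\<phi> g = 1"
  proof -
    have "1 \<in> \<phi> ` carrier G" using bij_betw_imp_surj_on[OF bij] by simp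
    then show ?thesis using that by (elim imageE) simp
  qed
  have indep_g: "?indep {g}"
  proof (intro allI impI)
    fix c :: "'a \<Rightarrow> int" assume "(\<Otimes>\<^bsub>G\<^esub>s\<in>{g}. s [^]\<^bsub>G\<^esub> c s) = \<one>\<^bsub>G\<^esub>"
    then have "g [^]\<^bsub>G\<^esub> c g = \<one>\<^bsub>G\<^esub>" using g by simp
    then show "\<forall>s\<in>{g}. c s = 0" using pow[OF g(1), of "c g"] g one by simp
  qed
  show ?thesis
    unfolding abelian_rank_def
  proof (rule cSup_eq_maximum)
    have "1 = card {g} \<and> finite {g} \<and> {g} \<subseteq> carrier G \<and> ?indep {g}"
      using g(1) indep_g by (intro conjI) simp_all
    then show "1 \<in> {card S | S. finite S \<and> S \<subseteq> carrier G \<and> ?indep S}"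
      by (intro CollectI exI)
    show "k \<le> 1" if "k \<in> {card S | S. finite S \<and> S \<subseteq> carrier G \<and> ?indep S}" for k
      using that by (elim CollectE exE conjE) (simp only: card_le)
  qed
qed

lemma euler_char_singleton:
  assumes "topspace X = {x}"
  shows "euler_char X = 1"
proof -
  have rank: "abelian_rank (homology_group (int p) X) = (if p = 0 then 1 else 0)" for p
    using abelian_rank_trivial[OF abelian_homology_group homology_dimension_axiom[OF assms, of "int p"]]
      abelian_rank_infinite_cyclic[OF abelian_homology_group homology_coefficients[OF assms]] by simp
  have "{p. abelian_rank (homology_group (int p) X) \<noteq> 0} = {0}" unfolding rank by auto
  then show ?thesis unfolding euler_char_def by (simp add: rank[of 0, simplified])
qed

lemma topspace_quotient_top: "topspace (quotient_top X q) = q ` topspace X"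
proof -
  have "{x \<in> topspace X. q x \<in> q ` topspace X} = topspace X" by auto
  then have "openin (quotient_top X q) (q ` topspace X)" by (simp add: openin_quotient_top)
  moreover have "topspace (quotient_top X q) \<subseteq> q ` topspace X"
    using openin_quotient_top[of X q "topspace (quotient_top X q)"] by simp
  ultimately show ?thesis by (meson openin_subset subset_antisym)
qed

text \<open>
  The empty tuple is the only frame of length 0.
\<close>

lemma topspace_grassmannian_0:
  assumes "vectorspace class_ring V"
  shows "topspace (grassmannian V 0) = {{\<zero>\<^bsub>V\<^esub>}}"
proof -
  interpret V: vectorspace class_ring V by fact
  have "\<not> V.lin_dep {}" by (simp add: V.lin_dep_def)
  then have "frames V 0 = {\<lambda>_. undefined}" by (simp add: frames_def)
  then show ?thesis
    by (simp add: grassmannian_def topspace_quotient_top topspace_subtopology V.span_empty)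
qed

lemma vectorspace_complex_space:
  assumes M: "left_module A M" and \<iota>: "\<iota> \<in> Ring.ring_hom class_ring A"
  shows "vectorspace class_ring (complex_space \<iota> M)"
proof -
  interpret M: left_module A M by fact
  have \<iota>_closed: "\<iota> c \<in> carrier A" for c
    using ring_hom_closed[OF \<iota>] by simp
  have \<iota>_simps: "\<iota> (c + d) = \<iota> c \<oplus>\<^bsub>A\<^esub> \<iota> d" "\<iota> (c * d) = \<iota> c \<otimes>\<^bsub>A\<^esub> \<iota> d" "\<iota> 1 = \<one>\<^bsub>A\<^esub>" for c d
    using ring_hom_add[OF \<iota>, of c d] ring_hom_mult[OF \<iota>, of c d] ring_hom_one[OF \<iota>] by simp_all
  have grp: "abelian_group (complex_space \<iota> M)"
    by (rule abelian_groupI) (auto simp: complex_space_def M.M.a_ac intro: M.M.add.l_inv_ex)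
  have "module class_ring (complex_space \<iota> M)"
  proof (rule moduleI)
    show "cring (class_ring :: complex ring)"
      by (rule domain.axioms(1)[OF field.axioms(1)[OF class_field.field_axioms]])
  qed (use grp in \<open>simp_all add: complex_space_def \<iota>_closed \<iota>_simps M.smult_closed M.smult_l_distr
      M.smult_r_distr M.smult_assoc M.smult_one\<close>)
  then show ?thesis by (rule vectorspace.intro[OF _ class_field.field_axioms])
qed

context
  fixes Q :: "(nat, 'a) pre_digraph" and J :: "'a path_series set"
    and M :: "('a path_series set, 'v) module" and n :: nat
  assumes wf: "wf_digraph Q" and J: "ideal J (path_algebra Q)"
    and M: "left_module (quiver_algebra Q J) M" and n: "{1..n} \<subseteq> verts Q"
begin

lemma vectorspace_module: "vectorspace class_ring (complex_space (scalar_class Q J) M)"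
  by (rule vectorspace_complex_space[OF M scalar_class_hom[OF wf J]])

lemma vertex_class_closed:
  assumes "j \<in> verts Q"
  shows "path_class Q J (path_elt (j, [])) \<in> carrier (quiver_algebra Q J)"
  using assms by (intro ring_hom_closed[OF path_class_hom[OF wf J]] path_elt_in_carrier)
    (simp add: quiver_paths_Nil)

lemma subspace_vertex_part:
  assumes N: "left_submodule N (quiver_algebra Q J) M" and j: "j \<in> verts Q"
  shows "VectorSpace.subspace class_ring (vertex_part Q J M N j) (complex_space (scalar_class Q J) M)"
proof -
  interpret M: left_module "quiver_algebra Q J" M by (rule M)
  let ?A = "quiver_algebra Q J" and ?V = "complex_space (scalar_class Q J) M"
  let ?e = "path_class Q J (path_elt (j, []))"
  note e = vertex_class_closed[OF j]
  have N_grp: "subgroup N (add_monoid M)"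
    and N_smult: "\<And>a x. a \<in> carrier ?A \<Longrightarrow> x \<in> N \<Longrightarrow> a \<odot>\<^bsub>M\<^esub> x \<in> N"
    using N by (auto simp: left_submodule_def)
  have N_sub: "x \<in> carrier M" if "x \<in> N" for x
    using subgroup.subset[OF N_grp] that by auto
  have s: "scalar_class Q J c \<in> carrier ?A" for c
    using ring_hom_closed[OF scalar_class_hom[OF wf J]] by simp
  have "LinearCombinations.submodule class_ring (vertex_part Q J M N j) ?V"
  proof (rule submodule.intro)
    show "module class_ring ?V" by (rule vectorspace.axioms(1)[OF vectorspace_module])
    show "vertex_part Q J M N j \<subseteq> carrier ?V"
      using N_sub M.smult_closed[OF e] by (auto simp: vertex_part_def complex_space_def)
    show "\<zero>\<^bsub>?V\<^esub> \<in> vertex_part Q J M N j"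
      using M.smult_zero[OF e] subgroup.one_closed[OF N_grp]
      by (auto simp: vertex_part_def complex_space_def intro!: image_eqI[of _ _ "\<zero>\<^bsub>M\<^esub>"])
    show "v \<oplus>\<^bsub>?V\<^esub> w \<in> vertex_part Q J M N j"
      if vw: "v \<in> vertex_part Q J M N j" "w \<in> vertex_part Q J M N j" for v w
    proof -
      obtain x y where "x \<in> N" "v = ?e \<odot>\<^bsub>M\<^esub> x" "y \<in> N" "w = ?e \<odot>\<^bsub>M\<^esub> y"
        using vw by (auto simp: vertex_part_def)
      then show ?thesis
        using M.smult_r_distr[OF e, of x y] subgroup.m_closed[OF N_grp, of x y] N_sub
        by (auto simp: vertex_part_def complex_space_def intro!: image_eqI[of _ _ "x \<oplus>\<^bsub>M\<^esub> y"])
    qed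
    show "c \<odot>\<^bsub>?V\<^esub> v \<in> vertex_part Q J M N j" if v: "v \<in> vertex_part Q J M N j" for c v
    proof -
      obtain x where x: "x \<in> N" "v = ?e \<odot>\<^bsub>M\<^esub> x" using v by (auto simp: vertex_part_def)
      have "c \<odot>\<^bsub>?V\<^esub> v = ?e \<odot>\<^bsub>M\<^esub> (scalar_class Q J c \<odot>\<^bsub>M\<^esub> x)"
        using M.smult_assoc[OF s e N_sub[OF x(1)], of c] M.smult_assoc[OF e s N_sub[OF x(1)], of c]
          scalar_class_central[OF wf J e, of c]
        by (simp add: complex_space_def x(2))
      then show ?thesis using N_smult[OF s x(1), of c] by (simp add: vertex_part_def)
    qed
  qed
  then show ?thesis using vectorspace_module by (simp add: VectorSpace.subspace_def)
qed

text \<open>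
  Finiteness of the range of summation in \<open>CC\<close>; a sum over an infinite set would be 0 by default.
  The dimension of every vertex part is bounded by that of the module.
\<close>

lemma finite_dimension_vectors:
  assumes "vectorspace.fin_dim class_ring (complex_space (scalar_class Q J) M)"
  shows "finite {e. (\<forall>j. j \<notin> {1..n} \<longrightarrow> e j = 0) \<and> subreps n Q J M e \<noteq> {}}"
proof (rule finite_subset)
  let ?V = "complex_space (scalar_class Q J) M"
  let ?E = "{e. \<forall>j. (j \<in> {1..n} \<longrightarrow> e j \<in> {..cdim ?V}) \<and> (j \<notin> {1..n} \<longrightarrow> e j = 0)}"
  show "finite ?E" by (rule finite_set_of_finite_funs) simp_all
  have "e j \<le> cdim ?V" if e: "N \<in> subreps n Q J M e" and j: "j \<in> {1..n}" for e j N
  proof -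
    have "left_submodule N (quiver_algebra Q J) M" and "e j = cdim (?V\<lparr>carrier := vertex_part Q J M N j\<rparr>)"
      using e j by (auto simp: subreps_def)
    then show ?thesis
      using vectorspace.subspace_dim_le[OF vectorspace_module assms subspace_vertex_part] j n by auto
  qed
  then show "{e. (\<forall>j. j \<notin> {1..n} \<longrightarrow> e j = 0) \<and> subreps n Q J M e \<noteq> {}} \<subseteq> ?E" by auto
qed

lemma zero_subrep: "{\<zero>\<^bsub>M\<^esub>} \<in> subreps n Q J M (\<lambda>_. 0)"
proof -
  interpret M: left_module "quiver_algebra Q J" M by (rule M)
  let ?V = "complex_space (scalar_class Q J) M"
  have N: "left_submodule {\<zero>\<^bsub>M\<^esub>} (quiver_algebra Q J) M"
    unfolding left_submodule_def using M.smult_zero M.M.add.triv_subgroup by simp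
  have "cdim (?V\<lparr>carrier := vertex_part Q J M {\<zero>\<^bsub>M\<^esub>} j\<rparr>) = 0" if "j \<in> {1..n}" for j
  proof -
    have j: "j \<in> verts Q" using that n by blast
    have part: "vertex_part Q J M {\<zero>\<^bsub>M\<^esub>} j = {\<zero>\<^bsub>?V\<^esub>}"
      using M.smult_zero[OF vertex_class_closed[OF j]] by (simp add: vertex_part_def complex_space_def)
    interpret W: vectorspace class_ring "?V\<lparr>carrier := {\<zero>\<^bsub>?V\<^esub>}\<rparr>"
      using vectorspace.subspace_is_vs[OF vectorspace_module subspace_vertex_part[OF N j]] unfolding part .
    have "W.basis {}" by (simp add: W.basis_def W.lin_dep_def W.span_empty)
    then show ?thesis using W.dim_basis[of "{}"] by (simp add: part)
  qed
  then show ?thesis using N by (simp add: subreps_def)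
qed

lemma euler_char_quiver_grassmannian_0: "euler_char (quiver_grassmannian n Q J M (\<lambda>_. 0)) = 1"
proof (rule euler_char_singleton)
  show "topspace (quiver_grassmannian n Q J M (\<lambda>_. 0)) = {{\<zero>\<^bsub>M\<^esub>}}"
    using zero_subrep
    by (simp add: quiver_grassmannian_def topspace_subtopology topspace_grassmannian_0[OF vectorspace_module])
      (simp add: complex_space_def)
qed

end

section \<open>Linear independence of pointed Laurent polynomials\<close>

lemma lookup_times_single:
  fixes p :: "'k::ab_group_add \<Rightarrow>\<^sub>0 'c::comm_ring_1"
  shows "Poly_Mapping.lookup (p * Poly_Mapping.single k v) \<alpha> = Poly_Mapping.lookup p (\<alpha> - k) * v"
proof -
  have "(\<Sum>q. Poly_Mapping.lookup (Poly_Mapping.single k v) q when \<alpha> = l + q) = (v when l = \<alpha> - k)" for l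
  proof -
    have "(\<Sum>q. Poly_Mapping.lookup (Poly_Mapping.single k v) q when \<alpha> = l + q)
        = (\<Sum>q. (v when \<alpha> = l + k) when q = k)"
      by (intro Sum_any.cong) (auto simp: lookup_single when_def)
    then show ?thesis by (auto simp: when_def eq_diff_eq)
  qed
  then show ?thesis by (simp add: lookup_mult mult_when)
qed

text \<open>
  The exponent of \<open>laurent_monom\<close>.
\<close>

definition exponent_vector :: "nat set \<Rightarrow> (nat \<Rightarrow> int) \<Rightarrow> nat \<Rightarrow>\<^sub>0 int" where
  "exponent_vector I f = (\<Sum>i\<in>I. Poly_Mapping.single i (f i))"

lemma lookup_exponent_vector:
  "finite I \<Longrightarrow> Poly_Mapping.lookup (exponent_vector I f) j = (if j \<in> I then f j else 0)"
  by (simp add: exponent_vector_def lookup_sum lookup_single when_def)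

lemma of_int_times_laurent_monom:
  "of_int k * laurent_monom I f = Poly_Mapping.single (exponent_vector I f) (of_int k)"
proof -
  have "of_int k * laurent_monom I f = Poly_Mapping.single 0 (of_int k) * Poly_Mapping.single (exponent_vector I f) 1"
    by (simp only: single_of_int laurent_monom_def exponent_vector_def)
  then show ?thesis by (simp only: mult_single add_0 mult_1_right)
qed

lemma lookup_times_monom:
  "Poly_Mapping.lookup (c * (of_int k * laurent_monom I f)) \<alpha> =
    of_int k * Poly_Mapping.lookup c (\<alpha> - exponent_vector I f)"
  by (simp add: of_int_times_laurent_monom lookup_times_single mult.commute)

lemma laurent_monom_in_laurent_ring:
  assumes "finite I"
  shows "of_int k * laurent_monom I f \<in> laurent_ring I"
proof -
  have "Poly_Mapping.keys (exponent_vector I f) \<subseteq> I"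
    using lookup_exponent_vector[OF assms] by (auto simp: in_keys_iff split: if_splits)
  then show ?thesis by (auto simp: laurent_ring_def of_int_times_laurent_monom)
qed

lemma sum_in_laurent_ring:
  assumes "\<And>e. e \<in> E \<Longrightarrow> p e \<in> laurent_ring I"
  shows "(\<Sum>e\<in>E. p e) \<in> laurent_ring I"
  using assms
proof (induct E rule: infinite_finite_induct)
  case (insert e E)
  then show ?case using Poly_Mapping.keys_add[of "p e" "sum p E"]
    by (auto simp: laurent_ring_def)
qed (auto simp: laurent_ring_def)

text \<open>
  Let \<open>F D\<close> be a sum of monomials whose degrees in the variables from \<open>A\<close> are \<open>\<gamma> D + \<beta> e\<close>, where \<open>\<beta>\<close> is additive
  and without non-trivial zeros on dimension vectors. In a linear relation pick, among the \<open>F D\<close> with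
  non-zero coefficient, one for which \<open>\<gamma> D\<close> is minimal with respect to adding values of \<open>\<beta>\<close>. Its term
  \<open>e = 0\<close> cannot be cancelled: a term of the same degree in the variables from \<open>A\<close> would come from a smaller
  \<open>\<gamma> D'\<close>, or from \<open>\<gamma> D' = \<gamma> D\<close>, that is, \<open>D' = D\<close>.
\<close>

lemma linearly_independent_over_pointed:
  fixes \<gamma> :: "'d \<Rightarrow> nat \<Rightarrow> int" and \<beta> :: "(nat \<Rightarrow> nat) \<Rightarrow> nat \<Rightarrow> int"
    and w :: "'d \<Rightarrow> (nat \<Rightarrow> nat) \<Rightarrow> int" and E :: "'d \<Rightarrow> (nat \<Rightarrow> nat) set"
  assumes I: "finite I" "A \<subseteq> I" "A \<inter> B = {}"
    and F: "\<And>D. D \<in> MM \<Longrightarrow> F D = (\<Sum>e\<in>E D. of_int (w D e) * laurent_monom I (\<lambda>i. \<beta> e i + \<gamma> D i))"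
    and E: "\<And>D. D \<in> MM \<Longrightarrow> finite (E D)" "\<And>D. D \<in> MM \<Longrightarrow> (\<lambda>_. 0) \<in> E D"
      "\<And>D e j. D \<in> MM \<Longrightarrow> e \<in> E D \<Longrightarrow> j \<notin> A \<Longrightarrow> e j = 0"
    and w: "\<And>D. D \<in> MM \<Longrightarrow> w D (\<lambda>_. 0) = 1"
    and \<beta>_add: "\<And>e e' i. \<beta> (\<lambda>j. e j + e' j) i = \<beta> e i + \<beta> e' i"
    and \<beta>_pointed: "\<And>e. (\<And>i. i \<in> A \<Longrightarrow> \<beta> e i = 0) \<Longrightarrow> (\<And>j. j \<in> A \<Longrightarrow> e j = 0)"
    and \<gamma>_inj: "\<And>D D'. D \<in> MM \<Longrightarrow> D' \<in> MM \<Longrightarrow> (\<And>i. i \<in> A \<Longrightarrow> \<gamma> D i = \<gamma> D' i) \<Longrightarrow> D = D'"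
  shows "linearly_independent_over (laurent_ring B) (F ` MM)"
  unfolding linearly_independent_over_def
proof (intro allI impI)
  fix T c
  assume T: "finite T" "T \<subseteq> F ` MM" and c: "\<forall>t\<in>T. c t \<in> laurent_ring B" and eq: "(\<Sum>t\<in>T. c t * t) = 0"
  have \<beta>_zero: "\<beta> (\<lambda>_. 0) i = 0" for i using \<beta>_add[of "\<lambda>_. 0" "\<lambda>_. 0" i] by simp
  obtain M where M: "\<And>t. t \<in> T \<Longrightarrow> M t \<in> MM" "\<And>t. t \<in> T \<Longrightarrow> F (M t) = t"
  proof
    show "inv_into MM F t \<in> MM" "F (inv_into MM F t) = t" if "t \<in> T" for t
      using T(2) that by (auto intro: inv_into_into f_inv_into_f)
  qed
  show "\<forall>t\<in>T. c t = 0"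
  proof (rule ccontr)
    assume "\<not> ?thesis"
    define T' where "T' = {t \<in> T. c t \<noteq> 0}"
    \<comment> \<open>The strict partial order: \<open>R t t'\<close> if the leading degree of \<open>t'\<close> occurs among the degrees of the
      non-leading terms of \<open>t\<close> allowed by \<open>\<beta>\<close>.\<close>
    define R where "R = (\<lambda>t t'. \<exists>e. (\<exists>j\<in>A. e j \<noteq> 0) \<and> (\<forall>i\<in>A. \<gamma> (M t') i = \<gamma> (M t) i + \<beta> e i))"
    have R_trans: "R x z" if "R x y" "R y z" for x y z
    proof -
      from that obtain e e' where e: "\<exists>j\<in>A. e j \<noteq> 0" "\<forall>i\<in>A. \<gamma> (M y) i = \<gamma> (M x) i + \<beta> e i"
        "\<forall>i\<in>A. \<gamma> (M z) i = \<gamma> (M y) i + \<beta> e' i" unfolding R_def by blast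
      show ?thesis
        unfolding R_def using e by (intro exI[of _ "\<lambda>j. e j + e' j"]) (auto simp: \<beta>_add)
    qed
    have R_irrefl: "\<not> R x x" for x
      unfolding R_def using \<beta>_pointed by fastforce
    have "\<exists>m\<in>T'. \<forall>x\<in>T'. x \<noteq> m \<longrightarrow> \<not> R x m"
    proof (rule Finite_Set.bex_min_element)
      show "finite T'" using T(1) by (simp add: T'_def)
      show "T' \<noteq> {}" using \<open>\<not> (\<forall>t\<in>T. c t = 0)\<close> by (auto simp: T'_def)
      show "transp_on T' R" using R_trans by (auto intro!: transp_onI)
      show "asymp_on T' R" using R_trans R_irrefl by (auto intro!: asymp_onI)
    qed
    then obtain t0 where t0: "t0 \<in> T'" and le: "\<forall>x\<in>T'. x \<noteq> t0 \<longrightarrow> \<not> R x t0"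
      by (rule bexE)
    have min: "\<not> R x t0" if "x \<in> T'" for x
      using le that R_irrefl[of x] by (cases "x = t0") auto
    have t0_T: "t0 \<in> T" "c t0 \<noteq> 0" using t0 by (auto simp: T'_def)
    then obtain \<kappa> where \<kappa>: "Poly_Mapping.lookup (c t0) \<kappa> \<noteq> 0"
      by (metis lookup_zero poly_mapping_eqI)
    let ?x = "\<lambda>t e. exponent_vector I (\<lambda>i. \<beta> e i + \<gamma> (M t) i)"
    \<comment> \<open>A monomial of \<open>c t0\<close> times the leading monomial of \<open>t0\<close>; its coefficient in the relation is
      the coefficient of \<open>\<kappa>\<close> in \<open>c t0\<close>.\<close>
    define \<alpha> where "\<alpha> = \<kappa> + ?x t0 (\<lambda>_. 0)"
    have outside: "Poly_Mapping.lookup \<mu> i = 0" if "t \<in> T" "Poly_Mapping.lookup (c t) \<mu> \<noteq> 0" "i \<in> A" for t \<mu> i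
    proof -
      have "Poly_Mapping.keys \<mu> \<subseteq> B"
        using c that(1,2) by (auto simp: laurent_ring_def in_keys_iff)
      then have "i \<notin> Poly_Mapping.keys \<mu>" using that(3) I(3) by blast
      then show ?thesis by (simp add: in_keys_iff)
    qed
    have other: "Poly_Mapping.lookup (c t) (\<alpha> - ?x t e) = 0"
      if t: "t \<in> T" "e \<in> E (M t)" and ne: "t \<noteq> t0 \<or> e \<noteq> (\<lambda>_. 0)" for t e
    proof (rule ccontr)
      assume nz: "Poly_Mapping.lookup (c t) (\<alpha> - ?x t e) \<noteq> 0"
      have deg: "\<gamma> (M t0) i = \<gamma> (M t) i + \<beta> e i" if "i \<in> A" for i
        using outside[OF t(1) nz that] outside[OF t0_T(1) \<kappa> that] that I(2)
        by (auto simp: \<alpha>_def lookup_add lookup_minus lookup_exponent_vector[OF I(1)] \<beta>_zero)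
      have "t \<in> T'" using t(1) nz by (auto simp: T'_def)
      then have "\<not> R t t0" by (rule min)
      moreover have "R t t0" if "\<exists>j\<in>A. e j \<noteq> 0"
        unfolding R_def using that by (intro exI[of _ e] conjI ballI deg)
      ultimately have "\<forall>j\<in>A. e j = 0" by blast
      then have "e j = 0" for j using E(3)[OF M(1)[OF t(1)] t(2), of j] by (cases "j \<in> A") simp_all
      then have e: "e = (\<lambda>_. 0)" by (rule ext)
      have "M t0 = M t"
        by (rule \<gamma>_inj[OF M(1)[OF t0_T(1)] M(1)[OF t(1)]]) (simp add: deg e \<beta>_zero)
      then have "t = t0" using M(2)[OF t(1)] M(2)[OF t0_T(1)] by simp
      then show False using ne e by simp
    qed
    have coeff: "Poly_Mapping.lookup (c t * t) \<alpha> = (if t = t0 then Poly_Mapping.lookup (c t0) \<kappa> else 0)"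
      if t: "t \<in> T" for t
    proof -
      let ?s = "\<lambda>e. of_int (w (M t) e) * Poly_Mapping.lookup (c t) (\<alpha> - ?x t e)"
      let ?m = "\<lambda>e. of_int (w (M t) e) * laurent_monom I (\<lambda>i. \<beta> e i + \<gamma> (M t) i)"
      have "t = sum ?m (E (M t))" using F[OF M(1)[OF t]] unfolding M(2)[OF t] .
      then have "c t * t = c t * sum ?m (E (M t))" by (rule arg_cong)
      also have "\<dots> = (\<Sum>e\<in>E (M t). c t * ?m e)" by (rule sum_distrib_left)
      finally have "Poly_Mapping.lookup (c t * t) \<alpha> = Poly_Mapping.lookup (\<Sum>e\<in>E (M t). c t * ?m e) \<alpha>"
        by (rule arg_cong)
      also have "\<dots> = (\<Sum>e\<in>E (M t). ?s e)"
        by (simp only: lookup_sum lookup_times_monom)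
      also have "\<dots> = (\<Sum>e\<in>{\<lambda>_. 0}. ?s e)"
        using E(1,2)[OF M(1)[OF t]] other[OF t] by (intro sum.mono_neutral_right) auto
      also have "\<dots> = (if t = t0 then Poly_Mapping.lookup (c t0) \<kappa> else 0)"
        using other[OF t E(2)[OF M(1)[OF t]]] by (auto simp: \<alpha>_def w[OF M(1)[OF t]])
      finally show ?thesis .
    qed
    have "0 = (\<Sum>t\<in>T. Poly_Mapping.lookup (c t * t) \<alpha>)"
      by (simp add: eq flip: lookup_sum)
    also have "\<dots> = Poly_Mapping.lookup (c t0) \<kappa>"
      using T(1) t0_T(1) by (simp add: coeff)
    finally show False using \<kappa> by simp
  qed
qed

section \<open>Linear independence of Caldero--Chapoton functions\<close>

lemma exchange_mult_add: "exchange_mult n Q (\<lambda>j. e j + e' j) i = exchange_mult n Q e i + exchange_mult n Q e' i"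
  by (simp add: exchange_mult_def distrib_left sum.distrib)

theorem theorem1p4:
  fixes n m :: nat
    and Qt Q :: "(nat, 'a) pre_digraph"
    and Jt J :: "'a path_series set"
    and MM :: "('a, 'v) decorated set"
  assumes "n \<ge> 1"
    and "fin_digraph Qt"
    and "verts Qt = {1..n + m}"
    and "Q = inner_quiver n Qt"
    and "ideal Jt (path_algebra Qt)"
    and "closedin (adic_topology (path_algebra Qt) (arrow_ideal Qt)) Jt"
    and "Jt \<subseteq> ideal_pow (path_algebra Qt) (arrow_ideal Qt) 2"
    and "J = inner_proj n Qt ` Jt"
    and "MM \<subseteq> {D \<in> decorated_reps Q J. supported_in {1..n} Q J D}"
    and "\<forall>e :: nat \<Rightarrow> nat. (\<forall>i\<in>{1..n}. exchange_mult n Qt e i = 0) \<longrightarrow> (\<forall>j\<in>{1..n}. e j = 0)"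
    and "\<forall>D\<in>MM. \<forall>D'\<in>MM. D \<noteq> D' \<longrightarrow> (\<exists>i\<in>{1..n}. g_vector Q J D i \<noteq> g_vector Q J D' i)"
  shows "CC n Qt Jt ` MM \<subseteq> laurent_ring {1..n + m} \<and>
    linearly_independent_over (laurent_ring {n + 1..n + m}) (CC n Qt Jt ` MM)"
proof
  have wf: "wf_digraph Qt" using assms(2) by (simp add: fin_digraph_def)
  show "CC n Qt Jt ` MM \<subseteq> laurent_ring {1..n + m}"
    unfolding CC_def assms(3) by (auto intro!: sum_in_laurent_ring laurent_monom_in_laurent_ring)
  have "ideal_pow (path_algebra Qt) (arrow_ideal Qt) 2 \<subseteq> arrow_ideal Qt"
    using ring.ideal_prod_inter[OF ring_path_algebra[OF wf] ideal_arrow_ideal[OF wf] ideal_ideal_pow[OF ideal_arrow_ideal[OF wf], of 1]]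
    by (simp add: numeral_2_eq_2)
  then have Jt_const: "f (u, []) = 0" if "f \<in> Jt" for f u
    using that assms(7) arrow_ideal_const_coeff[OF wf] by blast
  interpret quiver_restriction n Qt Jt
    by (rule quiver_restriction.intro[OF assms(2,5)]) (rule Jt_const)
  have QJ: "inner_quiver n Qt = Q" "inner_proj n Qt ` Jt = J" by (simp_all add: assms(4,8))
  have verts: "{1..n} \<subseteq> verts Q" "\<And>i. i \<in> {1..n} \<Longrightarrow> i \<in> verts Qt"
    unfolding assms(4) by (auto simp: inner_quiver_def assms(3))
  have wf_Q: "wf_digraph Q" and ideal_J: "ideal J (path_algebra Q)"
    using wf_inner ideal_J by (simp_all add: QJ)
  let ?g = "\<lambda>D. g_vector Qt Jt (inflate n Qt D)"
  let ?E = "\<lambda>D. {e. (\<forall>j. j \<notin> {1..n} \<longrightarrow> e j = 0) \<and> subreps n Q J (fst D) e \<noteq> {}}"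
  let ?w = "\<lambda>D e. euler_char (quiver_grassmannian n Q J (fst D) e)"
  have D: "D \<in> decorated_reps Q J" "supported_in {1..n} Q J D"
    and M: "left_module (quiver_algebra Q J) (fst D)"
    and fin_dim: "vectorspace.fin_dim class_ring (complex_space (scalar_class Q J) (fst D))" if "D \<in> MM" for D
    using that assms(9) by (auto simp: decorated_reps_def)
  have g: "?g D i = g_vector Q J D i" if "D \<in> MM" "i \<in> {1..n}" for D i
    using g_vector_inflate[of D i] D[OF that(1)] that(2) verts(2) unfolding QJ by blast
  show "linearly_independent_over (laurent_ring {n + 1..n + m}) (CC n Qt Jt ` MM)"
  proof (rule linearly_independent_over_pointed[where I = "verts Qt" and A = "{1..n}" and E = ?E and w = ?w
        and \<beta> = "exchange_mult n Qt" and \<gamma> = ?g])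
    show "finite (?E D)" if "D \<in> MM" for D
      by (rule finite_dimension_vectors[OF wf_Q ideal_J M[OF that] verts(1) fin_dim[OF that]])
    show "(\<lambda>_. 0) \<in> ?E D" if "D \<in> MM" for D
      using zero_subrep[OF wf_Q ideal_J M[OF that] verts(1)] by auto
    show "?w D (\<lambda>_. 0) = 1" if "D \<in> MM" for D
      by (rule euler_char_quiver_grassmannian_0[OF wf_Q ideal_J M[OF that] verts(1)])
    show "D = D'" if "D \<in> MM" "D' \<in> MM" "\<And>i. i \<in> {1..n} \<Longrightarrow> ?g D i = ?g D' i" for D D'
    proof (rule ccontr)
      assume "D \<noteq> D'"
      then obtain i where "i \<in> {1..n}" "g_vector Q J D i \<noteq> g_vector Q J D' i"
        using assms(11) \<open>D \<in> MM\<close> \<open>D' \<in> MM\<close> by blast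
      then show False using that(3)[of i] g[OF that(1)] g[OF that(2)] by simp
    qed
    show "CC n Qt Jt D = (\<Sum>e\<in>?E D. of_int (?w D e) * laurent_monom (verts Qt) (\<lambda>i. exchange_mult n Qt e i + ?g D i))"
      for D unfolding CC_def QJ ..
    show "e j = 0" if "\<And>i. i \<in> {1..n} \<Longrightarrow> exchange_mult n Qt e i = 0" "j \<in> {1..n}" for e :: "nat \<Rightarrow> nat" and j
      using assms(10) that by blast
  qed (auto simp: assms(3) exchange_mult_add)
qed

end
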